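(* Let $n \ge 2$ and let $K \subset \mathbb{R}^{2n}$ be a strongly convex body with smooth boundary. Then all characteristics on $\partial K$ are planar if and only if $K$ is a ball up to an affine symplectomorphism, i.e. there is an affine symplectomorphism of $\mathbb{R}^{2n}$ mapping $K$ onto a Euclidean ball $\{x : |x|\le r\}$ for some $r>0$.
   Context: $\mathbb{R}^{2n}$ has coordinates $(p_1,\dots,p_n,q_1,\dots,q_n)$, the standard Euclidean inner product, and the standard symplectic form $\omega=\sum_{i=1}^n dp_i\wedge dq_i$. $J$ is the standard complex structure on $\mathbb{R}^{2n}\cong\mathbb{C}^n$ (linear, $J^2=-1$). A convex body is a compact convex set with nonempty interior. "Smooth" means that the boundary is a $C^\infty$ hypersurface. A convex body with smooth boundary is strongly convex if the second fundamental form of its boundary is positive definite at every boundary point. For a convex body $K$ with smooth boundary and $z\in\partial K$, let $N_zK$ be the line of vectors normal to $\partial K$ at $z$. The characteristic direction at $z$ is the line $\ker\left(\omega|_{T_z\partial K}\right)=J N_zK$. The characteristics of $K$ are the (maximal, connected) curves on $\partial K$ whose tangent vectors at each point $z$ lie in the characteristic direction at $z$. A characteristic is planar if it lies in some affine $2$-dimensional plane of $\mathbb{R}^{2n}$. An affine symplectomorphism is an affine bijection $\mathbb{R}^{2n}\to\mathbb{R}^{2n}$ whose linear part preserves $\omega$. *)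

theory Defs
  imports "HOL-Analysis.Analysis"
begin

section \<open>Smooth hypersurfaces of a Euclidean space\<close>

text \<open>Only used for open \<open>U\<close>. In finite dimension, \<open>C\<^sup>k\<close> is equivalent to all iterated
  directional derivatives up to order \<open>k\<close> existing as derivatives of differentiable maps and
  being continuous.\<close>

fun Ck_on :: "nat \<Rightarrow> ('a::euclidean_space \<Rightarrow> 'b::real_normed_vector) \<Rightarrow> 'a set \<Rightarrow> bool" where
  "Ck_on 0 f U \<longleftrightarrow> continuous_on U f"
| "Ck_on (Suc k) f U \<longleftrightarrow>
     (\<forall>x\<in>U. f differentiable (at x)) \<and>
     (\<forall>v. Ck_on k (\<lambda>x. frechet_derivative f (at x) v) U)"

definition smooth_on :: "('a::euclidean_space \<Rightarrow> 'b::real_normed_vector) \<Rightarrow> 'a set \<Rightarrow> bool" where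
  "smooth_on f U \<longleftrightarrow> (\<forall>k. Ck_on k f U)"

definition smooth_hypersurface :: "'a::euclidean_space set \<Rightarrow> bool" where
  "smooth_hypersurface S \<longleftrightarrow>
     (\<forall>z\<in>S. \<exists>U (f :: 'a \<Rightarrow> real). open U \<and> z \<in> U \<and> smooth_on f U \<and>
        (\<forall>x\<in>U. \<exists>v. frechet_derivative f (at x) v \<noteq> 0) \<and>
        S \<inter> U = {x \<in> U. f x = 0})"

text \<open>Velocities of curves in \<open>S\<close>. On a hypersurface of class \<open>C\<^sup>1\<close> it does not matter whether
  the curves are required to be smooth or only differentiable at the base point.\<close>

definition tangent_space :: "'a::euclidean_space set \<Rightarrow> 'a \<Rightarrow> 'a set" where
  "tangent_space S z =
     {v. \<exists>(\<gamma> :: real \<Rightarrow> 'a) e. e > 0 \<and> continuous_on {-e<..<e} \<gamma> \<and> \<gamma> ` {-e<..<e} \<subseteq> S \<and>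
           \<gamma> 0 = z \<and> (\<gamma> has_vector_derivative v) (at 0)}"

definition normal_space :: "'a::euclidean_space set \<Rightarrow> 'a \<Rightarrow> 'a set" where
  "normal_space S z = orthogonal_comp (tangent_space S z)"


section \<open>Strongly convex bodies\<close>

definition convex_body :: "'a::euclidean_space set \<Rightarrow> bool" where
  "convex_body K \<longleftrightarrow> compact K \<and> convex K \<and> interior K \<noteq> {}"

definition smooth_boundary :: "'a::euclidean_space set \<Rightarrow> bool" where
  "smooth_boundary K \<longleftrightarrow> smooth_hypersurface (frontier K)"

text \<open>The next two notions are meant for convex bodies with smooth boundary and points \<open>z\<close> of
  the boundary. Of the two unit normals at \<open>z\<close>, the outer one is the one pointing away
  from \<open>K\<close>.\<close>

definition outer_unit_normal :: "'a::euclidean_space set \<Rightarrow> 'a \<Rightarrow> 'a" where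
  "outer_unit_normal K z =
     (THE \<nu>. \<nu> \<in> normal_space (frontier K) z \<and> norm \<nu> = 1 \<and> (\<forall>x\<in>K. (x - z) \<bullet> \<nu> \<le> 0))"

text \<open>\<open>II(u, v) = \<langle>D\<^sub>u \<nu>, v\<rangle>\<close> with \<open>\<nu>\<close> the outer unit normal, so that spheres have a positive
  second fundamental form. The derivative is taken within the boundary; the linear map chosen by
  \<^const>\<open>frechet_derivative\<close> is not unique there, but its values on vectors tangent to the
  boundary, the only ones at which \<open>II\<close> is used, are.\<close>

definition second_fundamental_form ::
    "'a::euclidean_space set \<Rightarrow> 'a \<Rightarrow> 'a \<Rightarrow> 'a \<Rightarrow> real" where
  "second_fundamental_form K z u v =
     frechet_derivative (outer_unit_normal K) (at z within frontier K) u \<bullet> v"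

definition strongly_convex :: "'a::euclidean_space set \<Rightarrow> bool" where
  "strongly_convex K \<longleftrightarrow>
     (\<forall>z\<in>frontier K. \<forall>v\<in>tangent_space (frontier K) z.
        v \<noteq> 0 \<longrightarrow> second_fundamental_form K z v v > 0)"


section \<open>Symplectic notions\<close>

text \<open>\<open>\<real>\<^sup>2\<^sup>n\<close> is the product \<open>\<real>\<^sup>n \<times> \<real>\<^sup>n\<close> with points \<open>(p, q)\<close>; its library inner product is the
  standard one. The form is \<open>\<omega> = \<Sum>\<^sub>i dp\<^sub>i \<and> dq\<^sub>i\<close>.\<close>

definition omega :: "(real^'n::finite) \<times> (real^'n) \<Rightarrow> (real^'n) \<times> (real^'n) \<Rightarrow> real" where
  "omega x y = (\<Sum>i\<in>UNIV. fst x $ i * snd y $ i - snd x $ i * fst y $ i)"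

definition affine_symplectomorphism ::
    "((real^'n::finite) \<times> (real^'n) \<Rightarrow> (real^'n) \<times> (real^'n)) \<Rightarrow> bool" where
  "affine_symplectomorphism \<phi> \<longleftrightarrow>
     bij \<phi> \<and>
     (\<exists>L a. linear L \<and> (\<forall>u v. omega (L u) (L v) = omega u v) \<and> (\<forall>x. \<phi> x = L x + a))"

definition characteristic_direction ::
    "((real^'n::finite) \<times> (real^'n)) set \<Rightarrow> (real^'n) \<times> (real^'n) \<Rightarrow> ((real^'n) \<times> (real^'n)) set" where
  "characteristic_direction K z =
     {v \<in> tangent_space (frontier K) z. \<forall>w\<in>tangent_space (frontier K) z. omega v w = 0}"

definition characteristic_arc ::
    "((real^'n::finite) \<times> (real^'n)) set \<Rightarrow> real set \<Rightarrow> (real \<Rightarrow> (real^'n) \<times> (real^'n)) \<Rightarrow> bool" where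
  "characteristic_arc K I \<gamma> \<longleftrightarrow>
     open I \<and> is_interval I \<and> I \<noteq> {} \<and> \<gamma> C1_differentiable_on I \<and> \<gamma> ` I \<subseteq> frontier K \<and>
     (\<forall>t\<in>I. vector_derivative \<gamma> (at t) \<noteq> 0 \<and>
            vector_derivative \<gamma> (at t) \<in> characteristic_direction K (\<gamma> t))"

text \<open>A characteristic is a maximal curve, regarded as a set of points (a leaf of the
  characteristic foliation, closed or not). Maximality is with respect to the traces of arcs, so
  that it does not depend on the parametrization.\<close>

definition characteristic ::
    "((real^'n::finite) \<times> (real^'n)) set \<Rightarrow> ((real^'n) \<times> (real^'n)) set \<Rightarrow> bool" where
  "characteristic K C \<longleftrightarrow>
     (\<exists>I \<gamma>. characteristic_arc K I \<gamma> \<and> C = \<gamma> ` I) \<and>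
     (\<forall>I \<gamma>. characteristic_arc K I \<gamma> \<and> C \<subseteq> \<gamma> ` I \<longrightarrow> \<gamma> ` I = C)"

definition planar :: "'a::euclidean_space set \<Rightarrow> bool" where
  "planar C \<longleftrightarrow> (\<exists>P. affine P \<and> aff_dim P = 2 \<and> C \<subseteq> P)"

end

theory Submission
  imports Defs "HOL-Complex_Analysis.Cauchy_Integral_Formula"
begin

text \<open>Write \<open>R\<close> for \<open>rot\<close>, so that \<open>omega x y = x \<bullet> R y\<close>. For a vector \<open>w \<noteq> 0\<close> let \<open>X w\<close> be the point
  of \<open>K\<close> at which \<open>omega _ w\<close> is maximal. The outer normal at \<open>X w\<close> is a positive multiple of \<open>R w\<close>,
  so the characteristic direction there is spanned by \<open>w\<close> itself: the boundary is parametrized by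
  its characteristic directions. Strong convexity makes this parametrization differentiable.

  Suppose that the characteristics are planar. The velocity of the characteristic through \<open>X w\<close> and
  the derivative of that velocity then stay in the direction \<open>L w\<close> of a plane. Strong convexity
  says that \<open>omega\<close> does not vanish on \<open>L w\<close>, and a connectedness argument in \<open>L w - {0}\<close> shows that
  all \<open>w' \<noteq> 0\<close> in \<open>L w\<close> have the same plane and satisfy \<open>X w' - X w \<in> L w\<close> (\<open>leaf\<close>). So the nonzero
  vectors are foliated by symplectic planes along which \<open>X\<close> varies within the plane. This step
  needs complete trajectories that are maximal characteristics; they come from Picard iteration
  for a Lipschitz extension of the characteristic field (\<open>trajectory\<close>,
  \<open>trajectory_characteristic\<close>).

  The remaining argument takes place in the dual space (\<open>planar_foliation\<close>). Let \<open>H\<close> be half the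
  width, \<open>G = H\<^sup>2 / 2\<close>, and let \<open>Y\<close> be the gradient of \<open>G\<close> with respect to \<open>omega\<close>. It maps every
  leaf to itself. Comparing the variation of \<open>Y\<close> on a leaf in directions \<open>omega\<close>-orthogonal to the
  leaf with the symmetry of the second derivative of \<open>G\<close> gives an ordinary differential equation
  for \<open>G\<close> along the leaf. It follows that \<open>G\<close> is quadratic on each leaf and that the derivative of
  \<open>Y\<close> satisfies \<open>(DY)\<^sup>2 = - m\<close> with a constant \<open>m > 0\<close> (\<open>DY_DY\<close>, \<open>m_constant\<close>). Such directions exist
  because \<open>n \<ge> 2\<close>.

  For \<open>I = Y / sqrt m\<close> this is a differential equation of Monge-Ampere type, and it has only linear
  solutions, as in Joergens' theorem: the Cayley transform of \<open>R I\<close> is a homogeneous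
  antiholomorphic map, which is linear by Liouville's theorem (\<open>linear_I\<close>). Thus \<open>I\<close> is a complex
  structure compatible with \<open>omega\<close>, and \<open>H\<close> is the square root of a quadratic form.

  The midpoint \<open>c w\<close> of \<open>X w\<close> and \<open>X (- w)\<close> is treated in the same way. The variation argument gives
  \<open>c (I w) = c w\<close>, so \<open>c\<close> is a bounded antiholomorphic map for \<open>I\<close> and therefore constant
  (\<open>c_constant\<close>). Together this determines the support function of \<open>K\<close> (\<open>support_formula\<close>), and a
  unitary basis for \<open>I\<close> and \<open>omega\<close> provides the symplectic map to a ball (\<open>ball_of_planar\<close>).

  Conversely, an affine symplectomorphism carries characteristics to characteristics, and those
  of a sphere lie on the circles in which it meets the complex lines through its centre (\<open>planar_of_ball\<close>).\<close>

section \<open>The symplectic form\<close>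

text \<open>Under \<open>(p, q) \<mapsto> p + \<i> q\<close> this is multiplication by \<open>- \<i>\<close>; it is the matrix of \<open>omega\<close> with
  respect to the inner product.\<close>

definition rot :: "(real^'n::finite) \<times> (real^'n) \<Rightarrow> (real^'n) \<times> (real^'n)" where
  "rot x = (snd x, - fst x)"

lemma omega_inner: "omega x y = x \<bullet> rot y"
  by (simp add: omega_def rot_def inner_prod_def inner_vec_def sum_subtractf sum_negf)

lemma linear_rot: "linear rot"
  by (rule linearI) (auto simp: rot_def)

lemma bounded_linear_rot: "bounded_linear rot"
  by (simp add: linear_conv_bounded_linear[symmetric] linear_rot)

lemma rot_rot [simp]: "rot (rot x) = - x"
  by (simp add: rot_def prod_eq_iff)

lemma rot_inner: "rot x \<bullet> y = - (x \<bullet> rot y)"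
  by (simp add: rot_def inner_prod_def inner_commute)

lemma rot_inner_rot [simp]: "rot x \<bullet> rot y = x \<bullet> y"
  by (simp add: rot_inner)

lemma inner_rot_self [simp]: "x \<bullet> rot x = 0"
  using rot_inner[of x x] by (simp add: inner_commute)

lemma norm_rot [simp]: "norm (rot x) = norm x"
  by (simp add: norm_eq_sqrt_inner)

lemmas rot_add = linear_add[OF linear_rot]
  and rot_diff = linear_diff[OF linear_rot]
  and rot_scaleR = linear_cmul[OF linear_rot]
  and rot_minus = linear_neg[OF linear_rot]

lemma rot_zero [simp]: "rot 0 = 0" and rot_eq_0_iff [simp]: "rot x = 0 \<longleftrightarrow> x = 0"
  using linear_0[OF linear_rot] norm_rot[of x] by (auto simp del: norm_rot)

lemma bounded_bilinear_omega:
  "bounded_bilinear (omega :: (real^'n::finite) \<times> (real^'n) \<Rightarrow> (real^'n) \<times> (real^'n) \<Rightarrow> real)"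
proof -
  have "bounded_bilinear (\<lambda>x y::(real^'n) \<times> (real^'n). x \<bullet> rot y)"
    by (rule bounded_bilinear.comp[OF bounded_bilinear_inner bounded_linear_ident bounded_linear_rot])
  moreover have "omega = (\<lambda>x y::(real^'n) \<times> (real^'n). x \<bullet> rot y)"
    by (intro ext) (rule omega_inner)
  ultimately show ?thesis by simp
qed

lemmas omega_add_left = bounded_bilinear.add_left[OF bounded_bilinear_omega]
  and omega_add_right = bounded_bilinear.add_right[OF bounded_bilinear_omega]
  and omega_diff_left = bounded_bilinear.diff_left[OF bounded_bilinear_omega]
  and omega_diff_right = bounded_bilinear.diff_right[OF bounded_bilinear_omega]
  and omega_minus_left = bounded_bilinear.minus_left[OF bounded_bilinear_omega]
  and omega_minus_right = bounded_bilinear.minus_right[OF bounded_bilinear_omega]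
  and omega_zero_left = bounded_bilinear.zero_left[OF bounded_bilinear_omega]
  and omega_zero_right = bounded_bilinear.zero_right[OF bounded_bilinear_omega]

lemma omega_scaleR_left: "omega (r *\<^sub>R x) y = r * omega x y"
  and omega_scaleR_right: "omega x (r *\<^sub>R y) = r * omega x y"
  by (simp_all add: omega_inner rot_scaleR)

lemmas omega_linear = omega_add_left omega_add_right omega_diff_left omega_diff_right
  omega_minus_left omega_minus_right omega_scaleR_left omega_scaleR_right
  omega_zero_left omega_zero_right

lemmas has_derivative_omega [derivative_intros] =
  bounded_bilinear.FDERIV[OF bounded_bilinear_omega]

lemma omega_commute: "omega x y = - omega y x"
  by (simp add: omega_inner rot_inner inner_commute[of x])

lemma omega_self [simp]: "omega x x = 0"
  by (simp add: omega_inner)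

lemma omega_nondegenerate: "(\<And>y. omega x y = 0) \<Longrightarrow> x = 0"
  using omega_inner[of x "- rot x"] by (simp add: rot_minus)

lemma continuous_on_omega [continuous_intros]:
  "continuous_on S f \<Longrightarrow> continuous_on S g \<Longrightarrow> continuous_on S (\<lambda>x. omega (f x) (g x))"
  by (rule bounded_bilinear.continuous_on[OF bounded_bilinear_omega])

lemma bounded_linear_omega_left: "bounded_linear (\<lambda>x. omega x y)"
  and bounded_linear_omega_right: "bounded_linear (omega x)"
  by (rule bounded_bilinear.bounded_linear_left[OF bounded_bilinear_omega]
      bounded_bilinear.bounded_linear_right[OF bounded_bilinear_omega])+

section \<open>Symmetry of second derivatives\<close>

text \<open>The second difference \<open>\<Delta>\<close> is symmetric in \<open>u\<close> and \<open>v\<close>. By the mean value theorem along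
  \<open>v\<close>, its quotient by \<open>s\<^sup>2\<close> tends to \<open>B u v\<close>, up to an error that the differentiability of
  the first derivative at \<open>x\<close> controls.\<close>

lemma second_derivative_symmetric:
  fixes f :: "'a::real_normed_vector \<Rightarrow> real" and g :: "'a \<Rightarrow> 'a \<Rightarrow> real"
  assumes S: "open S" "x \<in> S"
    and f: "\<And>y. y \<in> S \<Longrightarrow> (f has_derivative g y) (at y)"
    and g: "\<And>v. ((\<lambda>y. g y v) has_derivative (\<lambda>u. B u v)) (at x)"
  shows "B u v = B v u"
proof -
  define \<Delta> where "\<Delta> s u v = f (x + s *\<^sub>R u + s *\<^sub>R v) - f (x + s *\<^sub>R u) - f (x + s *\<^sub>R v) + f x"
    for s :: real and u v :: 'a
  have lim: "((\<lambda>s. \<Delta> s u v / s^2) \<longlongrightarrow> B u v) (at_right 0)" for u v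
  proof (rule tendstoI)
    fix e :: real assume e: "e > 0"
    define C where "C = 2 * norm u + 2 * norm v + 1"
    have uv: "norm u + norm v < C"
      unfolding C_def using norm_ge_zero[of u] norm_ge_zero[of v] by linarith
    have C: "C > 0" by (simp add: C_def add_nonneg_pos)
    have blB: "bounded_linear (\<lambda>u. B u v)" using g[of v] by (rule has_derivative_bounded_linear)
    obtain d1 where d1: "d1 > 0" "\<And>y. norm (y - x) < d1 \<Longrightarrow>
        \<bar>g y v - g x v - B (y - x) v\<bar> \<le> e / (4 * C) * norm (y - x)"
    proof -
      have "e / (4 * C) > 0" using e C by simp
      with g[of v] obtain d where "d > 0" "\<forall>y. norm (y - x) < d \<longrightarrow>
          norm (g y v - g x v - B (y - x) v) \<le> e / (4 * C) * norm (y - x)"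
        unfolding has_derivative_at_alt by blast
      then show ?thesis using that by auto
    qed
    obtain d2 where d2: "d2 > 0" "ball x d2 \<subseteq> S" using S open_contains_ball by blast
    define d where "d = min d1 d2 / C"
    have dpos: "d > 0" using d1(1) d2(1) C by (simp add: d_def)
    have "\<bar>\<Delta> s u v / s^2 - B u v\<bar> < e" if s: "0 < s" "s < d" for s
    proof -
      have sC: "s * C < d1" "s * C < d2" using s C by (auto simp: d_def field_simps)
      have nb: "norm ((s * a) *\<^sub>R u + (s * t) *\<^sub>R v) < s * C" if "0 \<le> t" "t \<le> 1" "0 \<le> a" "a \<le> 1" for t a
      proof -
        have "norm ((s * a) *\<^sub>R u + (s * t) *\<^sub>R v) \<le> s * a * norm u + s * t * norm v"
          using norm_triangle_ineq[of "(s * a) *\<^sub>R u" "(s * t) *\<^sub>R v"] that s by simp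
        also have "\<dots> \<le> s * norm u + s * norm v"
          using that s by (intro add_mono mult_right_mono) (auto simp: mult_left_le)
        also have "\<dots> = s * (norm u + norm v)" by (simp only: distrib_left)
        also have "\<dots> < s * C"
          by (rule mult_strict_left_mono[OF uv s(1)])
        finally show ?thesis .
      qed
      let ?h = "\<lambda>t. f (x + s *\<^sub>R u + (s * t) *\<^sub>R v) - f (x + (s * t) *\<^sub>R v)"
      let ?p = "\<lambda>a t. x + (s * a) *\<^sub>R u + (s * t) *\<^sub>R v"
      have inS: "?p a t \<in> S" if "0 \<le> t" "t \<le> 1" "0 \<le> a" "a \<le> 1" for a t
      proof -
        have "?p a t - x = (s * a) *\<^sub>R u + (s * t) *\<^sub>R v" by simp
        then have "dist (?p a t) x < d2" using nb[OF that] sC by (simp only: dist_norm)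
        then show ?thesis using d2(2) by (auto simp: dist_commute)
      qed
      have der: "(?h has_real_derivative s * (g (?p 1 t) v - g (?p 0 t) v)) (at t)"
        if t: "0 \<le> t" "t \<le> 1" for t
      proof -
        have d0: "((\<lambda>t. f (?p a t)) has_derivative (\<lambda>r. g (?p a t) ((s * r) *\<^sub>R v))) (at t)"
          if "0 \<le> a" "a \<le> 1" for a
        proof -
          have "(?p a has_derivative (\<lambda>r. (s * r) *\<^sub>R v)) (at t)"
            by (auto intro!: derivative_eq_intros)
          from has_derivative_compose[OF this, where g = f and g' = "g (?p a t)"] f[OF inS[OF t that]]
          show ?thesis by blast
        qed
        have bl: "linear (g (?p a t))" if "0 \<le> a" "a \<le> 1" for a
          using f[OF inS[OF t that]] has_derivative_linear by blast
        have h': "(?h has_derivative (\<lambda>r. g (?p 1 t) ((s * r) *\<^sub>R v) - g (?p 0 t) ((s * r) *\<^sub>R v))) (at t)"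
          using has_derivative_diff[OF d0[of 1] d0[of 0]] by simp
        have lin: "g (?p 1 t) ((s * r) *\<^sub>R v) - g (?p 0 t) ((s * r) *\<^sub>R v) =
            s * (g (?p 1 t) v - g (?p 0 t) v) * r" for r
          unfolding linear_cmul[OF bl[OF zero_le_one order_refl]] linear_cmul[OF bl[OF order_refl zero_le_one]]
          by (simp only: real_scaleR_def right_diff_distrib left_diff_distrib mult_ac)
        show ?thesis
          unfolding has_field_derivative_def by (rule h'[unfolded lin])
      qed
      \<comment> \<open>The difference \<open>\<Delta>\<close> is the increment over \<open>[0, 1]\<close> of the function \<open>?h\<close>, which
        moves along \<open>v\<close> and subtracts the values on two parallel segments.\<close>
      obtain t where t: "0 < t" "t < 1" "?h 1 - ?h 0 = (1 - 0) * (s * (g (?p 1 t) v - g (?p 0 t) v))"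
        using MVT2[of 0 1 ?h "\<lambda>t. s * (g (?p 1 t) v - g (?p 0 t) v)", OF zero_less_one der] by blast
      have eq: "\<Delta> s u v = s * (g (?p 1 t) v - g (?p 0 t) v)"
        using t(3) by (simp add: \<Delta>_def)
      define E where "E a = g (?p a t) v - g x v - B (?p a t - x) v" for a
      have Ele: "\<bar>E a\<bar> \<le> e / 4 * s" if "0 \<le> a" "a \<le> 1" for a
      proof -
        have "?p a t - x = (s * a) *\<^sub>R u + (s * t) *\<^sub>R v" by simp
        then have n: "norm (?p a t - x) < s * C"
          using nb[of t a] that t by (simp only: less_imp_le)
        then have "\<bar>E a\<bar> \<le> e / (4 * C) * norm (?p a t - x)"
          unfolding E_def using sC by (intro d1(2)) auto
        also have "\<dots> \<le> e / (4 * C) * (s * C)" using n e C by (intro mult_left_mono) auto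
        also have "\<dots> = e / 4 * s" using C by (simp only: times_divide_times_eq times_divide_eq_left) simp
        finally show ?thesis .
      qed
      have lin: "linear (\<lambda>u. B u v)" using blB by (rule bounded_linear.linear)
      have "B (?p 1 t - x) v - B (?p 0 t - x) v = s * B u v"
      proof -
        have "?p 1 t - x - (?p 0 t - x) = s *\<^sub>R u" by simp
        then show ?thesis
          unfolding linear_diff[OF lin, symmetric] by (simp only: linear_cmul[OF lin] real_scaleR_def)
      qed
      then have "g (?p 1 t) v - g (?p 0 t) v = E 1 - E 0 + s * B u v" by (simp add: E_def)
      then have "\<Delta> s u v / s^2 - B u v = (E 1 - E 0) / s"
      proof -
        have "s * (a + s * b) / s^2 - b = a / s" for a b
          using s(1) by (simp add: power2_eq_square field_simps)
        then show ?thesis using \<open>g (?p 1 t) v - g (?p 0 t) v = _\<close> by (simp only: eq)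
      qed
      moreover have "\<bar>(E 1 - E 0) / s\<bar> \<le> e / 2"
      proof -
        have "\<bar>E 1 - E 0\<bar> \<le> e / 2 * s"
          using Ele[OF zero_le_one order_refl] Ele[OF order_refl zero_le_one] by linarith
        then show ?thesis using s(1) by (simp add: pos_divide_le_eq)
      qed
      ultimately show ?thesis using e by linarith
    qed
    then show "\<forall>\<^sub>F s in at_right 0. dist (\<Delta> s u v / s\<^sup>2) (B u v) < e"
      unfolding eventually_at_right_field dist_real_def using dpos by (intro exI[of _ d]) simp
  qed
  have "\<Delta> s u v = \<Delta> s v u" for s by (simp add: \<Delta>_def algebra_simps)
  then have "((\<lambda>s. \<Delta> s u v / s^2) \<longlongrightarrow> B v u) (at_right 0)" using lim[of v u] by simp
  then show ?thesis by (rule tendsto_unique[OF trivial_limit_at_right_real lim])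
qed

section \<open>Liouville theorems for antiholomorphic maps\<close>

text \<open>The pairing of \<open>F\<close> with a fixed vector \<open>e\<close> is the real part of the function
  \<open>e \<bullet> F + \<i> (e \<bullet> I F)\<close> on the complex line \<open>a + span {b, I b}\<close>. That function is entire,
  because the derivative of \<open>F\<close> anticommutes with \<open>I\<close>, and it grows at most linearly, so it
  is affine by Liouville's theorem. The line has to avoid the origin, the only possible
  singularity of \<open>F\<close>.\<close>

lemma antiholomorphic_on_line:
  fixes F :: "'a::euclidean_space \<Rightarrow> 'a" and I :: "'a \<Rightarrow> 'a"
  assumes I: "linear I" "\<And>v. I (I v) = - v"
    and F: "\<And>x. x \<noteq> 0 \<Longrightarrow> (F has_derivative F' x) (at x)"
    and anti: "\<And>x v. x \<noteq> 0 \<Longrightarrow> F' x (I v) = - I (F' x v)"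
    and bound: "\<And>x. norm (F x) \<le> B * norm x + B'"
    and ab: "\<And>s t. a + s *\<^sub>R b + t *\<^sub>R I b \<noteq> 0"
  shows "F (a + s *\<^sub>R b) = F a + s *\<^sub>R (F (a + b) - F a)"
proof -
  have blI: "bounded_linear I" using I(1) by (simp add: linear_conv_bounded_linear)
  define p where "p \<tau> = a + Re \<tau> *\<^sub>R b + Im \<tau> *\<^sub>R I b" for \<tau>
  have p0: "p \<tau> \<noteq> 0" for \<tau> using ab by (simp add: p_def)
  have dp: "(p has_derivative (\<lambda>d. Re d *\<^sub>R b + Im d *\<^sub>R I b)) (at \<tau>)" for \<tau>
    unfolding p_def by (auto intro!: derivative_eq_intros)
  have aff: "e \<bullet> F (a + s *\<^sub>R b) = e \<bullet> F a + s * (e \<bullet> F (a + b) - e \<bullet> F a)" for e s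
  proof -
    define \<phi> where "\<phi> \<tau> = Complex (e \<bullet> F (p \<tau>)) (e \<bullet> I (F (p \<tau>)))" for \<tau>
    have "(\<phi> has_field_derivative Complex (e \<bullet> F' (p \<tau>) b) (e \<bullet> I (F' (p \<tau>) b))) (at \<tau>)" for \<tau>
    proof -
      let ?G = "F' (p \<tau>)"
      have lG: "linear ?G" using F[OF p0] has_derivative_linear by blast
      have dF: "((\<lambda>\<tau>. F (p \<tau>)) has_derivative (\<lambda>d. ?G (Re d *\<^sub>R b + Im d *\<^sub>R I b))) (at \<tau>)"
        by (rule has_derivative_compose[OF dp F[OF p0]])
      have G: "?G (Re d *\<^sub>R b + Im d *\<^sub>R I b) = Re d *\<^sub>R ?G b - Im d *\<^sub>R I (?G b)" for d
        using anti[OF p0] by (simp add: linear_add[OF lG] linear_cmul[OF lG])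
      have dIF: "((\<lambda>\<tau>. I (F (p \<tau>))) has_derivative (\<lambda>d. I (Re d *\<^sub>R ?G b - Im d *\<^sub>R I (?G b)))) (at \<tau>)"
        using bounded_linear.has_derivative[OF blI dF] by (simp add: G)
      have "(\<phi> has_derivative (\<lambda>d. complex_of_real (e \<bullet> (Re d *\<^sub>R ?G b - Im d *\<^sub>R I (?G b))) +
           \<i> * complex_of_real (e \<bullet> I (Re d *\<^sub>R ?G b - Im d *\<^sub>R I (?G b))))) (at \<tau>)"
        unfolding \<phi>_def Complex_eq
        using dF[unfolded G] dIF by (auto intro!: derivative_eq_intros)
      moreover have "complex_of_real (e \<bullet> (Re d *\<^sub>R ?G b - Im d *\<^sub>R I (?G b))) +
           \<i> * complex_of_real (e \<bullet> I (Re d *\<^sub>R ?G b - Im d *\<^sub>R I (?G b))) =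
           Complex (e \<bullet> ?G b) (e \<bullet> I (?G b)) * d" for d
        by (simp add: complex_eq_iff inner_diff_right linear_diff[OF I(1)] linear_cmul[OF I(1)] I(2)
            inner_minus_right algebra_simps)
      ultimately show ?thesis unfolding has_field_derivative_def by simp
    qed
    then have hol: "\<phi> holomorphic_on UNIV"
      unfolding holomorphic_on_def field_differentiable_def by (metis has_field_derivative_at_within)
    obtain C where C: "\<And>x. norm (I x) \<le> norm x * C" "C > 0"
      using bounded_linear.pos_bounded[OF blI] by blast
    define D where "D = \<bar>B\<bar> * (norm a + norm b + norm (I b)) + \<bar>B'\<bar>"
    have "norm (\<phi> \<tau>) \<le> (norm e * (1 + C) * D) * norm \<tau> ^ 1" if "1 \<le> norm \<tau>" for \<tau>
    proof -
      have "norm (p \<tau>) \<le> norm a + \<bar>Re \<tau>\<bar> * norm b + \<bar>Im \<tau>\<bar> * norm (I b)"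
        unfolding p_def by (smt (verit) norm_triangle_ineq norm_scaleR)
      also have "\<dots> \<le> norm \<tau> * norm a + norm \<tau> * norm b + norm \<tau> * norm (I b)"
        using that abs_Re_le_cmod[of \<tau>] abs_Im_le_cmod[of \<tau>]
        by (intro add_mono mult_right_mono) (auto simp: mult_le_cancel_right1)
      finally have "\<bar>B\<bar> * norm (p \<tau>) \<le> \<bar>B\<bar> * (norm \<tau> * (norm a + norm b + norm (I b)))"
        by (intro mult_left_mono) (auto simp: algebra_simps)
      moreover have "norm (F (p \<tau>)) \<le> \<bar>B\<bar> * norm (p \<tau>) + \<bar>B'\<bar>"
        using bound[of "p \<tau>"] by (smt (verit) mult_right_mono norm_ge_zero)
      moreover have "\<bar>B'\<bar> \<le> norm \<tau> * \<bar>B'\<bar>" using that by (simp add: mult_le_cancel_right1)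
      moreover have "norm \<tau> * D = \<bar>B\<bar> * (norm \<tau> * (norm a + norm b + norm (I b))) + norm \<tau> * \<bar>B'\<bar>"
        unfolding D_def by (simp only: distrib_left mult.left_commute)
      ultimately have nF: "norm (F (p \<tau>)) \<le> norm \<tau> * D" by linarith
      have "norm (\<phi> \<tau>) \<le> \<bar>e \<bullet> F (p \<tau>)\<bar> + \<bar>e \<bullet> I (F (p \<tau>))\<bar>"
        unfolding \<phi>_def using cmod_le[of "Complex (e \<bullet> F (p \<tau>)) (e \<bullet> I (F (p \<tau>)))"] by simp
      also have "\<dots> \<le> norm e * norm (F (p \<tau>)) + norm e * (norm (F (p \<tau>)) * C)"
      proof (rule add_mono[OF Cauchy_Schwarz_ineq2])
        show "\<bar>e \<bullet> I (F (p \<tau>))\<bar> \<le> norm e * (norm (F (p \<tau>)) * C)"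
          by (rule order_trans[OF Cauchy_Schwarz_ineq2 mult_left_mono[OF C(1) norm_ge_zero]])
      qed
      also have "\<dots> = norm e * (1 + C) * norm (F (p \<tau>))" by (simp add: distrib_left distrib_right mult.commute mult.left_commute)
      also have "\<dots> \<le> norm e * (1 + C) * (norm \<tau> * D)" using nF C by (intro mult_left_mono) auto
      finally show ?thesis unfolding power_one_right mult.assoc mult.commute[of D] .
    qed
    then have "\<phi> \<xi> = (\<Sum>k\<le>1. (deriv^^k) \<phi> 0 / fact k * \<xi> ^ k)" for \<xi>
      by (rule Liouville_polynomial[OF hol])
    from this[unfolded One_nat_def, simplified]
    have lin: "\<phi> \<xi> = \<phi> 0 + deriv \<phi> 0 * \<xi>" for \<xi> by (rule trans) simp
    have "Re (\<phi> (of_real s)) = Re (\<phi> 0) + s * (Re (\<phi> 1) - Re (\<phi> 0))"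
      unfolding lin[of "of_real s"] lin[of 1] by simp
    moreover have "Re (\<phi> (of_real r)) = e \<bullet> F (a + r *\<^sub>R b)" for r
      by (simp add: \<phi>_def p_def)
    note this[of s] this[of 0] this[of 1]
    ultimately show ?thesis by simp
  qed
  show ?thesis
  proof (rule vector_eq_ldot[THEN iffD1], rule allI)
    fix e
    show "e \<bullet> F (a + s *\<^sub>R b) = e \<bullet> (F a + s *\<^sub>R (F (a + b) - F a))"
      by (simp add: aff[of e s] inner_add_right inner_diff_right)
  qed
qed

lemma not_in_span_pair_nonzero:
  assumes "a \<notin> span {b, c}" shows "a + s *\<^sub>R b + t *\<^sub>R c \<noteq> 0"
proof
  assume "a + s *\<^sub>R b + t *\<^sub>R c = 0"
  then have "a = - (s *\<^sub>R b + t *\<^sub>R c)" by (simp only: eq_neg_iff_add_eq_0 add.assoc)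
  moreover have "s *\<^sub>R b + t *\<^sub>R c \<in> span {b, c}"
    by (intro span_add span_scale span_base) auto
  ultimately show False using assms span_neg by metis
qed

lemma exists_outside_span_pair:
  fixes b c :: "'a::euclidean_space"
  assumes "DIM('a) \<ge> 3" obtains e where "e \<notin> span {b, c}"
proof -
  have "dim (span {b, c}) \<le> card {b, c}" using dim_le_card[of "{b, c}" "{b, c}"] by (simp add: span_superset)
  also have "\<dots> \<le> 2" by (simp add: card_insert_if)
  finally have "dim (span {b, c}) < dim (UNIV :: 'a set)" using assms by simp
  then have "span {b, c} \<noteq> UNIV" by (metis less_irrefl)
  then show ?thesis using that by blast
qed

text \<open>On a line that misses the origin \<open>F\<close> is affine. Homogeneity turns the value at \<open>a + s b\<close>
  into the value at \<open>b + a / s\<close>, and for large \<open>s\<close> this identifies the slope along \<open>b\<close> as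
  \<open>F b\<close>. Lines through the origin are limits of lines that miss it, since a third direction
  exists.\<close>

lemma antiholomorphic_additive:
  fixes F :: "'a::euclidean_space \<Rightarrow> 'a" and I :: "'a \<Rightarrow> 'a"
  assumes dim: "DIM('a) \<ge> 3"
    and I: "linear I" "\<And>v. I (I v) = - v"
    and F: "\<And>x. x \<noteq> 0 \<Longrightarrow> (F has_derivative F' x) (at x)"
    and anti: "\<And>x v. x \<noteq> 0 \<Longrightarrow> F' x (I v) = - I (F' x v)"
    and bound: "\<And>x. norm (F x) \<le> B * norm x"
    and cont: "continuous_on UNIV F"
    and scale: "\<And>s x. F (s *\<^sub>R x) = s *\<^sub>R F x"
  shows "F (a + b) = F a + F b"
proof -
  have cF: "((\<lambda>t. F (x + t *\<^sub>R y)) \<longlongrightarrow> F x) (at 0)" for x y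
  proof -
    have "isCont F x" using cont by (simp add: continuous_on_eq_continuous_at)
    moreover have "((\<lambda>t. x + t *\<^sub>R y) \<longlongrightarrow> x + 0 *\<^sub>R y) (at 0)" by (intro tendsto_intros)
    ultimately show ?thesis by (intro isCont_tendsto_compose[of x F]) simp_all
  qed
  have indep: "F (a + b) = F a + F b" if a: "a \<notin> span {b, I b}" for a
  proof -
    have line: "F (a + s *\<^sub>R b) = F a + s *\<^sub>R (F (a + b) - F a)" for s
      by (rule antiholomorphic_on_line[where I = I and F' = F' and B = B and B' = 0])
        (use I F anti bound not_in_span_pair_nonzero[OF a] in auto)
    have "F (b + t *\<^sub>R a) = t *\<^sub>R F a + (F (a + b) - F a)" if "t \<noteq> 0" for t
    proof -
      have "b + t *\<^sub>R a = t *\<^sub>R (a + (1 / t) *\<^sub>R b)" using that by (simp add: scaleR_add_right)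
      then have "F (b + t *\<^sub>R a) = t *\<^sub>R (F a + (1 / t) *\<^sub>R (F (a + b) - F a))"
        by (simp only: scale line)
      then show ?thesis using that by (simp add: scaleR_add_right)
    qed
    then have ev: "\<forall>\<^sub>F t in at 0. t *\<^sub>R F a + (F (a + b) - F a) = F (b + t *\<^sub>R a)"
      by (simp add: eventually_at_filter)
    have "((\<lambda>t. t *\<^sub>R F a + (F (a + b) - F a)) \<longlongrightarrow> 0 *\<^sub>R F a + (F (a + b) - F a)) (at 0)"
      by (intro tendsto_intros)
    from tendsto_unique[OF _ cF Lim_transform_eventually[OF this ev]]
    show ?thesis by simp
  qed
  show ?thesis
  proof (cases "a \<in> span {b, I b}")
    case True
    obtain e where e: "e \<notin> span {b, I b}" by (rule exists_outside_span_pair[OF dim])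
    have "a + t *\<^sub>R e \<notin> span {b, I b}" if "t \<noteq> 0" for t
    proof
      assume "a + t *\<^sub>R e \<in> span {b, I b}"
      then have "(a + t *\<^sub>R e) - a \<in> span {b, I b}" using True by (rule span_diff)
      then have "t *\<^sub>R e \<in> span {b, I b}" by simp
      then have "(1 / t) *\<^sub>R (t *\<^sub>R e) \<in> span {b, I b}" by (rule span_scale)
      then show False using e that by simp
    qed
    then have ev: "\<forall>\<^sub>F t in at 0. F ((a + b) + t *\<^sub>R e) = F (a + t *\<^sub>R e) + F b"
      using indep[of "a + t *\<^sub>R e" for t] by (simp add: eventually_at_filter add_ac)
    have "((\<lambda>t. F (a + t *\<^sub>R e) + F b) \<longlongrightarrow> F (a + b)) (at 0)"
      by (rule Lim_transform_eventually[OF cF ev])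
    moreover have "((\<lambda>t. F (a + t *\<^sub>R e) + F b) \<longlongrightarrow> F a + F b) (at 0)"
      by (intro tendsto_add cF tendsto_const)
    ultimately show ?thesis by (rule tendsto_unique[OF trivial_limit_at])
  qed (rule indep)
qed

text \<open>A bounded map that is affine along a line is constant there, so \<open>F (a + b) = F a\<close> for
  independent complex lines. Exchanging \<open>a\<close> and \<open>b\<close> gives \<open>F a = F b\<close>; two vectors on one
  complex line are compared through a vector outside it.\<close>

lemma antiholomorphic_bounded_constant:
  fixes F :: "'a::euclidean_space \<Rightarrow> 'a" and I :: "'a \<Rightarrow> 'a"
  assumes dim: "DIM('a) \<ge> 3"
    and I: "linear I" "\<And>v. I (I v) = - v"
    and F: "\<And>x. x \<noteq> 0 \<Longrightarrow> (F has_derivative F' x) (at x)"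
    and anti: "\<And>x v. x \<noteq> 0 \<Longrightarrow> F' x (I v) = - I (F' x v)"
    and bound: "\<And>x. norm (F x) \<le> B"
    and ab: "a \<noteq> 0" "b \<noteq> 0"
  shows "F a = F b"
proof -
  have sum: "F (a + b) = F a" if a: "a \<notin> span {b, I b}" for a b
  proof (rule ccontr)
    assume "F (a + b) \<noteq> F a"
    define d where "d = norm (F (a + b) - F a)"
    have d: "d > 0" using \<open>F (a + b) \<noteq> F a\<close> by (simp add: d_def)
    define s where "s = (2 * B + 1) / d"
    have B: "B \<ge> 0" using bound[of 0] norm_ge_zero order_trans by blast
    have "F (a + s *\<^sub>R b) = F a + s *\<^sub>R (F (a + b) - F a)"
      by (rule antiholomorphic_on_line[where I = I and F' = F' and B = 0 and B' = B])
        (use I F anti bound not_in_span_pair_nonzero[OF a] in auto)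
    then have "s *\<^sub>R (F (a + b) - F a) = F (a + s *\<^sub>R b) - F a" by simp
    then have "\<bar>s\<bar> * d \<le> 2 * B"
      using norm_triangle_ineq4[of "F (a + s *\<^sub>R b)" "F a"] bound[of "a + s *\<^sub>R b"] bound[of a]
      unfolding d_def norm_scaleR[symmetric] by simp
    moreover have "\<bar>s\<bar> * d = 2 * B + 1" using d B by (simp add: s_def)
    ultimately show False by simp
  qed
  have swap: "b \<notin> span {a, I a}" if a: "a \<notin> span {b, I b}" and b: "b \<noteq> 0" for a b
  proof
    assume "b \<in> span {a, I a}"
    then obtain s t where st: "b = s *\<^sub>R a + t *\<^sub>R I a"
      unfolding span_insert span_singleton by (auto simp: algebra_simps)
    have Ib: "I b = s *\<^sub>R I a - t *\<^sub>R a"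
      unfolding st by (simp add: linear_add[OF I(1)] linear_cmul[OF I(1)] I(2))
    have "s *\<^sub>R b - t *\<^sub>R I b = (s * s + t * t) *\<^sub>R a"
      unfolding Ib unfolding st by (simp add: algebra_simps)
    moreover have "s * s + t * t \<noteq> 0" using b st by auto
    then have "a = (1 / (s * s + t * t)) *\<^sub>R ((s * s + t * t) *\<^sub>R a)"
      by (simp only: scaleR_scaleR) auto
    ultimately have "a = (1 / (s * s + t * t)) *\<^sub>R (s *\<^sub>R b - t *\<^sub>R I b)" by (simp only:)
    also have "\<dots> \<in> span {b, I b}" by (intro span_scale span_diff span_base) auto
    finally show False using a by simp
  qed
  have indep: "F a = F b" if a: "a \<notin> span {b, I b}" and b: "b \<noteq> 0" for a b
    using sum[OF a] sum[OF swap[OF a b]] by (simp add: add.commute)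
  show ?thesis
  proof (cases "a \<in> span {b, I b}")
    case True
    obtain e where e: "e \<notin> span {b, I b}" by (rule exists_outside_span_pair[OF dim])
    obtain s t where st: "a = s *\<^sub>R b + t *\<^sub>R I b"
      using True unfolding span_insert span_singleton by (auto simp: algebra_simps)
    have "I a = s *\<^sub>R I b - t *\<^sub>R b"
      unfolding st by (simp add: linear_add[OF I(1)] linear_cmul[OF I(1)] I(2))
    moreover have "s *\<^sub>R I b - t *\<^sub>R b \<in> span {b, I b}"
      by (intro span_diff span_scale span_base) auto
    ultimately have "I a \<in> span {b, I b}" by (simp only:)
    then have "span {a, I a} \<subseteq> span {b, I b}" using True by (intro span_minimal) auto
    then have "e \<notin> span {a, I a}" using e by blast
    from indep[OF this ab(1)] indep[OF e ab(2)] show ?thesis by (rule trans[OF sym])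
  next
    case False
    then show ?thesis using ab(2) by (rule indep)
  qed
qed

section \<open>Regularity of smooth functions\<close>

definition lipschitz_near :: "('a::euclidean_space \<Rightarrow> 'b::real_normed_vector) \<Rightarrow> 'a \<Rightarrow> bool" where
  "lipschitz_near F z \<longleftrightarrow>
     (\<exists>r>0. \<exists>M. \<forall>x\<in>ball z r. \<forall>y\<in>ball z r. norm (F x - F y) \<le> M * norm (x - y))"

lemma lipschitz_near_const: "lipschitz_near (\<lambda>x. c) z"
  unfolding lipschitz_near_def by (intro exI[of _ 1] conjI exI[of _ 0]) auto

lemma lipschitz_near_add:
  assumes "lipschitz_near F z" "lipschitz_near G z" shows "lipschitz_near (\<lambda>x. F x + G x) z"
proof -
  obtain r M where F: "r > 0" "\<And>x y. x \<in> ball z r \<Longrightarrow> y \<in> ball z r \<Longrightarrow> norm (F x - F y) \<le> M * norm (x - y)"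
    using assms(1) unfolding lipschitz_near_def by blast
  obtain r' M' where G: "r' > 0" "\<And>x y. x \<in> ball z r' \<Longrightarrow> y \<in> ball z r' \<Longrightarrow> norm (G x - G y) \<le> M' * norm (x - y)"
    using assms(2) unfolding lipschitz_near_def by blast
  have "norm (F x + G x - (F y + G y)) \<le> (M + M') * norm (x - y)"
    if "x \<in> ball z (min r r')" "y \<in> ball z (min r r')" for x y
  proof -
    have "norm (F x + G x - (F y + G y)) \<le> norm (F x - F y) + norm (G x - G y)"
      using norm_triangle_ineq[of "F x - F y" "G x - G y"] by (simp add: algebra_simps)
    also have "\<dots> \<le> M * norm (x - y) + M' * norm (x - y)" using F(2)[of x y] G(2)[of x y] that by simp
    finally show ?thesis by (simp add: distrib_right)
  qed
  then show ?thesis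
    unfolding lipschitz_near_def using F(1) G(1)
    by (intro exI[of _ "min r r'"] conjI exI[of _ "M + M'"]) auto
qed

lemma lipschitz_near_sum:
  "finite A \<Longrightarrow> (\<And>i. i \<in> A \<Longrightarrow> lipschitz_near (F i) z) \<Longrightarrow> lipschitz_near (\<lambda>x. \<Sum>i\<in>A. F i x) z"
  by (induction A rule: finite_induct) (auto intro: lipschitz_near_const lipschitz_near_add)

lemma lipschitz_near_scaleR_left:
  assumes "lipschitz_near (F :: _ \<Rightarrow> real) z" shows "lipschitz_near (\<lambda>x. F x *\<^sub>R b) z"
proof -
  obtain r M where F: "r > 0" "\<And>x y. x \<in> ball z r \<Longrightarrow> y \<in> ball z r \<Longrightarrow> norm (F x - F y) \<le> M * norm (x - y)"
    using assms unfolding lipschitz_near_def by blast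
  have "norm (F x *\<^sub>R b - F y *\<^sub>R b) \<le> (M * norm b) * norm (x - y)"
    if "x \<in> ball z r" "y \<in> ball z r" for x y
    using mult_right_mono[OF F(2)[OF that] norm_ge_zero[of b]]
    by (simp add: mult.commute mult.left_commute flip: scaleR_diff_left)
  then show ?thesis unfolding lipschitz_near_def using F(1) by blast
qed

text \<open>The operator norms of the derivatives are bounded on a compact ball by the sum of the
  bounds for the partial derivatives.\<close>

lemma lipschitz_near_C1:
  fixes g :: "'a::euclidean_space \<Rightarrow> real"
  assumes g: "Ck_on (Suc 0) g U" and U: "open U" "z \<in> U"
  shows "lipschitz_near g z"
proof -
  obtain r where r: "r > 0" "cball z r \<subseteq> U" using U open_contains_cball by blast
  define g' where "g' x = frechet_derivative g (at x)" for x
  have d: "(g has_derivative g' x) (at x)" if "x \<in> U" for x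
    using g that frechet_derivative_works unfolding g'_def by auto
  have "\<exists>M. \<forall>x\<in>cball z r. \<bar>g' x b\<bar> \<le> M" for b
  proof -
    have "continuous_on (cball z r) (\<lambda>x. g' x b)"
      using g r(2) unfolding g'_def by (auto intro: continuous_on_subset)
    then have "bounded ((\<lambda>x. g' x b) ` cball z r)"
      by (intro compact_imp_bounded compact_continuous_image) auto
    then show ?thesis unfolding bounded_iff by auto
  qed
  then obtain M where M: "\<And>b x. x \<in> cball z r \<Longrightarrow> \<bar>g' x b\<bar> \<le> M b" by metis
  have on: "onorm (g' x) \<le> (\<Sum>b\<in>Basis. M b)" if x: "x \<in> cball z r" for x
  proof (rule onorm_le)
    fix v
    have lin: "linear (g' x)" using d r(2) x has_derivative_linear by blast
    have "g' x v = (\<Sum>b\<in>Basis. (v \<bullet> b) * g' x b)"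
      using arg_cong[OF euclidean_representation[of v], of "g' x"]
      by (simp add: linear_sum[OF lin] linear_cmul[OF lin])
    then have "norm (g' x v) \<le> (\<Sum>b\<in>Basis. \<bar>(v \<bullet> b) * g' x b\<bar>)" by (simp add: sum_abs)
    also have "\<dots> \<le> (\<Sum>b\<in>Basis. norm v * M b)"
      unfolding abs_mult by (intro sum_mono mult_mono Basis_le_norm M x) auto
    finally show "norm (g' x v) \<le> (\<Sum>b\<in>Basis. M b) * norm v" by (simp add: sum_distrib_left mult.commute)
  qed
  have "norm (g x - g y) \<le> (\<Sum>b\<in>Basis. M b) * norm (x - y)" if "x \<in> ball z r" "y \<in> ball z r" for x y
    by (rule differentiable_bound[of "cball z r" g g', OF convex_cball
          has_derivative_at_withinI[OF d[OF subsetD[OF r(2)]]] on]) (use that in auto)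
  then show ?thesis unfolding lipschitz_near_def using r(1) by blast
qed

lemma norm_normalize_diff:
  fixes a b :: "'a::real_normed_vector"
  assumes "a \<noteq> 0" "b \<noteq> 0"
  shows "norm (a /\<^sub>R norm a - b /\<^sub>R norm b) \<le> 2 * norm (a - b) / norm a"
proof -
  have "norm a *\<^sub>R (a /\<^sub>R norm a - b /\<^sub>R norm b) = (a - b) + (1 - norm a / norm b) *\<^sub>R b"
    using assms by (simp add: algebra_simps divide_inverse)
  then have "norm a * norm (a /\<^sub>R norm a - b /\<^sub>R norm b) = norm ((a - b) + (1 - norm a / norm b) *\<^sub>R b)"
    by (metis abs_norm_cancel norm_scaleR)
  also have "\<dots> \<le> norm (a - b) + \<bar>1 - norm a / norm b\<bar> * norm b"
    using norm_triangle_ineq[of "a - b" "(1 - norm a / norm b) *\<^sub>R b"] by simp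
  also have "\<bar>1 - norm a / norm b\<bar> * norm b = \<bar>norm b - norm a\<bar>"
  proof -
    have "\<bar>1 - norm a / norm b\<bar> * norm b = \<bar>(1 - norm a / norm b) * norm b\<bar>" by (simp add: abs_mult)
    also have "(1 - norm a / norm b) * norm b = norm b - norm a" using assms(2) by (simp add: left_diff_distrib)
    finally show ?thesis .
  qed
  also have "\<dots> \<le> norm (a - b)" using norm_triangle_ineq3[of b a] by (simp add: norm_minus_commute)
  finally show ?thesis using assms(1) by (simp add: pos_le_divide_eq mult.commute)
qed

lemma lipschitz_near_normalize:
  assumes F: "lipschitz_near F z" and nz: "F z \<noteq> 0"
  shows "lipschitz_near (\<lambda>x. F x /\<^sub>R norm (F x)) z"
proof -
  obtain r M where M: "r > 0" "\<And>x y. x \<in> ball z r \<Longrightarrow> y \<in> ball z r \<Longrightarrow> norm (F x - F y) \<le> M * norm (x - y)"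
    using F unfolding lipschitz_near_def by blast
  define m where "m = norm (F z) / 2"
  have m: "m > 0" using nz by (simp add: m_def)
  define r' where "r' = min r (m / (\<bar>M\<bar> + 1))"
  have r': "r' > 0" using M(1) m by (simp add: r'_def)
  have big: "norm (F x) \<ge> m" if x: "x \<in> ball z r'" for x
  proof -
    have "norm (F z - F x) \<le> M * norm (z - x)" using M x by (intro M(2)) (auto simp: r'_def)
    also have "\<dots> \<le> (\<bar>M\<bar> + 1) * norm (z - x)" by (intro mult_right_mono) auto
    also have "\<dots> \<le> (\<bar>M\<bar> + 1) * (m / (\<bar>M\<bar> + 1))"
      using x by (intro mult_left_mono) (auto simp: r'_def dist_norm)
    also have "\<dots> = m" by (simp add: add_nonneg_eq_0_iff)
    finally show ?thesis using norm_triangle_ineq2[of "F z" "F x"] by (simp add: m_def)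
  qed
  have "norm (F x /\<^sub>R norm (F x) - F y /\<^sub>R norm (F y)) \<le> (2 * \<bar>M\<bar> / m) * norm (x - y)"
    if xy: "x \<in> ball z r'" "y \<in> ball z r'" for x y
  proof -
    have nz': "F x \<noteq> 0" "F y \<noteq> 0" using big[OF xy(1)] big[OF xy(2)] m by auto
    have "norm (F x - F y) \<le> M * norm (x - y)" using xy by (intro M(2)) (auto simp: r'_def)
    also have "\<dots> \<le> \<bar>M\<bar> * norm (x - y)" by (intro mult_right_mono) auto
    finally have "2 * norm (F x - F y) / norm (F x) \<le> 2 * (\<bar>M\<bar> * norm (x - y)) / m"
      using big[OF xy(1)] m by (intro frac_le) auto
    then show ?thesis using norm_normalize_diff[OF nz'] by (simp add: mult.assoc)
  qed
  then show ?thesis unfolding lipschitz_near_def using r' by blast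
qed

definition gradient :: "('a::euclidean_space \<Rightarrow> real) \<Rightarrow> 'a \<Rightarrow> 'a" where
  "gradient f x = (\<Sum>b\<in>Basis. frechet_derivative f (at x) b *\<^sub>R b)"

lemma gradient_inner:
  assumes "f differentiable (at x)"
  shows "gradient f x \<bullet> v = frechet_derivative f (at x) v"
proof -
  have lin: "linear (frechet_derivative f (at x))"
    using assms frechet_derivative_works has_derivative_linear by blast
  have "frechet_derivative f (at x) v = frechet_derivative f (at x) (\<Sum>b\<in>Basis. (v \<bullet> b) *\<^sub>R b)"
    by (simp only: euclidean_representation)
  also have "\<dots> = (\<Sum>b\<in>Basis. (v \<bullet> b) * frechet_derivative f (at x) b)"
    by (simp only: linear_sum[OF lin] linear_cmul[OF lin] real_scaleR_def)
  also have "\<dots> = gradient f x \<bullet> v"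
    unfolding gradient_def inner_sum_left inner_scaleR_left
    by (rule sum.cong[OF refl]) (simp add: inner_commute)
  finally show ?thesis ..
qed

lemma gradient_derivative:
  assumes "f differentiable (at x)"
  shows "(f has_derivative (\<lambda>v. gradient f x \<bullet> v)) (at x)"
  using assms by (simp add: gradient_inner frechet_derivative_works)

lemma
  assumes f: "Ck_on (Suc (Suc 0)) f U" and U: "open U" "z \<in> U"
  shows gradient_differentiable: "gradient f differentiable (at z)"
    and gradient_lipschitz_near: "lipschitz_near (gradient f) z"
proof -
  have 1: "Ck_on (Suc 0) (\<lambda>x. frechet_derivative f (at x) v) U" for v using f by simp
  show "gradient f differentiable (at z)"
    unfolding gradient_def[abs_def]
    using 1 U by (intro differentiable_sum differentiable_scaleR differentiable_const) auto
  show "lipschitz_near (gradient f) z"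
    unfolding gradient_def[abs_def]
    by (intro lipschitz_near_sum lipschitz_near_scaleR_left lipschitz_near_C1[OF 1 U]) auto
qed

lemma differentiable_normalize:
  fixes F :: "'a::euclidean_space \<Rightarrow> 'a"
  assumes "F differentiable (at z)" "F z \<noteq> 0"
  shows "(\<lambda>x. F x /\<^sub>R norm (F x)) differentiable (at z)"
proof -
  have "(norm \<circ> F) differentiable (at z)"
    by (rule differentiable_chain_at[OF assms(1)]) (use assms(2) in simp)
  then have "(\<lambda>x. inverse (norm (F x))) differentiable (at z)"
    using assms(2) by (intro differentiable_inverse) (simp_all add: o_def)
  then show ?thesis by (intro differentiable_scaleR assms)
qed

section \<open>Convex bodies with smooth boundary\<close>

locale smooth_convex_body =
  fixes K :: "'a::euclidean_space set"
  assumes body: "convex_body K" and smooth: "smooth_boundary K"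
begin

abbreviation "N \<equiv> outer_unit_normal K"

definition supports where
  "supports z \<nu> \<longleftrightarrow> norm \<nu> = 1 \<and> (\<forall>x\<in>K. (x - z) \<bullet> \<nu> \<le> 0)"

lemma compact_K: "compact K" and convex_K: "convex K" and interior_K: "interior K \<noteq> {}"
  using body by (auto simp: convex_body_def)

lemma closed_K: "closed K" using compact_K by (rule compact_imp_closed)

lemma compact_frontier_K: "compact (frontier K)" using compact_K by (rule compact_frontier)

lemma frontier_subset: "frontier K \<subseteq> K" using closed_K by (simp add: frontier_subset_closed)

lemma in_frontier_iff: "z \<in> frontier K \<longleftrightarrow> z \<in> K \<and> z \<notin> interior K"
  using closed_K by (simp add: frontier_def)

lemma closure_interior_K: "closure (interior K) = K"
  using convex_closure_interior[OF convex_K interior_K] closed_K by simp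

lemma supports_normalize:
  assumes u: "u \<noteq> 0" and le: "\<And>x. x \<in> K \<Longrightarrow> (x - z) \<bullet> u \<le> 0"
  shows "supports z (u /\<^sub>R norm u)"
  unfolding supports_def
proof (intro conjI ballI)
  show "norm (u /\<^sub>R norm u) = 1" using u by simp
  fix x assume "x \<in> K"
  then have "inverse (norm u) * ((x - z) \<bullet> u) \<le> 0" using le by (intro mult_nonneg_nonpos) auto
  then show "(x - z) \<bullet> (u /\<^sub>R norm u) \<le> 0" by (simp only: inner_scaleR_right)
qed

lemma support_strict:
  assumes \<nu>: "supports z \<nu>" and x: "x \<in> interior K" shows "(x - z) \<bullet> \<nu> < 0"
proof -
  obtain e where e: "e > 0" "cball x e \<subseteq> K"
    using x mem_interior_cball by blast
  have "x + e *\<^sub>R \<nu> \<in> cball x e" using e(1) \<nu> by (simp add: dist_norm supports_def)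
  then have "(x + e *\<^sub>R \<nu> - z) \<bullet> \<nu> \<le> 0" using e \<nu> by (auto simp: supports_def)
  moreover have "\<nu> \<bullet> \<nu> = 1" using \<nu> by (simp add: supports_def dot_square_norm)
  ultimately show ?thesis using e(1) by (simp add: inner_add_left inner_diff_left)
qed

lemma support_exists: assumes z: "z \<in> frontier K" obtains \<nu> where "supports z \<nu>"
proof -
  have "{z} \<inter> interior K = {}" using z in_frontier_iff by blast
  from separating_hyperplane_sets[OF convex_singleton convex_interior[OF convex_K] _ interior_K this]
  obtain a b where ab: "a \<noteq> 0" "\<forall>x\<in>{z}. a \<bullet> x \<le> b" "\<forall>x\<in>interior K. b \<le> a \<bullet> x" by blast
  have "interior K \<subseteq> {x. b \<le> a \<bullet> x}" using ab(3) by blast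
  then have "K \<subseteq> {x. b \<le> a \<bullet> x}"
    using closure_minimal[OF _ closed_halfspace_ge] closure_interior_K by blast
  then have ge: "a \<bullet> z \<le> a \<bullet> x" if "x \<in> K" for x using ab(2) that by auto
  have "supports z (- a /\<^sub>R norm a)"
    using supports_normalize[of "- a" z] ab(1) ge by (simp add: inner_diff_right inner_commute[of _ a])
  then show ?thesis by (rule that)
qed

lemma local_equation:
  assumes z: "z \<in> frontier K"
  obtains U f where "open U" "z \<in> U" "Ck_on (Suc (Suc 0)) f U"
    "\<And>x. x \<in> U \<Longrightarrow> gradient f x \<noteq> 0" "frontier K \<inter> U = {x \<in> U. f x = 0}"
proof -
  obtain U f where Uf: "open U" "z \<in> U" "smooth_on f U"
    "\<forall>x\<in>U. \<exists>v. frechet_derivative f (at x) v \<noteq> 0" "frontier K \<inter> U = {x \<in> U. f x = (0::real)}"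
    using bspec[OF smooth[unfolded smooth_boundary_def smooth_hypersurface_def] z] by blast
  have C2: "Ck_on (Suc (Suc 0)) f U" using Uf(3) by (simp only: smooth_on_def)
  have "gradient f x \<noteq> 0" if "x \<in> U" for x
  proof
    assume "gradient f x = 0"
    moreover have "f differentiable (at x)" using C2 that by simp
    ultimately have "frechet_derivative f (at x) v = 0" for v
      using gradient_inner[of f x v] by simp
    with Uf(4) that show False by blast
  qed
  with Uf C2 show ?thesis by (intro that[of U f])
qed

text \<open>Suppose that \<open>m\<close> is positive on some tangent vector \<open>d\<close>. The points \<open>z + t (d \<plusminus> e g)\<close> with
  a small \<open>e\<close> lie on opposite sides of the hypersurface for all small \<open>t > 0\<close>, so the
  segment between them contains a boundary point, and there the support inequality fails.\<close>

lemma support_parallel_gradient: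
  assumes z: "z \<in> frontier K" and U: "open U" "z \<in> U" and f: "f differentiable (at z)"
    and fU: "continuous_on U f"
    and g: "gradient f z \<noteq> 0" and zero: "frontier K \<inter> U = {x \<in> U. f x = 0}"
    and m: "\<And>x. x \<in> K \<Longrightarrow> (x - z) \<bullet> m \<le> 0"
  shows "\<exists>k. m = k *\<^sub>R gradient f z"
proof -
  define g where "g = gradient f z"
  have gg: "g \<bullet> g > 0" using assms(6) by (simp add: g_def)
  have le: "m \<bullet> d \<le> 0" if d: "g \<bullet> d = 0" for d
  proof (rule ccontr)
    assume "\<not> m \<bullet> d \<le> 0"
    then have md: "m \<bullet> d > 0" by simp
    define e where "e = m \<bullet> d / (2 * (\<bar>m \<bullet> g\<bar> + 1))"
    have e: "e > 0" using md by (simp add: e_def)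
    have "e * \<bar>m \<bullet> g\<bar> < e * (2 * (\<bar>m \<bullet> g\<bar> + 1))" using e by (intro mult_strict_left_mono) auto
    also have "\<dots> = m \<bullet> d" by (simp add: e_def)
    finally have small: "e * \<bar>m \<bullet> g\<bar> < m \<bullet> d" .
    obtain r where r: "r > 0" "ball z r \<subseteq> U" using U open_contains_ball by blast
    define p where "p t \<sigma> = z + t *\<^sub>R (d + \<sigma> *\<^sub>R g)" for t \<sigma> :: real
    have line: "((\<lambda>t. f (p t \<sigma>)) has_real_derivative \<sigma> * (g \<bullet> g)) (at 0)" for \<sigma>
    proof -
      have "((\<lambda>t. p t \<sigma>) has_derivative (\<lambda>t. t *\<^sub>R (d + \<sigma> *\<^sub>R g))) (at 0)"
        unfolding p_def by (auto intro!: derivative_eq_intros)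
      from has_derivative_compose[OF this, of f "\<lambda>v. g \<bullet> v"] gradient_derivative[OF f]
      have "((\<lambda>t. f (p t \<sigma>)) has_derivative (\<lambda>t. g \<bullet> (t *\<^sub>R (d + \<sigma> *\<^sub>R g)))) (at 0)"
        by (simp add: p_def g_def)
      moreover have "(\<lambda>t. g \<bullet> (t *\<^sub>R (d + \<sigma> *\<^sub>R g))) = (*) (\<sigma> * (g \<bullet> g))"
        using d by (auto simp: inner_add_right)
      ultimately show ?thesis by (simp add: has_field_derivative_def)
    qed
    have fz: "f (p 0 \<sigma>) = 0" for \<sigma> using z U zero by (auto simp: p_def)
    have "e * (g \<bullet> g) > 0" using e gg by simp
    from has_real_derivative_pos_inc_right[OF line this] obtain d1 where
      "d1 > 0" "\<forall>h>0. 0 + h \<in> UNIV \<longrightarrow> h < d1 \<longrightarrow> f (p 0 e) < f (p (0 + h) e)" by blast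
    then have d1: "d1 > 0" "\<And>t. 0 < t \<Longrightarrow> t < d1 \<Longrightarrow> f (p t e) > 0" by (simp_all add: fz)
    have "(- e) * (g \<bullet> g) < 0" using e gg by simp
    from has_real_derivative_neg_dec_right[OF line this] obtain d2 where
      "d2 > 0" "\<forall>h>0. 0 + h \<in> UNIV \<longrightarrow> h < d2 \<longrightarrow> f (p (0 + h) (- e)) < f (p 0 (- e))" by blast
    then have d2: "d2 > 0" "\<And>t. 0 < t \<Longrightarrow> t < d2 \<Longrightarrow> f (p t (- e)) < 0" by (simp_all add: fz)
    define C where "C = norm d + e * norm g + 1"
    have C: "C > 0" using e by (simp add: C_def add_nonneg_pos)
    define T where "T = min (min d1 d2) (r / C)"
    define t where "t = T / 2"
    have "T > 0" "T \<le> d1" "T \<le> d2" "T \<le> r / C" using d1(1) d2(1) r(1) C by (auto simp: T_def)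
    moreover from this(1) have "0 < t" "t < T" by (simp_all add: t_def)
    ultimately have t: "t > 0" "t < d1" "t < d2" "t < r / C" by linarith+
    have inU: "p t \<sigma> \<in> U" if "\<bar>\<sigma>\<bar> \<le> e" for \<sigma>
    proof -
      have "norm (d + \<sigma> *\<^sub>R g) \<le> norm d + \<bar>\<sigma>\<bar> * norm g"
        using norm_triangle_ineq[of d "\<sigma> *\<^sub>R g"] by simp
      also have "\<dots> \<le> C" using mult_right_mono[OF that norm_ge_zero[of g]] by (simp add: C_def)
      finally have "t * norm (d + \<sigma> *\<^sub>R g) \<le> t * C" using t by (intro mult_left_mono) auto
      also have "\<dots> < r" using t(4) C by (simp add: pos_less_divide_eq)
      finally have "dist z (p t \<sigma>) < r" using t(1) by (simp add: p_def dist_norm)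
      then show ?thesis using r(2) by auto
    qed
    have cont: "continuous_on {-e..e} (\<lambda>\<sigma>. f (p t \<sigma>))"
    proof (rule continuous_on_compose2[OF fU])
      show "continuous_on {-e..e} (p t)" unfolding p_def[abs_def] by (intro continuous_intros)
    qed (use inU in auto)
    have "f (p t (- e)) \<le> 0" "0 \<le> f (p t e)" "- e \<le> e"
      using d1(2)[OF t(1,2)] d2(2)[OF t(1,3)] e by auto
    from IVT'[OF this cont]
    obtain \<sigma> where \<sigma>: "- e \<le> \<sigma>" "\<sigma> \<le> e" "f (p t \<sigma>) = 0" by auto
    then have "p t \<sigma> \<in> K" using inU[of \<sigma>] zero frontier_subset by (auto simp: abs_le_iff)
    then have "(p t \<sigma> - z) \<bullet> m \<le> 0" by (rule m)
    then have "t * (m \<bullet> d + \<sigma> * (m \<bullet> g)) \<le> 0"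
      by (simp add: p_def inner_commute inner_add_right)
    then have "m \<bullet> d + \<sigma> * (m \<bullet> g) \<le> 0" using t(1) by (simp add: mult_le_0_iff)
    moreover have "\<bar>\<sigma> * (m \<bullet> g)\<bar> \<le> e * \<bar>m \<bullet> g\<bar>"
      unfolding abs_mult using \<sigma> by (intro mult_right_mono) auto
    ultimately show False using small by linarith
  qed
  define k where "k = (m \<bullet> g) / (g \<bullet> g)"
  define d where "d = m - k *\<^sub>R g"
  have "g \<bullet> d = 0" using gg by (simp add: d_def k_def inner_diff_right inner_commute)
  then have "m \<bullet> d \<le> 0" by (rule le)
  moreover have "d \<bullet> d = m \<bullet> d" using \<open>g \<bullet> d = 0\<close>
    by (simp add: d_def inner_diff_left)
  ultimately have "d = 0" using inner_gt_zero_iff[of d] by (metis not_le)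
  then show ?thesis by (auto simp: d_def g_def)
qed

lemma support_parallel:
  assumes z: "z \<in> frontier K"
  obtains g where "g \<noteq> 0"
    "\<And>m. (\<And>x. x \<in> K \<Longrightarrow> (x - z) \<bullet> m \<le> 0) \<Longrightarrow> \<exists>k. m = k *\<^sub>R g"
proof -
  obtain U f where U: "open U" "z \<in> U" and f: "Ck_on (Suc (Suc 0)) f U"
    and g: "\<And>x. x \<in> U \<Longrightarrow> gradient f x \<noteq> 0" and zero: "frontier K \<inter> U = {x \<in> U. f x = 0}"
    by (rule local_equation[OF z]) blast
  have d: "f differentiable (at x)" if "x \<in> U" for x using f that by simp
  have "continuous_on U f"
    by (intro continuous_at_imp_continuous_on ballI differentiable_imp_continuous_within d)
  from support_parallel_gradient[OF z U d[OF U(2)] this g[OF U(2)] zero]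
  show ?thesis by (intro that[OF g[OF U(2)]]) blast
qed

text \<open>All supporting normals are multiples of the gradient, and two opposite ones would leave no
  interior.\<close>

lemma support_unique:
  assumes z: "z \<in> frontier K" and \<nu>: "supports z \<nu>" "supports z \<mu>" shows "\<mu> = \<nu>"
proof -
  obtain g where g: "g \<noteq> 0" "\<And>m. (\<And>x. x \<in> K \<Longrightarrow> (x - z) \<bullet> m \<le> 0) \<Longrightarrow> \<exists>k. m = k *\<^sub>R g"
    by (rule support_parallel[OF z]) blast
  obtain k l where kl: "\<nu> = k *\<^sub>R g" "\<mu> = l *\<^sub>R g"
    using g(2)[of \<nu>] g(2)[of \<mu>] \<nu> unfolding supports_def by blast
  have n: "\<bar>k\<bar> * norm g = 1" "\<bar>l\<bar> * norm g = 1" using \<nu> kl by (simp_all add: supports_def)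
  then have "\<bar>k\<bar> * norm g = \<bar>l\<bar> * norm g" by simp
  then have "\<bar>k\<bar> = \<bar>l\<bar>" using g(1) by simp
  moreover have "k \<noteq> - l"
  proof
    assume "k = - l"
    then have "\<nu> = - \<mu>" using kl by simp
    moreover obtain o' where "o' \<in> interior K" using interior_K by blast
    ultimately show False using support_strict[OF \<nu>(1)] support_strict[OF \<nu>(2)] by fastforce
  qed
  ultimately have "k = l" by (simp add: abs_eq_iff)
  then show ?thesis using kl by simp
qed

text \<open>A ray that stays outside the interior can be separated from it by a hyperplane through
  \<open>z\<close>. The normal of that hyperplane supports the body, hence equals \<open>\<nu>\<close>, which contradicts
  the direction of the ray.\<close>

lemma inward_direction:
  assumes z: "z \<in> frontier K" and \<nu>: "supports z \<nu>" and d: "\<nu> \<bullet> d < 0"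
  obtains t0 where "t0 > 0" "\<And>t. 0 \<le> t \<Longrightarrow> t \<le> t0 \<Longrightarrow> z + t *\<^sub>R d \<in> K"
proof -
  have "\<exists>t>0. z + t *\<^sub>R d \<in> interior K"
  proof (rule ccontr)
    assume none: "\<not> (\<exists>t>0. z + t *\<^sub>R d \<in> interior K)"
    define A where "A = (\<lambda>t. z + t *\<^sub>R d) ` {0<..}"
    have "convex A"
    proof -
      have "A = (\<lambda>x. z + x) ` ((\<lambda>t. t *\<^sub>R d) ` {0<..})" by (auto simp: A_def image_image)
      moreover have "linear (\<lambda>t. t *\<^sub>R d)" by (rule linearI) (simp_all add: scaleR_add_left)
      ultimately show ?thesis by (simp add: convex_translation convex_linear_image)
    qed
    moreover have "A \<inter> interior K = {}" using none by (auto simp: A_def)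
    ultimately obtain a b where ab: "a \<noteq> 0" "\<forall>x\<in>A. a \<bullet> x \<le> b" "\<forall>x\<in>interior K. b \<le> a \<bullet> x"
      using separating_hyperplane_sets[of A "interior K"] convex_interior[OF convex_K] interior_K
      by (auto simp: A_def)
    have line: "a \<bullet> z + t * (a \<bullet> d) \<le> b" if "t > 0" for t
      using ab(2) that by (auto simp: A_def inner_add_right)
    have "interior K \<subseteq> {x. b \<le> a \<bullet> x}" using ab(3) by blast
    then have ge: "b \<le> a \<bullet> x" if "x \<in> K" for x
      using closure_minimal[OF _ closed_halfspace_ge] closure_interior_K that by blast
    have "((\<lambda>t. a \<bullet> z + t * (a \<bullet> d)) \<longlongrightarrow> a \<bullet> z + 0 * (a \<bullet> d)) (at_right 0)"
      by (intro tendsto_intros)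
    then have "a \<bullet> z + 0 * (a \<bullet> d) \<le> b"
      by (rule tendsto_upperbound) (auto simp: eventually_at_right_field line intro!: exI[of _ 1])
    then have b: "b = a \<bullet> z" using ge frontier_subset z by (auto intro: antisym)
    have "supports z (- a /\<^sub>R norm a)"
      using supports_normalize[of "- a" z] ab(1) ge by (simp add: b inner_diff_right inner_commute[of _ a])
    from support_unique[OF z this \<nu>] have "\<nu> = - a /\<^sub>R norm a" .
    then have "\<nu> \<bullet> d = - (a \<bullet> d) / norm a" by (simp add: divide_inverse mult.commute)
    then have "a \<bullet> d / norm a > 0" using d by simp
    then have "a \<bullet> d > 0" using ab(1) by (auto simp: zero_less_divide_iff)
    then show False using line[of 1] b by simp
  qed
  then obtain t0 where t0: "t0 > 0" "z + t0 *\<^sub>R d \<in> interior K" by blast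
  have "z + t *\<^sub>R d \<in> K" if t: "0 \<le> t" "t \<le> t0" for t
  proof -
    have "(1 - t / t0) *\<^sub>R z + (t / t0) *\<^sub>R (z + t0 *\<^sub>R d) \<in> K"
      using convex_K z frontier_subset interior_subset t0 t by (intro convexD) (auto simp: field_simps)
    moreover have "(1 - t / t0) *\<^sub>R z + (t / t0) *\<^sub>R (z + t0 *\<^sub>R d) = z + t *\<^sub>R d"
      using t0 by (simp add: scaleR_add_right scaleR_diff_left)
    ultimately show ?thesis by simp
  qed
  then show ?thesis by (rule that[OF t0(1)])
qed

text \<open>A curve on the frontier has \<open>(\<gamma> t - z) \<bullet> \<nu> \<le> 0\<close> with equality at \<open>0\<close>, so its velocity is
  orthogonal to \<open>\<nu>\<close>. Conversely, for \<open>v\<close> orthogonal to \<open>\<nu>\<close> the projections of the points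
  \<open>z + t v\<close> to the body form a continuous curve on the frontier, and its velocity is \<open>v\<close>
  because these points are at distance \<open>o(t)\<close> from the body.\<close>

lemma tangent_space_eq:
  assumes z: "z \<in> frontier K" and \<nu>: "supports z \<nu>"
  shows "tangent_space (frontier K) z = {v. v \<bullet> \<nu> = 0}"
proof (intro set_eqI iffI CollectI)
  fix v assume "v \<in> tangent_space (frontier K) z"
  then obtain \<gamma> e where \<gamma>: "e > 0" "\<gamma> ` {-e<..<e} \<subseteq> frontier K" "\<gamma> 0 = z"
    "(\<gamma> has_vector_derivative v) (at (0::real))"
    unfolding tangent_space_def by blast
  have "((\<lambda>t. (\<gamma> t - z) \<bullet> \<nu>) has_vector_derivative (v \<bullet> \<nu>)) (at 0)"
    using has_vector_derivative_diff[OF \<gamma>(4) has_vector_derivative_const[of z]]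
    by (intro bounded_linear.has_vector_derivative[OF bounded_linear_inner_left]) simp
  then have d: "((\<lambda>t. (\<gamma> t - z) \<bullet> \<nu>) has_derivative (\<lambda>t. t * (v \<bullet> \<nu>))) (at 0)"
    by (simp add: has_vector_derivative_def)
  have "(\<lambda>t. t * (v \<bullet> \<nu>)) = (\<lambda>t. 0)"
  proof (rule differential_zero_maxmin[OF _ _ d, of "{-e<..<e}"])
    show "(\<forall>y\<in>{- e<..<e}. (\<gamma> y - z) \<bullet> \<nu> \<le> (\<gamma> 0 - z) \<bullet> \<nu>) \<or>
        (\<forall>y\<in>{- e<..<e}. (\<gamma> 0 - z) \<bullet> \<nu> \<le> (\<gamma> y - z) \<bullet> \<nu>)"
      using \<gamma> \<nu> frontier_subset unfolding supports_def by (intro disjI1 ballI) fastforce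
  qed (use \<gamma>(1) in auto)
  then show "v \<bullet> \<nu> = 0" by (metis mult_1)
next
  fix v assume "v \<in> {v. v \<bullet> \<nu> = 0}"
  then have v: "v \<bullet> \<nu> = 0" by simp
  define \<gamma> where "\<gamma> t = closest_point K (z + t *\<^sub>R v)" for t
  have zK: "z \<in> K" using z frontier_subset by blast
  have K_ne: "K \<noteq> {}" using zK by blast
  have cont: "continuous_on UNIV \<gamma>"
    unfolding \<gamma>_def[abs_def]
    by (rule continuous_on_compose2[OF continuous_on_closest_point[OF convex_K closed_K K_ne, of UNIV]])
      (auto intro!: continuous_intros)
  have fr: "\<gamma> t \<in> frontier K" for t
  proof -
    have "((z + t *\<^sub>R v) - z) \<bullet> \<nu> = 0" using v by simp
    then have "z + t *\<^sub>R v \<notin> interior K" using support_strict[OF \<nu>] by (metis less_irrefl)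
    then have "z + t *\<^sub>R v \<notin> rel_interior K" using rel_interior_nonempty_interior[OF interior_K] by simp
    then have "\<gamma> t \<notin> rel_interior K"
      unfolding \<gamma>_def using closest_point_in_rel_interior[OF closed_K K_ne]
      by (simp add: affine_hull_nonempty_interior[OF interior_K])
    then show ?thesis
      using rel_interior_nonempty_interior[OF interior_K] closest_point_in_set[OF closed_K K_ne]
      by (simp add: in_frontier_iff \<gamma>_def)
  qed
  have \<nu>\<nu>: "\<nu> \<bullet> \<nu> = 1" using \<nu> by (simp add: supports_def dot_square_norm)
  have g0: "\<gamma> 0 = z" using zK by (simp add: \<gamma>_def closest_point_self)
  have "(\<gamma> has_derivative (\<lambda>t. t *\<^sub>R v)) (at 0)"
    unfolding has_derivative_at_alt
  proof (intro conjI allI impI)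
    show "bounded_linear (\<lambda>t. t *\<^sub>R v)" by (rule bounded_linear_scaleR_left)
    fix e :: real assume e: "e > 0"
    have neg: "\<nu> \<bullet> (v - e *\<^sub>R \<nu>) < 0" "\<nu> \<bullet> (- v - e *\<^sub>R \<nu>) < 0"
      using v e \<nu>\<nu> by (simp_all add: inner_diff_right inner_commute[of \<nu> v])
    obtain t1 where t1: "t1 > 0" "\<And>t. 0 \<le> t \<Longrightarrow> t \<le> t1 \<Longrightarrow> z + t *\<^sub>R (v - e *\<^sub>R \<nu>) \<in> K"
      by (rule inward_direction[OF z \<nu> neg(1)]) blast
    obtain t2 where t2: "t2 > 0" "\<And>t. 0 \<le> t \<Longrightarrow> t \<le> t2 \<Longrightarrow> z + t *\<^sub>R (- v - e *\<^sub>R \<nu>) \<in> K"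
      by (rule inward_direction[OF z \<nu> neg(2)]) blast
    have "norm (\<gamma> y - \<gamma> 0 - (y - 0) *\<^sub>R v) \<le> e * norm (y - 0)" if y: "norm (y - 0) < min t1 t2" for y
    proof -
      have "z + y *\<^sub>R v - (e * \<bar>y\<bar>) *\<^sub>R \<nu> \<in> K"
      proof (cases "y \<ge> 0")
        case True
        then show ?thesis using t1(2)[of y] y by (simp add: scaleR_diff_right mult.commute add_diff_eq add.assoc)
      next
        case False
        then show ?thesis using t2(2)[of "- y"] y by (simp add: scaleR_diff_right mult.commute add_diff_eq add.assoc)
      qed
      from closest_point_le[OF closed_K this, of "z + y *\<^sub>R v"]
      have "dist (z + y *\<^sub>R v) (\<gamma> y) \<le> e * \<bar>y\<bar>"
        using e \<nu> by (simp add: \<gamma>_def[symmetric] dist_norm supports_def abs_mult)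
      then show ?thesis unfolding g0 by (simp add: dist_norm norm_minus_commute algebra_simps)
    qed
    then show "\<exists>d>0. \<forall>y. norm (y - 0) < d \<longrightarrow> norm (\<gamma> y - \<gamma> 0 - (y - 0) *\<^sub>R v) \<le> e * norm (y - 0)"
      using t1(1) t2(1) by (intro exI[of _ "min t1 t2"]) auto
  qed
  then have "(\<gamma> has_vector_derivative v) (at 0)" by (simp add: has_vector_derivative_def)
  then show "v \<in> tangent_space (frontier K) z"
    unfolding tangent_space_def using cont fr g0
    by (intro CollectI exI[of _ \<gamma>] exI[of _ 1]) (auto intro: continuous_on_subset)
qed

lemma N_eqI:
  assumes z: "z \<in> frontier K" and \<nu>: "supports z \<nu>" shows "N z = \<nu>"
  unfolding outer_unit_normal_def
proof (rule the_equality)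
  have "\<nu> \<in> normal_space (frontier K) z"
    unfolding normal_space_def orthogonal_comp_def tangent_space_eq[OF z \<nu>]
    by (simp add: orthogonal_def)
  then show "\<nu> \<in> normal_space (frontier K) z \<and> norm \<nu> = 1 \<and> (\<forall>x\<in>K. (x - z) \<bullet> \<nu> \<le> 0)"
    using \<nu> by (simp add: supports_def)
qed (use support_unique[OF z \<nu>] in \<open>auto simp: supports_def\<close>)

lemma N_supports: assumes z: "z \<in> frontier K" shows "supports z (N z)"
proof -
  obtain \<nu> where "supports z \<nu>" by (rule support_exists[OF z])
  with N_eqI[OF z this] show ?thesis by simp
qed

lemma norm_N: "z \<in> frontier K \<Longrightarrow> norm (N z) = 1"
  and N_le: "z \<in> frontier K \<Longrightarrow> x \<in> K \<Longrightarrow> (x - z) \<bullet> N z \<le> 0"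
  using N_supports by (auto simp: supports_def)

lemma tangent_space_N: "z \<in> frontier K \<Longrightarrow> tangent_space (frontier K) z = {v. v \<bullet> N z = 0}"
  by (rule tangent_space_eq[OF _ N_supports])

end

text \<open>The derivative of an inverse map, for maps between subsets such as a hypersurface and a
  sphere. Derivatives within a subset need not be unique, and the conclusion holds for every
  choice of \<open>A\<close> that has a left inverse.\<close>

lemma has_derivative_inverse_within:
  fixes f :: "'a::real_normed_vector \<Rightarrow> 'b::real_normed_vector"
  assumes f: "(f has_derivative A) (at z within S)"
    and B: "bounded_linear B" "\<And>v. B (A v) = v"
    and g: "continuous (at y within T) g" "g y = z" "y \<in> T"
    and gT: "\<And>x. x \<in> T \<Longrightarrow> g x \<in> S" "\<And>x. x \<in> T \<Longrightarrow> f (g x) = x"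
  shows "(g has_derivative B) (at y within T)"
  unfolding has_derivative_within_alt
proof (intro conjI allI impI)
  show "bounded_linear B" by fact
  fix e :: real assume e: "e > 0"
  obtain C where C: "C > 0" "\<And>v. norm (B v) \<le> norm v * C"
    using bounded_linear.pos_bounded[OF B(1)] by blast
  define e1 where "e1 = min (1 / (2 * C)) (e / (2 * C * C))"
  have e1: "e1 > 0" "e1 * C \<le> 1 / 2" "e1 * (2 * C * C) \<le> e"
  proof -
    show "e1 > 0" using e C by (simp add: e1_def)
    have "e1 \<le> 1 / (2 * C)" "e1 \<le> e / (2 * C * C)" by (simp_all add: e1_def)
    then show "e1 * C \<le> 1 / 2" "e1 * (2 * C * C) \<le> e"
      using C(1) by (simp_all add: pos_le_divide_eq mult_ac)
  qed
  obtain d1 where d1: "d1 > 0"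
    "\<And>x. x \<in> S \<Longrightarrow> norm (x - z) < d1 \<Longrightarrow> norm (f x - f z - A (x - z)) \<le> e1 * norm (x - z)"
    using f e1(1) unfolding has_derivative_within_alt by blast
  obtain d where d: "d > 0" "\<And>x. x \<in> T \<Longrightarrow> dist x y < d \<Longrightarrow> dist (g x) (g y) < d1"
    using g(1) d1(1) unfolding continuous_within_eps_delta by blast
  have fz: "f z = y" using gT(2)[OF g(3)] g(2) by simp
  have "norm (g x - g y - B (x - y)) \<le> e * norm (x - y)" if x: "x \<in> T" "norm (x - y) < d" for x
  proof -
    have lin: "linear B" using B(1) by (rule bounded_linear.linear)
    have "norm (g x - z) < d1" using d(2)[OF x(1)] x(2) g(2) by (simp add: dist_norm)
    from d1(2)[OF gT(1)[OF x(1)] this]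
    have le: "norm (x - y - A (g x - z)) \<le> e1 * norm (g x - z)" by (simp add: gT(2)[OF x(1)] fz)
    have "g x - g y - B (x - y) = - B (x - y - A (g x - z))"
      by (simp add: linear_diff[OF lin] B(2) g(2))
    then have "norm (g x - g y - B (x - y)) = norm (B (x - y - A (g x - z)))"
      by (simp only: norm_minus_cancel)
    also have "\<dots> \<le> norm (x - y - A (g x - z)) * C" by (rule C(2))
    also have "\<dots> \<le> (e1 * norm (g x - z)) * C" using le C(1) by (intro mult_right_mono) auto
    finally have 1: "norm (g x - g y - B (x - y)) \<le> (e1 * C) * norm (g x - z)" by (simp add: mult_ac)
    also have "\<dots> \<le> 1 / 2 * norm (g x - z)" using e1(2) by (intro mult_right_mono) auto
    finally have "norm (g x - z) \<le> norm (B (x - y)) + 1 / 2 * norm (g x - z)"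
      using norm_triangle_sub[of "g x - z" "B (x - y)"] g(2) by simp
    then have "norm (g x - z) \<le> 2 * (norm (x - y) * C)" using C(2)[of "x - y"] by simp
    then have "(e1 * C) * norm (g x - z) \<le> (e1 * C) * (2 * (norm (x - y) * C))"
      using e1(1) C(1) by (intro mult_left_mono) auto
    also have "\<dots> = e1 * (2 * C * C) * norm (x - y)" by (simp only: mult_ac)
    also have "\<dots> \<le> e * norm (x - y)" using e1(3) by (intro mult_right_mono) auto
    finally show ?thesis using 1 by linarith
  qed
  then show "\<exists>d>0. \<forall>x\<in>T. norm (x - y) < d \<longrightarrow> norm (g x - g y - B (x - y)) \<le> e * norm (x - y)"
    using d(1) by blast
qed

context smooth_convex_body
begin

text \<open>The normalized gradient of a local equation extends the outer normal to a neighbourhood of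
  \<open>z\<close>. Its sign is fixed by the requirement that it points away from an interior point \<open>c\<close>,
  which makes the same sign correct at all nearby boundary points; \<open>k\<close> is the gradient's
  length with that sign.\<close>

lemma local_normal:
  assumes z: "z \<in> frontier K"
  obtains r M n f k where "r > 0" "n differentiable (at z)"
    "\<And>x y. x \<in> ball z r \<Longrightarrow> y \<in> ball z r \<Longrightarrow> norm (n x - n y) \<le> M * norm (x - y)"
    "\<And>x. x \<in> ball z r \<Longrightarrow> norm (n x) = 1"
    "\<And>x. x \<in> ball z r \<Longrightarrow> (f has_derivative (\<lambda>v. k x * (n x \<bullet> v))) (at x)"
    "\<And>x. x \<in> ball z r \<Longrightarrow> x \<in> frontier K \<longleftrightarrow> f x = (0 :: real)"
    "\<And>x. x \<in> ball z r \<Longrightarrow> x \<in> frontier K \<Longrightarrow> N x = n x"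
proof -
  obtain U f where U: "open U" "z \<in> U" and f: "Ck_on (Suc (Suc 0)) f U"
    and g: "\<And>x. x \<in> U \<Longrightarrow> gradient f x \<noteq> 0" and zero: "frontier K \<inter> U = {x \<in> U. f x = 0}"
    by (rule local_equation[OF z]) blast
  have d: "f differentiable (at x)" if "x \<in> U" for x using f that by simp
  have cont: "continuous_on U f"
    by (intro continuous_at_imp_continuous_on ballI differentiable_imp_continuous_within d)
  define n0 where "n0 x = gradient f x /\<^sub>R norm (gradient f x)" for x
  have n0: "norm (n0 x) = 1" if "x \<in> U" for x using g[OF that] by (simp add: n0_def)
  have pm: "N x = n0 x \<or> N x = - n0 x" if x: "x \<in> frontier K" "x \<in> U" for x
  proof -
    obtain l where l: "N x = l *\<^sub>R gradient f x"
      using support_parallel_gradient[OF x(1) U(1) x(2) d[OF x(2)] cont g[OF x(2)] zero N_le[OF x(1)]] by blast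
    have "\<bar>l\<bar> * norm (gradient f x) = 1" using norm_N[OF x(1)] unfolding l by simp
    then have "\<bar>l\<bar> = inverse (norm (gradient f x))" using g[OF x(2)] by (simp add: field_simps)
    then have "l = inverse (norm (gradient f x)) \<or> l = - inverse (norm (gradient f x))" by linarith
    then show ?thesis unfolding l n0_def by auto
  qed
  define \<sigma> :: real where "\<sigma> = (if N z = n0 z then 1 else - 1)"
  have \<sigma>: "\<bar>\<sigma>\<bar> = 1" "\<sigma> * \<sigma> = 1" by (auto simp: \<sigma>_def)
  define n where "n x = \<sigma> *\<^sub>R n0 x" for x
  have nz: "N z = n z" using pm[OF z U(2)] by (auto simp: n_def \<sigma>_def)
  have dn0: "n0 differentiable (at z)" unfolding n0_def[abs_def]
    by (rule differentiable_normalize[OF gradient_differentiable[OF f U] g[OF U(2)]])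
  then have dn: "n differentiable (at z)"
    unfolding n_def[abs_def] by (intro differentiable_scaleR differentiable_const)
  have "lipschitz_near n0 z" unfolding n0_def[abs_def]
    by (rule lipschitz_near_normalize[OF gradient_lipschitz_near[OF f U] g[OF U(2)]])
  then obtain r1 M where r1: "r1 > 0"
    "\<And>x y. x \<in> ball z r1 \<Longrightarrow> y \<in> ball z r1 \<Longrightarrow> norm (n0 x - n0 y) \<le> M * norm (x - y)"
    unfolding lipschitz_near_def by blast
  obtain r2 where r2: "r2 > 0" "ball z r2 \<subseteq> U" using U open_contains_ball by blast
  obtain c where c: "c \<in> interior K" using interior_K by blast
  have "isCont (\<lambda>x. n x \<bullet> (x - c)) z"
    using differentiable_imp_continuous_within[OF dn] by (intro continuous_intros)
  moreover have "n z \<bullet> (z - c) > 0"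
    using support_strict[OF N_supports[OF z] c] by (simp add: nz inner_diff_left inner_diff_right inner_commute)
  moreover from calculation(1) have "((\<lambda>x. n x \<bullet> (x - c)) \<longlongrightarrow> n z \<bullet> (z - c)) (nhds z)"
    using tendsto_at_iff_tendsto_nhds[of "\<lambda>x. n x \<bullet> (x - c)" z] by (simp add: isCont_def)
  ultimately have "\<forall>\<^sub>F x in nhds z. n x \<bullet> (x - c) > 0" by (intro order_tendstoD(1))
  then obtain r3 where r3: "r3 > 0" "\<And>x. dist x z < r3 \<Longrightarrow> n x \<bullet> (x - c) > 0"
    unfolding eventually_nhds_metric by blast
  define r where "r = min r1 (min r2 r3)"
  have rr: "r > 0" "\<And>x. x \<in> ball z r \<Longrightarrow> x \<in> ball z r1" "\<And>x. x \<in> ball z r \<Longrightarrow> x \<in> U"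
    "\<And>x. x \<in> ball z r \<Longrightarrow> dist x z < r3"
    using r1(1) r2 r3(1) by (auto simp: r_def dist_commute)
  show ?thesis
  proof (rule that[of r n M f "\<lambda>x. \<sigma> * norm (gradient f x)"])
    show "r > 0" by (rule rr)
    show "n differentiable (at z)" by (rule dn)
    show "norm (n x - n y) \<le> M * norm (x - y)" if "x \<in> ball z r" "y \<in> ball z r" for x y
      using r1(2)[OF rr(2)[OF that(1)] rr(2)[OF that(2)]] \<sigma>
      by (simp add: n_def flip: scaleR_diff_right)
    show "norm (n x) = 1" if "x \<in> ball z r" for x
      using n0[OF rr(3)[OF that]] \<sigma> by (simp add: n_def)
    show "x \<in> frontier K \<longleftrightarrow> f x = 0" if "x \<in> ball z r" for x
      using zero rr(3)[OF that] by blast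
    show "(f has_derivative (\<lambda>v. \<sigma> * norm (gradient f x) * (n x \<bullet> v))) (at x)" if "x \<in> ball z r" for x
    proof -
      have "\<sigma> * norm (gradient f x) * (n x \<bullet> v) = gradient f x \<bullet> v" for v
      proof -
        have "\<sigma> * norm (gradient f x) * (n x \<bullet> v) = (\<sigma> * \<sigma>) * (norm (gradient f x) * (n0 x \<bullet> v))"
          by (simp only: n_def inner_scaleR_left mult_ac)
        also have "\<dots> = gradient f x \<bullet> v" using g[OF rr(3)[OF that]] \<sigma>(2) by (simp add: n0_def)
        finally show ?thesis .
      qed
      then show ?thesis using gradient_derivative[OF d[OF rr(3)[OF that]]] by simp
    qed
    show "N x = n x" if "x \<in> ball z r" "x \<in> frontier K" for x
    proof -
      have "N x = n x \<or> N x = - n x"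
        using pm[OF that(2) rr(3)[OF that(1)]] by (auto simp: n_def \<sigma>_def)
      moreover have "N x \<bullet> (x - c) > 0"
        using support_strict[OF N_supports[OF that(2)] c]
        by (simp add: inner_diff_left inner_diff_right inner_commute)
      ultimately show ?thesis using r3(2)[OF rr(4)[OF that(1)]] by auto
    qed
  qed
qed

text \<open>The shape operator. Its values on tangent vectors are determined by the normal field.\<close>

definition A where "A z = frechet_derivative N (at z within frontier K)"

lemma N_derivative: assumes z: "z \<in> frontier K" shows "(N has_derivative A z) (at z within frontier K)"
proof -
  obtain r n where r: "r > 0" and n: "n differentiable (at z)"
    and eq: "\<And>x. x \<in> ball z r \<Longrightarrow> x \<in> frontier K \<Longrightarrow> N x = n x"
    by (rule local_normal[OF z]) blast
  obtain n' where "(n has_derivative n') (at z within frontier K)"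
    using n has_derivative_at_withinI unfolding differentiable_def by blast
  then have "(N has_derivative n') (at z within frontier K)"
    by (rule has_derivative_transform_within[OF _ r z]) (use eq in \<open>auto simp: dist_commute\<close>)
  then have "N differentiable (at z within frontier K)" by (rule differentiableI)
  then show ?thesis by (simp add: A_def frechet_derivative_works)
qed

lemma N_continuous: "continuous_on (frontier K) N"
  unfolding continuous_on_eq_continuous_within using N_derivative has_derivative_continuous by blast

text \<open>Pairs of points that violate larger and larger Lipschitz constants get close to each
  other, because normals have length one, and accumulate at a point of the frontier. Near
  that point \<open>local_normal\<close> provides a constant.\<close>

lemma N_lipschitz: obtains M where "M \<ge> 0" "\<And>x y. x \<in> frontier K \<Longrightarrow> y \<in> frontier K \<Longrightarrow> norm (N x - N y) \<le> M * norm (x - y)"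
proof (rule ccontr)
  assume no: "\<not> thesis"
  have "\<exists>x y. x \<in> frontier K \<and> y \<in> frontier K \<and> norm (N x - N y) > real i * norm (x - y)" for i
  proof (rule ccontr)
    assume "\<not> ?thesis"
    then have "norm (N x - N y) \<le> real i * norm (x - y)" if "x \<in> frontier K" "y \<in> frontier K" for x y
      using that not_le by blast
    from that[OF of_nat_0_le_iff this] show False using no by blast
  qed
  then obtain x y where x: "\<And>i. x i \<in> frontier K" and y: "\<And>i. y i \<in> frontier K"
    and gt: "\<And>i. norm (N (x i) - N (y i)) > real i * norm (x i - y i)" by metis
  obtain z s where z: "z \<in> frontier K" and s: "strict_mono s" and xz: "(x \<circ> s) \<longlonglongrightarrow> z"
    by (rule seq_compactE[OF compact_imp_seq_compact[OF compact_frontier_K], of x]) (use x in auto)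
  have le2: "real i * norm (x i - y i) \<le> 2" for i
    using gt[of i] norm_triangle_ineq4[of "N (x i)" "N (y i)"] norm_N[OF x] norm_N[OF y] by (smt (verit))
  obtain r M n where r: "r > 0"
    and lip: "\<And>x y. x \<in> ball z r \<Longrightarrow> y \<in> ball z r \<Longrightarrow> norm (n x - n y) \<le> M * norm (x - y)"
    and eq: "\<And>x. x \<in> ball z r \<Longrightarrow> x \<in> frontier K \<Longrightarrow> N x = n x"
    by (rule local_normal[OF z]) blast
  obtain i0 where i0: "\<And>i. i \<ge> i0 \<Longrightarrow> dist (x (s i)) z < r / 2"
  proof -
    have "r / 2 > 0" using r by simp
    with xz obtain k where "\<forall>i\<ge>k. dist ((x \<circ> s) i) z < r / 2" unfolding lim_sequentially by blast
    then show ?thesis by (intro that[of k]) simp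
  qed
  obtain i1 :: nat where i1: "real i1 > max M (4 / r)" using reals_Archimedean2 by blast
  define i where "i = s (max i0 i1)"
  have "i \<ge> max i0 i1" unfolding i_def using s by (rule seq_suble)
  then have iM: "real i > M" "real i > 4 / r" using i1 by (auto simp: max_def split: if_splits)
  have "4 / r * norm (x i - y i) \<le> 2"
    using mult_right_mono[OF less_imp_le[OF iM(2)] norm_ge_zero[of "x i - y i"]] le2[of i] by linarith
  then have "norm (x i - y i) \<le> r / 2" using r by (simp add: field_simps)
  moreover have "dist (x i) z < r / 2" unfolding i_def by (rule i0) simp
  ultimately have "x i \<in> ball z r" "y i \<in> ball z r"
    using dist_triangle[of z "y i" "x i"] r by (auto simp: dist_commute dist_norm[of "x i" "y i"])
  then have "norm (N (x i) - N (y i)) \<le> M * norm (x i - y i)"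
    using lip[of "x i" "y i"] eq[OF _ x] eq[OF _ y] by simp
  also have "\<dots> \<le> real i * norm (x i - y i)" using iM by (intro mult_right_mono) auto
  finally show False using gt[of i] by simp
qed

end

locale strongly_convex_body = smooth_convex_body +
  assumes strong: "strongly_convex K"
begin

lemma A_pos: assumes "z \<in> frontier K" "v \<bullet> N z = 0" "v \<noteq> 0" shows "A z v \<bullet> v > 0"
  using strong assms tangent_space_N unfolding strongly_convex_def second_fundamental_form_def A_def by blast

text \<open>Points with equal normals lie in one supporting hyperplane, and so does the segment
  between them. The normal is constant on that segment, against the positivity of the second
  fundamental form in its direction.\<close>

lemma N_inj: assumes z: "z1 \<in> frontier K" "z2 \<in> frontier K" and eq: "N z1 = N z2" shows "z1 = z2"
proof (rule ccontr)
  assume ne: "z1 \<noteq> z2"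
  define v where "v = z2 - z1"
  define \<gamma> where "\<gamma> t = z1 + t *\<^sub>R v" for t :: real
  have v: "v \<noteq> 0" using ne by (simp add: v_def)
  have K: "z1 \<in> K" "z2 \<in> K" using z frontier_subset by auto
  have orth: "v \<bullet> N z1 = 0"
    using N_le[OF z(1) K(2)] N_le[OF z(2) K(1)] eq by (simp add: v_def inner_diff_left)
  have sup: "supports (\<gamma> t) (N z1)" for t
    using N_supports[OF z(1)] orth unfolding supports_def \<gamma>_def
    by (simp add: inner_diff_left inner_add_left)
  have fr: "\<gamma> t \<in> frontier K" if "t \<in> {0<..<1}" for t
  proof -
    have "(1 - t) *\<^sub>R z1 + t *\<^sub>R z2 \<in> K" using convex_K K that by (intro convexD) auto
    moreover have "(1 - t) *\<^sub>R z1 + t *\<^sub>R z2 = \<gamma> t" by (simp add: \<gamma>_def v_def algebra_simps)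
    ultimately have "\<gamma> t \<in> K" by simp
    moreover have "\<gamma> t \<notin> interior K" using support_strict[OF sup[of t], of "\<gamma> t"] by auto
    ultimately show ?thesis by (simp add: in_frontier_iff)
  qed
  have N: "N (\<gamma> t) = N z1" if "t \<in> {0<..<1}" for t by (rule N_eqI[OF fr[OF that] sup])
  let ?I = "{0<..<1::real}"
  have h: "(1/2::real) \<in> ?I" by simp
  have d\<gamma>: "(\<gamma> has_derivative (\<lambda>t. t *\<^sub>R v)) (at (1/2) within ?I)"
    unfolding \<gamma>_def[abs_def] by (auto intro!: derivative_eq_intros)
  have "(N has_derivative A (\<gamma> (1/2))) (at (\<gamma> (1/2)) within \<gamma> ` ?I)"
    by (rule has_derivative_subset[OF N_derivative[OF fr[OF h]]]) (use fr in auto)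
  from has_derivative_in_compose[OF d\<gamma> this]
  have "((\<lambda>t. N (\<gamma> t)) has_derivative (\<lambda>t. A (\<gamma> (1/2)) (t *\<^sub>R v))) (at (1/2) within ?I)" .
  then have "((\<lambda>t. N (\<gamma> t)) has_derivative (\<lambda>t. A (\<gamma> (1/2)) (t *\<^sub>R v))) (at (1/2))"
    using at_within_open[OF h] by simp
  then have "((\<lambda>t. N z1) has_derivative (\<lambda>t. A (\<gamma> (1/2)) (t *\<^sub>R v))) (at (1/2))"
    by (rule has_derivative_transform_within_open[of _ _ _ _ ?I]) (use N in auto)
  from has_derivative_unique[OF this has_derivative_const]
  have "A (\<gamma> (1/2)) (1 *\<^sub>R v) = 0" by metis
  moreover have "A (\<gamma> (1/2)) v \<bullet> v > 0"
    using A_pos[OF fr[OF h] _ v] orth N[OF h] by simp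
  ultimately show False by simp
qed

text \<open>On unit vectors this is the inverse of the Gauss map \<open>N\<close>; for \<open>u = 0\<close> it is an arbitrary
  point of the body.\<close>

definition Xp where "Xp u = (SOME x. x \<in> K \<and> (\<forall>y\<in>K. y \<bullet> u \<le> x \<bullet> u))"

lemma Xp: "Xp u \<in> K" "y \<in> K \<Longrightarrow> y \<bullet> u \<le> Xp u \<bullet> u"
proof -
  have "K \<noteq> {}" using interior_K interior_subset by blast
  then have "\<exists>x\<in>K. \<forall>y\<in>K. y \<bullet> u \<le> x \<bullet> u"
    by (intro continuous_attains_sup[OF compact_K] continuous_intros)
  then have "\<exists>x. x \<in> K \<and> (\<forall>y\<in>K. y \<bullet> u \<le> x \<bullet> u)" by blast
  from someI_ex[OF this] show "Xp u \<in> K" "y \<in> K \<Longrightarrow> y \<bullet> u \<le> Xp u \<bullet> u" by (auto simp: Xp_def)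
qed

lemma Xp_supports: "u \<noteq> 0 \<Longrightarrow> supports (Xp u) (u /\<^sub>R norm u)"
  by (rule supports_normalize) (use Xp(2) in \<open>auto simp: inner_diff_left\<close>)

lemma Xp_frontier: assumes u: "u \<noteq> 0" shows "Xp u \<in> frontier K"
  using Xp(1) support_strict[OF Xp_supports[OF u], of "Xp u"] by (auto simp: in_frontier_iff)

lemma N_Xp: "u \<noteq> 0 \<Longrightarrow> N (Xp u) = u /\<^sub>R norm u"
  by (rule N_eqI[OF Xp_frontier Xp_supports])

lemma Xp_N: assumes z: "z \<in> frontier K" shows "Xp (N z) = z"
proof (rule N_inj[OF _ z])
  have "N z \<noteq> 0" using norm_N[OF z] by auto
  then show "Xp (N z) \<in> frontier K" "N (Xp (N z)) = N z"
    using Xp_frontier N_Xp norm_N[OF z] by auto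
qed

lemma Xp_scale: assumes "u \<noteq> 0" "c > 0" shows "Xp (c *\<^sub>R u) = Xp u"
proof (rule N_inj)
  have cu: "c *\<^sub>R u \<noteq> 0" using assms by simp
  show "Xp (c *\<^sub>R u) \<in> frontier K" "Xp u \<in> frontier K"
    by (rule Xp_frontier[OF cu], rule Xp_frontier[OF assms(1)])
  show "N (Xp (c *\<^sub>R u)) = N (Xp u)" unfolding N_Xp[OF cu] N_Xp[OF assms(1)] using assms by simp
qed

lemma Xp_continuous: "continuous_on (sphere 0 1) Xp"
proof -
  have "continuous_on (N ` frontier K) Xp"
    by (rule continuous_on_inv[OF N_continuous compact_frontier_K]) (use Xp_N in auto)
  moreover have "sphere 0 1 \<subseteq> N ` frontier K"
  proof
    fix u :: 'a assume "u \<in> sphere 0 1"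
    then have u: "norm u = 1" by simp
    then have "u \<noteq> 0" by auto
    then have "N (Xp u) = u" "Xp u \<in> frontier K" using N_Xp[of u] Xp_frontier[of u] u by auto
    then show "u \<in> N ` frontier K" by (metis image_eqI)
  qed
  ultimately show ?thesis by (rule continuous_on_subset)
qed

text \<open>The height \<open>\<rho>\<close> over the tangent hyperplane vanishes to first order along the frontier, so
  that both \<open>0\<close> and its linear part \<open>v \<bullet> \<nu>\<close> are derivatives of it within the frontier.
  Adding a multiple of their difference alters the shape operator in the normal direction
  only; the choice below sends \<open>\<nu>\<close> to itself.\<close>

lemma N_derivative_invertible:
  assumes z: "z \<in> frontier K"
  obtains A' B where "(N has_derivative A') (at z within frontier K)" "bounded_linear B" "\<And>v. B (A' v) = v"
proof -
  define \<nu> where "\<nu> = N z"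
  have \<nu>\<nu>: "\<nu> \<bullet> \<nu> = 1" using norm_N[OF z] by (simp add: \<nu>_def dot_square_norm)
  have linA: "linear (A z)" using N_derivative[OF z] has_derivative_linear by blast
  define \<rho> where "\<rho> x = (x - z) \<bullet> \<nu>" for x
  have \<rho>0: "(\<rho> has_derivative (\<lambda>v. 0)) (at z within frontier K)"
    unfolding has_derivative_within_alt
  proof (intro conjI allI impI)
    fix e :: real assume "e > 0"
    then obtain d where d: "d > 0" "\<And>x. x \<in> frontier K \<Longrightarrow> dist x z < d \<Longrightarrow> dist (N x) (N z) < e"
      using N_continuous z unfolding continuous_on_iff by blast
    have "norm (\<rho> x - \<rho> z - 0) \<le> e * norm (x - z)" if x: "x \<in> frontier K" "norm (x - z) < d" for x
    proof -
      have 1: "\<rho> x \<le> 0" using N_le[OF z] x(1) frontier_subset by (auto simp: \<rho>_def \<nu>_def)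
      have "(z - x) \<bullet> N x \<le> 0" using N_le[OF x(1)] z frontier_subset by auto
      then have "- \<rho> x \<le> (x - z) \<bullet> (N x - \<nu>)"
        by (simp add: \<rho>_def inner_diff_left inner_diff_right)
      also have "\<dots> \<le> norm (x - z) * norm (N x - \<nu>)" by (rule norm_cauchy_schwarz)
      also have "\<dots> \<le> norm (x - z) * e"
        using d(2)[OF x(1)] x(2) by (intro mult_left_mono) (auto simp: dist_norm \<nu>_def)
      finally show ?thesis using 1 by (simp add: \<rho>_def mult.commute)
    qed
    then show "\<exists>d>0. \<forall>x\<in>frontier K. norm (x - z) < d \<longrightarrow> norm (\<rho> x - \<rho> z - 0) \<le> e * norm (x - z)"
      using d(1) by blast
  qed simp
  have \<rho>1: "(\<rho> has_derivative (\<lambda>v. v \<bullet> \<nu>)) (at z within frontier K)"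
    unfolding \<rho>_def[abs_def] by (auto intro!: derivative_eq_intros)
  define w where "w = A z \<nu> - \<nu>"
  define A' where "A' v = A z v - (v \<bullet> \<nu>) *\<^sub>R w" for v
  have "((\<lambda>x. N x - \<rho> x *\<^sub>R w + \<rho> x *\<^sub>R w) has_derivative
      (\<lambda>v. A z v - (v \<bullet> \<nu>) *\<^sub>R w + 0 *\<^sub>R w)) (at z within frontier K)"
    by (intro has_derivative_add has_derivative_diff N_derivative[OF z]
        has_derivative_scaleR_left \<rho>0 \<rho>1)
  then have d: "(N has_derivative A') (at z within frontier K)" by (simp add: A'_def[abs_def])
  then have linA': "linear A'" by (rule has_derivative_linear)
  have "inj A'"
  proof (rule linear_injective_0[OF linA', THEN iffD2], intro allI impI)
    fix v assume 0: "A' v = 0"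
    define t where "t = v - (v \<bullet> \<nu>) *\<^sub>R \<nu>"
    have t\<nu>: "t \<bullet> \<nu> = 0" using \<nu>\<nu> by (simp add: t_def inner_diff_left)
    have "A z t = A z v - (v \<bullet> \<nu>) *\<^sub>R A z \<nu>" by (simp add: t_def linear_diff[OF linA] linear_cmul[OF linA])
    also have "\<dots> = - (v \<bullet> \<nu>) *\<^sub>R \<nu>" using 0 by (simp add: A'_def w_def scaleR_diff_right algebra_simps)
    finally have At: "A z t = - (v \<bullet> \<nu>) *\<^sub>R \<nu>" .
    then have "A z t \<bullet> t = 0" using t\<nu> by (simp add: inner_commute)
    then have t0: "t = 0" using A_pos[OF z, of t] t\<nu> by (auto simp: \<nu>_def)
    have "v = t + (v \<bullet> \<nu>) *\<^sub>R \<nu>" by (simp add: t_def)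
    also have "\<dots> = 0" using At t0 linear_0[OF linA] by simp
    finally show "v = 0" .
  qed
  then obtain B where "linear B" "B \<circ> A' = id" using linear_injective_left_inverse[OF linA'] by blast
  then show ?thesis using d by (intro that[of A' B]) (auto simp: linear_conv_bounded_linear fun_eq_iff)
qed

text \<open>Near a nonzero vector \<open>Xp\<close> is the radial projection followed by the inverse of the Gauss
  map, and the latter is differentiable within the sphere because the derivative of the
  Gauss map is invertible.\<close>

lemma Xp_differentiable: assumes u: "u \<noteq> 0" shows "Xp differentiable (at u)"
proof -
  define \<sigma> where "\<sigma> u = u /\<^sub>R norm u" for u :: 'a
  have \<sigma>S: "\<sigma> v \<in> sphere 0 1" if "v \<noteq> 0" for v using that by (simp add: \<sigma>_def)
  have "\<sigma> differentiable (at u)"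
    unfolding \<sigma>_def[abs_def] by (rule differentiable_normalize[of "\<lambda>x. x"]) (use u in auto)
  then obtain \<sigma>' where \<sigma>': "(\<sigma> has_derivative \<sigma>') (at u within - {0})"
    using has_derivative_at_withinI unfolding differentiable_def by blast
  have z: "Xp (\<sigma> u) \<in> frontier K" using \<sigma>S[OF u] by (intro Xp_frontier) auto
  obtain A' B where AB: "(N has_derivative A') (at (Xp (\<sigma> u)) within frontier K)" "bounded_linear B" "\<And>v. B (A' v) = v"
    by (rule N_derivative_invertible[OF z]) blast
  have "(Xp has_derivative B) (at (\<sigma> u) within sphere 0 1)"
  proof (rule has_derivative_inverse_within[OF AB])
    show "continuous (at (\<sigma> u) within sphere 0 1) Xp"
      using Xp_continuous \<sigma>S[OF u] by (auto simp: continuous_on_eq_continuous_within)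
    show "Xp x \<in> frontier K" "N (Xp x) = x" if "x \<in> sphere 0 1" for x
    proof -
      have "norm x = 1" using that by simp
      moreover from this have "x \<noteq> 0" by auto
      ultimately show "Xp x \<in> frontier K" "N (Xp x) = x" using N_Xp[of x] Xp_frontier[of x] by auto
    qed
  qed (use \<sigma>S[OF u] in auto)
  then have "(Xp has_derivative B) (at (\<sigma> u) within \<sigma> ` (- {0}))"
    by (rule has_derivative_subset) (use \<sigma>S in blast)
  moreover have "at u within - {0} = at u" by (rule at_within_open) (use u in auto)
  ultimately have "((\<lambda>v. Xp (\<sigma> v)) has_derivative (\<lambda>v. B (\<sigma>' v))) (at u)"
    using has_derivative_in_compose[OF \<sigma>', of Xp B] by simp
  then have "(Xp has_derivative (\<lambda>v. B (\<sigma>' v))) (at u)"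
    by (rule has_derivative_transform_within_open[of _ _ _ _ "- {0}"])
      (use u Xp_scale in \<open>auto simp: \<sigma>_def\<close>)
  then show ?thesis by (rule differentiableI)
qed

end

section \<open>Ordinary differential equations with Lipschitz right-hand side\<close>

lemma antiderivative_on_interval:
  fixes f :: "real \<Rightarrow> 'a::banach"
  assumes I: "open I" "is_interval I" "t0 \<in> I" and f: "continuous_on I f"
  obtains F where "F t0 = 0" "\<And>t. t \<in> I \<Longrightarrow> (F has_vector_derivative f t) (at t)"
proof -
  \<comment> \<open>One of the two integrals vanishes, depending on the side of \<open>t0\<close> on which \<open>u\<close>
    lies.\<close>
  define F where "F u = integral {t0..u} f - integral {u..t0} f" for u
  have "(F has_vector_derivative f t) (at t)" if t: "t \<in> I" for t
  proof -
    have mM: "min t t0 \<in> I" "max t t0 \<in> I" using t I(3) by (auto simp: min_def max_def)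
    obtain e1 where e1: "e1 > 0" "cball (min t t0) e1 \<subseteq> I" using I(1) mM(1) open_contains_cball by blast
    obtain e2 where e2: "e2 > 0" "cball (max t t0) e2 \<subseteq> I" using I(1) mM(2) open_contains_cball by blast
    define a where "a = min t t0 - e1"
    define b where "b = max t t0 + e2"
    have ab: "a < t" "t < b" "a < t0" "t0 < b" using e1(1) e2(1) by (auto simp: a_def b_def)
    have "a \<in> cball (min t t0) e1" "b \<in> cball (max t t0) e2"
      using e1(1) e2(1) by (auto simp: a_def b_def dist_real_def)
    then have abI: "a \<in> I" "b \<in> I" using e1(2) e2(2) by blast+
    have sub: "{a..b} \<subseteq> I"
    proof
      fix s assume "s \<in> {a..b}"
      then show "s \<in> I" using I(2) abI unfolding is_interval_1 by (meson atLeastAtMost_iff)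
    qed
    have cont: "continuous_on {a..b} f" using f sub by (rule continuous_on_subset)
    have eq: "F u = integral {a..u} f - integral {a..t0} f" if u: "u \<in> {a..b}" for u
    proof (cases "t0 \<le> u")
      case True
      have "integral {a..t0} f + integral {t0..u} f = integral {a..u} f"
        using True ab u cont
        by (intro Henstock_Kurzweil_Integration.integral_combine integrable_continuous_real)
          (auto intro: continuous_on_subset)
      moreover have "integral {u..t0} f = 0" using True by (cases "u = t0") auto
      ultimately show ?thesis by (simp add: F_def algebra_simps)
    next
      case False
      have "integral {a..u} f + integral {u..t0} f = integral {a..t0} f"
        using False ab u cont
        by (intro Henstock_Kurzweil_Integration.integral_combine integrable_continuous_real)
          (auto intro: continuous_on_subset)
      moreover have "integral {t0..u} f = 0" using False by auto
      ultimately show ?thesis by (simp add: F_def algebra_simps)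
    qed
    have "((\<lambda>u. integral {a..u} f) has_vector_derivative f t) (at t within {a..b})"
      by (rule integral_has_vector_derivative[OF cont]) (use ab in auto)
    from has_vector_derivative_diff[OF this has_vector_derivative_const[of "integral {a..t0} f"]]
    have "((\<lambda>u. integral {a..u} f - integral {a..t0} f) has_vector_derivative f t) (at t within {a<..<b})"
      by (auto intro: has_vector_derivative_within_subset)
    then have "((\<lambda>u. integral {a..u} f - integral {a..t0} f) has_vector_derivative f t) (at t)"
      using at_within_open[of t "{a<..<b}"] ab by auto
    then show ?thesis
      by (rule has_vector_derivative_transform_within_open[of _ _ _ "{a<..<b}"]) (use ab eq in auto)
  qed
  moreover have "F t0 = 0" by (simp add: F_def)
  ultimately show ?thesis by (intro that)
qed

lemma exponential_growth_bound_forward: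
  fixes G :: "real \<Rightarrow> 'a::real_inner"
  assumes G: "G 0 = 0" "\<And>s. (G has_vector_derivative g s) (at s)"
    and g: "\<And>s. norm (g s) \<le> C * exp (l * \<bar>s\<bar>)" and l: "l > 0" and t: "t \<ge> 0"
  shows "norm (G t) \<le> C / l * exp (l * t)"
proof (cases "G t = 0")
  case True
  have "norm (g 0) \<le> C" using g[of 0] by simp
  then have "C \<ge> 0" by (rule order_trans[OF norm_ge_zero])
  then show ?thesis using True l by simp
next
  case False
  define e where "e = G t /\<^sub>R norm (G t)"
  have e: "norm e = 1" using False by (simp add: e_def)
  have "norm (g 0) \<le> C" using g[of 0] by simp
  then have C: "C \<ge> 0" by (rule order_trans[OF norm_ge_zero])
  define \<phi> where "\<phi> s = G s \<bullet> e - C / l * exp (l * s)" for s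
  have "\<exists>y. (\<phi> has_real_derivative y) (at s) \<and> y \<le> 0" if s: "0 \<le> s" "s \<le> t" for s
  proof (intro exI conjI)
    have 1: "((\<lambda>s. G s \<bullet> e) has_real_derivative g s \<bullet> e) (at s)"
      unfolding has_real_derivative_iff_has_vector_derivative
      by (rule bounded_linear.has_vector_derivative[OF bounded_linear_inner_left G(2)])
    have 2: "((\<lambda>s. C / l * exp (l * s)) has_real_derivative C * exp (l * s)) (at s)"
      using l by (auto intro!: derivative_eq_intros)
    show "(\<phi> has_real_derivative g s \<bullet> e - C * exp (l * s)) (at s)"
      unfolding \<phi>_def by (rule DERIV_diff[OF 1 2])
    have "g s \<bullet> e \<le> norm (g s) * norm e" by (rule norm_cauchy_schwarz)
    then show "g s \<bullet> e - C * exp (l * s) \<le> 0" using g[of s] s e by simp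
  qed
  then have "\<phi> t \<le> \<phi> 0" by (rule DERIV_nonpos_imp_nonincreasing[OF t])
  then have "G t \<bullet> e \<le> C / l * exp (l * t) - C / l" by (simp add: \<phi>_def G(1))
  moreover have "G t \<bullet> e = norm (G t)" using False by (simp add: e_def dot_square_norm power2_eq_square)
  moreover have "C / l \<ge> 0" using C l by simp
  ultimately show ?thesis by linarith
qed

lemma exponential_growth_bound:
  fixes G :: "real \<Rightarrow> 'a::real_inner"
  assumes G: "G 0 = 0" "\<And>s. (G has_vector_derivative g s) (at s)"
    and g: "\<And>s. norm (g s) \<le> C * exp (l * \<bar>s\<bar>)" and l: "l > 0"
  shows "norm (G t) \<le> C / l * exp (l * \<bar>t\<bar>)"
proof (cases "t \<ge> 0")
  case True
  then show ?thesis using exponential_growth_bound_forward[OF assms] by simp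
next
  case False
  have "((\<lambda>s. G (- s)) has_vector_derivative - g (- s)) (at s)" for s
  proof -
    have "((\<lambda>s. - s) has_vector_derivative - 1) (at s)" by (auto intro!: derivative_eq_intros)
    from vector_diff_chain_at[OF this G(2)] show ?thesis by (simp add: o_def)
  qed
  from exponential_growth_bound_forward[of "\<lambda>s. G (- s)", OF _ this _ l, of C "- t"] G(1) g False
  show ?thesis by (simp add: abs_of_neg) (metis abs_minus_cancel)
qed

text \<open>Picard iteration on all of the real line at once. A bounded continuous function \<open>u\<close>
  represents the curve \<open>z + exp (l \<bar>t\<bar>) u t\<close>; in this weighted norm the iteration \<open>T\<close>
  contracts by the factor \<open>m / l\<close>, where \<open>m\<close> is the Lipschitz constant.\<close>

theorem global_solution_exists:
  fixes V :: "'a::euclidean_space \<Rightarrow> 'a"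
  assumes V: "\<And>x y. norm (V x - V y) \<le> M * norm (x - y)"
  obtains x where "x 0 = z" "\<And>t. (x has_vector_derivative V (x t)) (at t)"
proof -
  define m where "m = \<bar>M\<bar>"
  have Vm: "norm (V x - V y) \<le> m * norm (x - y)" for x y
    using V[of x y] by (smt (verit) m_def mult_right_mono norm_ge_zero)
  have m: "m \<ge> 0" by (simp add: m_def)
  define l where "l = 2 * m + 1"
  have l: "l > 0" using m by (simp add: l_def)
  have contV: "continuous_on UNIV V"
  proof (rule continuous_on_iff[THEN iffD2], intro ballI allI impI)
    fix x e assume "(0::real) < e"
    then show "\<exists>d>0. \<forall>x'\<in>UNIV. dist x' x < d \<longrightarrow> dist (V x') (V x) < e"
    proof (intro exI[of _ "e / (m + 1)"] conjI ballI impI)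
      show "0 < e / (m + 1)" using \<open>0 < e\<close> m by simp
      fix x' assume "dist x' x < e / (m + 1)"
      then have "(m + 1) * norm (x' - x) < e" using m by (simp add: dist_norm pos_less_divide_eq mult.commute)
      moreover have "m * norm (x' - x) \<le> (m + 1) * norm (x' - x)" by (intro mult_right_mono) auto
      ultimately show "dist (V x') (V x) < e" using Vm[of x' x] by (simp add: dist_norm)
    qed
  qed
  define g where "g u s = V (z + exp (l * \<bar>s\<bar>) *\<^sub>R apply_bcontfun u s)" for u :: "real \<Rightarrow>\<^sub>C 'a" and s
  have "\<exists>F. F 0 = 0 \<and> (\<forall>t. (F has_vector_derivative g u t) (at t))" for u
  proof -
    have "continuous_on UNIV (g u)"
      unfolding g_def[abs_def]
      by (rule continuous_on_compose2[OF contV]) (auto intro!: continuous_intros)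
    then show ?thesis
      using antiderivative_on_interval[of UNIV 0 "g u"] by (metis UNIV_I is_interval_univ open_UNIV)
  qed
  then obtain F where F: "\<And>u. F u 0 = 0" "\<And>u t. (F u has_vector_derivative g u t) (at t)" by metis
  have gbound: "norm (g u s) \<le> (norm (V z) + m * norm u) * exp (l * \<bar>s\<bar>)" for u s
  proof -
    have "norm (g u s - V z) \<le> m * norm (exp (l * \<bar>s\<bar>) *\<^sub>R apply_bcontfun u s)"
      using Vm[of "z + exp (l * \<bar>s\<bar>) *\<^sub>R apply_bcontfun u s" z] by (simp add: g_def)
    also have "\<dots> \<le> m * (exp (l * \<bar>s\<bar>) * norm u)"
      using m norm_bounded[of u s] by (intro mult_left_mono) auto
    finally have "norm (g u s) \<le> norm (V z) + m * (exp (l * \<bar>s\<bar>) * norm u)"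
      using norm_triangle_sub[of "g u s" "V z"] by simp
    also have "norm (V z) \<le> norm (V z) * exp (l * \<bar>s\<bar>)" using l by (simp add: mult_le_cancel_left1)
    finally show ?thesis by (simp add: algebra_simps)
  qed
  define T where "T u = Bcontfun (\<lambda>t. exp (- l * \<bar>t\<bar>) *\<^sub>R F u t)" for u
  have scaled: "norm (exp (- l * \<bar>t\<bar>) *\<^sub>R w) \<le> C" if "norm w \<le> C * exp (l * \<bar>t\<bar>)" for w :: 'a and C t
  proof -
    have "exp (- l * \<bar>t\<bar>) * norm w \<le> exp (- l * \<bar>t\<bar>) * (C * exp (l * \<bar>t\<bar>))"
      using that by (intro mult_left_mono) auto
    also have "\<dots> = C" by (simp add: exp_minus)
    finally show ?thesis by simp
  qed
  have "(\<lambda>t. exp (- l * \<bar>t\<bar>) *\<^sub>R F u t) \<in> bcontfun" for u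
  proof (rule bcontfun_normI)
    have "continuous_on UNIV (F u)"
      by (intro continuous_at_imp_continuous_on ballI has_vector_derivative_continuous[OF F(2)])
    then show "continuous_on UNIV (\<lambda>t. exp (- l * \<bar>t\<bar>) *\<^sub>R F u t)" by (intro continuous_intros)
    show "norm (exp (- l * \<bar>t\<bar>) *\<^sub>R F u t) \<le> (norm (V z) + m * norm u) / l" for t
      by (rule scaled[OF exponential_growth_bound[OF F gbound l]])
  qed
  then have T: "apply_bcontfun (T u) t = exp (- l * \<bar>t\<bar>) *\<^sub>R F u t" for u t
    by (simp add: T_def Bcontfun_inverse)
  have contr: "dist (T u) (T v) \<le> (m / l) * dist u v" for u v
  proof (rule dist_bound)
    fix t
    have "norm (g u s - g v s) \<le> (m * dist u v) * exp (l * \<bar>s\<bar>)" for s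
    proof -
      have "norm (g u s - g v s) \<le> m * norm (exp (l * \<bar>s\<bar>) *\<^sub>R (apply_bcontfun u s - apply_bcontfun v s))"
        using Vm[of "z + exp (l * \<bar>s\<bar>) *\<^sub>R apply_bcontfun u s" "z + exp (l * \<bar>s\<bar>) *\<^sub>R apply_bcontfun v s"]
        by (simp add: g_def scaleR_diff_right)
      also have "\<dots> \<le> m * (exp (l * \<bar>s\<bar>) * dist u v)"
        using m dist_bounded[of u s v] by (intro mult_left_mono) (auto simp: dist_norm)
      finally show ?thesis by (simp add: mult_ac)
    qed
    then have "norm (F u t - F v t) \<le> (m * dist u v) / l * exp (l * \<bar>t\<bar>)"
      by (intro exponential_growth_bound[of "\<lambda>t. F u t - F v t" "\<lambda>t. g u t - g v t"]
          has_vector_derivative_diff F l) (simp_all add: F)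
    from scaled[OF this]
    show "dist (apply_bcontfun (T u) t) (apply_bcontfun (T v) t) \<le> m / l * dist u v"
      by (simp add: T dist_norm flip: scaleR_diff_right)
  qed
  have "0 \<le> m / l" "m / l < 1" using m l by (simp_all add: l_def)
  from banach_fix_type[OF this, of T] contr obtain u where u: "T u = u" by blast
  define x where "x t = z + F u t" for t
  have xF: "exp (l * \<bar>t\<bar>) *\<^sub>R apply_bcontfun u t = F u t" for t
    using T[of u t] unfolding u by (simp add: exp_minus)
  have "(x has_vector_derivative V (x t)) (at t)" for t
  proof -
    have "g u t = V (x t)" by (simp only: g_def x_def xF)
    then show ?thesis
      using has_vector_derivative_add[OF has_vector_derivative_const[of z] F(2)[of u t]]
      unfolding x_def[abs_def] by simp
  qed
  moreover have "x 0 = z" by (simp add: x_def F(1))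
  ultimately show ?thesis by (intro that)
qed

text \<open>Gronwall's argument: the weighted square of the distance \<open>E\<close> does not increase.\<close>

lemma ode_unique_forward:
  fixes y1 y2 :: "real \<Rightarrow> 'a::real_inner"
  assumes t: "t0 \<le> t1"
    and y: "\<And>t. t0 \<le> t \<Longrightarrow> t \<le> t1 \<Longrightarrow> (y1 has_vector_derivative v t *\<^sub>R V (y1 t)) (at t)"
      "\<And>t. t0 \<le> t \<Longrightarrow> t \<le> t1 \<Longrightarrow> (y2 has_vector_derivative v t *\<^sub>R V (y2 t)) (at t)"
    and S: "\<And>t. t0 \<le> t \<Longrightarrow> t \<le> t1 \<Longrightarrow> y1 t \<in> S \<and> y2 t \<in> S"
    and V: "\<And>x y. x \<in> S \<Longrightarrow> y \<in> S \<Longrightarrow> norm (V x - V y) \<le> M * norm (x - y)"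
    and v: "\<And>t. t0 \<le> t \<Longrightarrow> t \<le> t1 \<Longrightarrow> \<bar>v t\<bar> \<le> B"
    and eq: "y1 t0 = y2 t0"
  shows "y1 t1 = y2 t1"
proof -
  define d where "d t = y1 t - y2 t" for t
  define l where "l = 2 * B * M"
  define E where "E t = (d t \<bullet> d t) * exp (- l * t)" for t
  have "\<exists>y. (E has_real_derivative y) (at t) \<and> y \<le> 0" if t: "t0 \<le> t" "t \<le> t1" for t
  proof (intro exI conjI)
    let ?d' = "v t *\<^sub>R V (y1 t) - v t *\<^sub>R V (y2 t)"
    have "(d has_vector_derivative ?d') (at t)"
      unfolding d_def[abs_def] by (rule has_vector_derivative_diff[OF y(1)[OF t] y(2)[OF t]])
    then have "((\<lambda>t. d t \<bullet> d t) has_vector_derivative d t \<bullet> ?d' + ?d' \<bullet> d t) (at t)"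
      by (intro bounded_bilinear.has_vector_derivative[OF bounded_bilinear_inner])
    then have 1: "((\<lambda>t. d t \<bullet> d t) has_real_derivative 2 * (d t \<bullet> ?d')) (at t)"
      by (simp add: has_real_derivative_iff_has_vector_derivative inner_commute)
    have 2: "((\<lambda>t. exp (- l * t)) has_real_derivative exp (- l * t) * (- l)) (at t)"
      by (auto intro!: derivative_eq_intros)
    show "(E has_real_derivative 2 * (d t \<bullet> ?d') * exp (- l * t) + exp (- l * t) * (- l) * (d t \<bullet> d t)) (at t)"
      unfolding E_def[abs_def] by (rule DERIV_mult[OF 1 2])
    have "d t \<bullet> ?d' \<le> norm (d t) * norm ?d'" by (rule norm_cauchy_schwarz)
    also have "norm ?d' = \<bar>v t\<bar> * norm (V (y1 t) - V (y2 t))" by (simp flip: scaleR_diff_right)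
    also have "norm (d t) * \<dots> \<le> norm (d t) * (B * (M * norm (d t)))"
      using S[OF t] V[of "y1 t" "y2 t"] v[OF t] unfolding d_def
      by (intro mult_left_mono mult_mono) auto
    also have "\<dots> = B * M * (d t \<bullet> d t)" by (simp add: dot_square_norm power2_eq_square)
    finally have le: "2 * (d t \<bullet> ?d') \<le> l * (d t \<bullet> d t)" by (simp add: l_def)
    have "2 * (d t \<bullet> ?d') * exp (- l * t) + exp (- l * t) * (- l) * (d t \<bullet> d t) =
        exp (- l * t) * (2 * (d t \<bullet> ?d') - l * (d t \<bullet> d t))"
      by (simp only: right_diff_distrib) simp
    also have "\<dots> \<le> 0" using le by (intro mult_nonneg_nonpos) auto
    finally show "2 * (d t \<bullet> ?d') * exp (- l * t) + exp (- l * t) * (- l) * (d t \<bullet> d t) \<le> 0" .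
  qed
  then have "E t1 \<le> E t0" by (rule DERIV_nonpos_imp_nonincreasing[OF t])
  moreover have "E t0 = 0" using eq by (simp add: E_def d_def)
  ultimately have "d t1 \<bullet> d t1 \<le> 0" by (simp add: E_def mult_le_0_iff)
  then have "d t1 = 0" using inner_gt_zero_iff[of "d t1"] by (metis not_le)
  then show ?thesis by (simp add: d_def)
qed

text \<open>The scalar factor \<open>v\<close> admits integral curves that are traversed with varying speed, as
  characteristics are.\<close>

theorem ode_unique:
  fixes y1 y2 :: "real \<Rightarrow> 'a::real_inner"
  assumes I: "is_interval I" "t0 \<in> I" "t1 \<in> I"
    and y1: "\<And>t. t \<in> I \<Longrightarrow> (y1 has_vector_derivative v t *\<^sub>R V (y1 t)) (at t)" "\<And>t. t \<in> I \<Longrightarrow> y1 t \<in> S"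
    and y2: "\<And>t. t \<in> I \<Longrightarrow> (y2 has_vector_derivative v t *\<^sub>R V (y2 t)) (at t)" "\<And>t. t \<in> I \<Longrightarrow> y2 t \<in> S"
    and V: "\<And>x y. x \<in> S \<Longrightarrow> y \<in> S \<Longrightarrow> norm (V x - V y) \<le> M * norm (x - y)"
    and v: "continuous_on I v"
    and eq: "y1 t0 = y2 t0"
  shows "y1 t1 = y2 t1"
proof -
  have inI: "t \<in> I" if "min t0 t1 \<le> t" "t \<le> max t0 t1" for t
    using I that unfolding is_interval_1 by (metis max_def min_def)
  have "compact (v ` {min t0 t1..max t0 t1})"
    by (intro compact_continuous_image continuous_on_subset[OF v]) (use inI in auto)
  then have "bounded (v ` {min t0 t1..max t0 t1})" by (rule compact_imp_bounded)
  then obtain B where "\<forall>x\<in>v ` {min t0 t1..max t0 t1}. norm x \<le> B" unfolding bounded_iff by blast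
  then have B: "\<bar>v t\<bar> \<le> B" if "min t0 t1 \<le> t" "t \<le> max t0 t1" for t using that by simp
  show ?thesis
  proof (cases "t0 \<le> t1")
    case True
    show ?thesis
      by (rule ode_unique_forward[of t0 t1 y1 v V y2 S M B])
        (use True inI y1 y2 V B eq in \<open>auto simp: min_def max_def\<close>)
  next
    case False
    have refl: "((\<lambda>s. y (- s)) has_vector_derivative (- v (- s)) *\<^sub>R V (y (- s))) (at s)"
      if "(y has_vector_derivative v (- s) *\<^sub>R V (y (- s))) (at (- s))" for y :: "real \<Rightarrow> 'a" and s
    proof -
      have "((\<lambda>s. - s) has_vector_derivative - 1) (at s)" by (auto intro!: derivative_eq_intros)
      from vector_diff_chain_at[OF this that] show ?thesis by (simp add: o_def)
    qed
    have "y1 (- (- t1)) = y2 (- (- t1))"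
    proof (rule ode_unique_forward[of "- t0" "- t1" "\<lambda>s. y1 (- s)" "\<lambda>s. - v (- s)" V "\<lambda>s. y2 (- s)" S M B])
      fix s assume s: "- t0 \<le> s" "s \<le> - t1"
      then have mm: "min t0 t1 \<le> - s" "- s \<le> max t0 t1" using False by auto
      show "((\<lambda>s. y1 (- s)) has_vector_derivative (- v (- s)) *\<^sub>R V (y1 (- s))) (at s)"
        by (rule refl[OF y1(1)[OF inI[OF mm]]])
      show "((\<lambda>s. y2 (- s)) has_vector_derivative (- v (- s)) *\<^sub>R V (y2 (- s))) (at s)"
        by (rule refl[OF y2(1)[OF inI[OF mm]]])
      show "y1 (- s) \<in> S \<and> y2 (- s) \<in> S" using y1(2) y2(2) inI[OF mm] by blast
      show "\<bar>- v (- s)\<bar> \<le> B" using B[OF mm] by simp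
    qed (use False eq V in auto)
    then show ?thesis by simp
  qed
qed

section \<open>Extension of Lipschitz maps\<close>

text \<open>McShane's extension: the infimum of the cones of slope \<open>M\<close> with their vertices on the
  graph.\<close>

lemma lipschitz_extension_real:
  fixes f :: "'a::metric_space \<Rightarrow> real"
  assumes S: "S \<noteq> {}" and M: "M \<ge> 0" and f: "\<And>x y. x \<in> S \<Longrightarrow> y \<in> S \<Longrightarrow> \<bar>f x - f y\<bar> \<le> M * dist x y"
  obtains g where "\<And>x. x \<in> S \<Longrightarrow> g x = f x" "\<And>x y. \<bar>g x - g y\<bar> \<le> M * dist x y"
proof -
  obtain y0 where y0: "y0 \<in> S" using S by blast
  define g where "g x = (INF y\<in>S. f y + M * dist x y)" for x
  have bdd: "bdd_below ((\<lambda>y. f y + M * dist x y) ` S)" for x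
  proof (rule bdd_belowI2)
    fix y assume y: "y \<in> S"
    have "M * dist y0 y \<le> M * (dist x y0 + dist x y)"
      using dist_triangle3[of y0 y x] M by (intro mult_left_mono) auto
    then show "f y0 - M * dist x y0 \<le> f y + M * dist x y" using f[OF y0 y] by (simp add: distrib_left abs_le_iff)
  qed
  have le: "g x \<le> f y + M * dist x y" if "y \<in> S" for x y
    unfolding g_def by (rule cINF_lower[OF bdd that])
  have gf: "g x = f x" if x: "x \<in> S" for x
  proof (rule antisym)
    show "g x \<le> f x" using le[OF x, of x] by simp
    show "f x \<le> g x" unfolding g_def
    proof (rule cINF_greatest[OF S])
      fix y assume "y \<in> S"
      from f[OF x this] show "f x \<le> f y + M * dist x y" by linarith
    qed
  qed
  have "g x - M * dist x x' \<le> g x'" for x x'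
    unfolding g_def[of x']
  proof (rule cINF_greatest[OF S])
    fix y assume y: "y \<in> S"
    have "M * dist x y \<le> M * (dist x x' + dist x' y)" using M by (intro mult_left_mono dist_triangle)
    then show "g x - M * dist x x' \<le> f y + M * dist x' y" using le[OF y, of x] by (simp add: distrib_left)
  qed
  then have "\<bar>g x - g y\<bar> \<le> M * dist x y" for x y
    using dist_commute[of x y] by (smt (verit))
  with gf show ?thesis by (rule that)
qed

lemma lipschitz_extension:
  fixes f :: "'a::metric_space \<Rightarrow> 'b::euclidean_space"
  assumes S: "S \<noteq> {}" and M: "M \<ge> 0" and f: "\<And>x y. x \<in> S \<Longrightarrow> y \<in> S \<Longrightarrow> norm (f x - f y) \<le> M * dist x y"
  obtains g where "\<And>x. x \<in> S \<Longrightarrow> g x = f x" "\<And>x y. norm (g x - g y) \<le> (real DIM('b) * M) * dist x y"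
proof -
  have "\<exists>g. (\<forall>x\<in>S. g x = f x \<bullet> b) \<and> (\<forall>x y. \<bar>g x - g y\<bar> \<le> M * dist x y)" if b: "b \<in> Basis" for b
  proof -
    have "\<bar>f x \<bullet> b - f y \<bullet> b\<bar> \<le> M * dist x y" if "x \<in> S" "y \<in> S" for x y
      using f[OF that] Basis_le_norm[OF b, of "f x - f y"] by (simp add: inner_diff_left)
    from lipschitz_extension_real[OF S M this] show ?thesis by metis
  qed
  then obtain G where G: "\<And>b x. b \<in> Basis \<Longrightarrow> x \<in> S \<Longrightarrow> G b x = f x \<bullet> b"
    "\<And>b x y. b \<in> Basis \<Longrightarrow> \<bar>G b x - G b y\<bar> \<le> M * dist x y" by metis
  define g where "g x = (\<Sum>b\<in>Basis. G b x *\<^sub>R b)" for x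
  have "g x = f x" if "x \<in> S" for x
    using that by (simp add: g_def G(1) euclidean_representation)
  moreover have "norm (g x - g y) \<le> (real DIM('b) * M) * dist x y" for x y
  proof -
    have "norm (g x - g y) = norm (\<Sum>b\<in>Basis. (G b x - G b y) *\<^sub>R b)"
      by (simp add: g_def scaleR_diff_left sum_subtractf)
    also have "\<dots> \<le> (\<Sum>b\<in>(Basis :: 'b set). M * dist x y)"
      by (rule sum_norm_le) (simp add: G(2))
    finally show ?thesis by simp
  qed
  ultimately show ?thesis by (rule that)
qed

section \<open>Derivatives along lines\<close>

lemma has_vector_derivative_along_line:
  assumes "(f has_derivative f') (at w)"
  shows "((\<lambda>t::real. f (w + t *\<^sub>R x)) has_vector_derivative f' x) (at 0)"
proof -
  have 1: "((\<lambda>t::real. w + t *\<^sub>R x) has_derivative (\<lambda>t. t *\<^sub>R x)) (at 0)"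
    by (auto intro!: derivative_eq_intros)
  have "((\<lambda>t. f (w + t *\<^sub>R x)) has_derivative (\<lambda>t. f' (t *\<^sub>R x))) (at 0)"
    by (rule has_derivative_compose[OF 1]) (use assms in simp)
  then show ?thesis
    unfolding has_vector_derivative_def
    using linear_cmul[OF has_derivative_linear[OF assms]] by simp
qed

lemma derivative_along_line_eqI:
  assumes "(f has_derivative f') (at w)"
    and "\<forall>\<^sub>F t in nhds 0. f (w + t *\<^sub>R x) = g t" "(g has_vector_derivative d) (at (0::real))"
  shows "f' x = d"
proof -
  have "((\<lambda>t. f (w + t *\<^sub>R x)) has_vector_derivative d) (at 0)"
    using has_vector_derivative_cong_ev[where f = "\<lambda>t. f (w + t *\<^sub>R x)" and g = g and S = UNIV and x = 0 and f' = d] assms(2,3)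
      eventually_nhds_x_imp_x[OF assms(2)]
    by simp
  with has_vector_derivative_along_line[OF assms(1)] show ?thesis
    by (rule vector_derivative_unique_at)
qed

text \<open>The quotients are required to lie in \<open>S\<close> only for some parameters accumulating at \<open>0\<close>,
  which is the situation at a limit point of a set on which the increments of \<open>f\<close> lie in
  \<open>S\<close>.\<close>

lemma derivative_in_subspace:
  fixes f :: "'a::real_normed_vector \<Rightarrow> 'b::euclidean_space"
  assumes f: "(f has_derivative f') (at w)" and S: "subspace S"
    and ev: "\<exists>\<^sub>F t in at (0::real). f (w + t *\<^sub>R x) - f w \<in> S"
  shows "f' x \<in> S"
proof (rule ccontr)
  assume "f' x \<notin> S"
  then have *: "open (- S)" "f' x \<in> - S" using closed_subspace[OF S] by auto
  have "((\<lambda>t. (f (w + t *\<^sub>R x) - f w) /\<^sub>R t) \<longlongrightarrow> f' x) (at 0)"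
  proof (rule LIM_zero_cancel, rule tendsto_norm_zero_cancel)
    have lim: "((\<lambda>t. norm (f (w + t *\<^sub>R x) - f w - t *\<^sub>R f' x) / norm t) \<longlongrightarrow> 0) (at 0)"
      using has_vector_derivative_along_line[OF f, of x]
      by (simp add: has_vector_derivative_def has_derivative_iff_norm)
    have "norm (f (w + t *\<^sub>R x) - f w - t *\<^sub>R f' x) / norm t =
        norm ((f (w + t *\<^sub>R x) - f w) /\<^sub>R t - f' x)" if "t \<noteq> 0" for t
    proof -
      have "(f (w + t *\<^sub>R x) - f w) /\<^sub>R t - f' x = (f (w + t *\<^sub>R x) - f w - t *\<^sub>R f' x) /\<^sub>R t"
        using that by (simp add: scaleR_diff_right)
      then show ?thesis by (simp add: divide_inverse_commute)
    qed
    then have "\<forall>\<^sub>F t in at 0. norm (f (w + t *\<^sub>R x) - f w - t *\<^sub>R f' x) / norm t =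
        norm ((f (w + t *\<^sub>R x) - f w) /\<^sub>R t - f' x)"
      by (simp add: eventually_at_filter)
    then show "((\<lambda>t. norm ((f (w + t *\<^sub>R x) - f w) /\<^sub>R t - f' x)) \<longlongrightarrow> 0) (at 0)"
      by (rule Lim_transform_eventually[OF lim])
  qed
  from topological_tendstoD[OF this *]
  have "\<forall>\<^sub>F t in at 0. \<not> (f (w + t *\<^sub>R x) - f w \<in> S)"
    by (rule eventually_mono) (use subspace_mul[OF S] in auto)
  with ev show False by (simp add: frequently_def)
qed

lemma dim_span_pair:
  fixes a b :: "(real^'n::finite) \<times> (real^'n)"
  assumes "omega a b \<noteq> 0" shows "dim (span {a, b}) = 2"
proof -
  have "b \<notin> span {a}" using assms by (auto simp: span_singleton omega_linear)
  moreover have "a \<noteq> 0" using assms by (auto simp: omega_linear)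
  moreover have "a \<noteq> b" using assms by auto
  ultimately have "independent {a, b}" "card {a, b} = 2"
    using independent_insert[of b "{a}"] by (auto simp: insert_commute)
  then show ?thesis by (metis dim_span_eq_card_independent)
qed

lemma two_dim_span:
  fixes a b :: "(real^'n::finite) \<times> (real^'n)"
  assumes "omega a b \<noteq> 0" "subspace S" "dim S = 2" "a \<in> S" "b \<in> S"
  shows "S = span {a, b}"
proof -
  have "span {a, b} \<subseteq> S" using assms by (intro span_minimal) auto
  then show ?thesis
    using subspace_dim_equal[of "span {a, b}" S] dim_span_pair[OF assms(1)] assms by simp
qed

lemma omega_orthogonal_hyperplane:
  assumes "\<And>u. u \<bullet> n = 0 \<Longrightarrow> omega v u = 0"
  obtains k where "v = k *\<^sub>R rot n"
proof -
  define k where "k = (rot v \<bullet> n) / (n \<bullet> n)"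
  define w where "w = rot v - k *\<^sub>R n"
  have wn: "w \<bullet> n = 0" by (simp add: w_def k_def inner_diff_left)
  have "rot v \<bullet> w = 0" using assms[OF wn] by (simp add: omega_inner rot_inner)
  then have "w \<bullet> w = 0" using wn by (simp add: w_def inner_diff_left inner_commute)
  then have "rot v = k *\<^sub>R n" by (simp add: w_def)
  then have "rot (rot v) = k *\<^sub>R rot n" by (metis rot_scaleR)
  then have "v = (- k) *\<^sub>R rot n" unfolding rot_rot scaleR_minus_left by (metis minus_minus)
  then show ?thesis by (rule that)
qed

section \<open>Characteristics as integral curves\<close>

locale symplectic_body = strongly_convex_body K for K :: "((real^'n::finite) \<times> (real^'n)) set"
begin

text \<open>The unit vector field that spans the characteristic directions.\<close>

definition W where "W z = - rot (N z)"

lemma norm_W: "z \<in> frontier K \<Longrightarrow> norm (W z) = 1"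
  by (simp add: W_def norm_N)

lemma W_lipschitz:
  obtains M where "M \<ge> 0" "\<And>x y. x \<in> frontier K \<Longrightarrow> y \<in> frontier K \<Longrightarrow> norm (W x - W y) \<le> M * norm (x - y)"
proof -
  have "norm (W x - W y) = norm (N x - N y)" for x y
  proof -
    have "W x - W y = - rot (N x - N y)" by (simp add: W_def rot_diff)
    then show ?thesis by simp
  qed
  then show ?thesis using N_lipschitz that by metis
qed

lemma characteristic_direction_eq:
  assumes z: "z \<in> frontier K"
  shows "v \<in> characteristic_direction K z \<longleftrightarrow> (\<exists>k. v = k *\<^sub>R W z)"
proof
  assume "v \<in> characteristic_direction K z"
  then have v: "\<And>w. w \<bullet> N z = 0 \<Longrightarrow> omega v w = 0"
    unfolding characteristic_direction_def tangent_space_N[OF z] by auto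
  obtain k where "v = k *\<^sub>R rot (N z)" by (rule omega_orthogonal_hyperplane[OF v]) blast
  then have "v = (- k) *\<^sub>R W z" by (simp add: W_def)
  then show "\<exists>k. v = k *\<^sub>R W z" by blast
next
  assume "\<exists>k. v = k *\<^sub>R W z"
  then obtain k where v: "v = k *\<^sub>R W z" by blast
  have "v \<bullet> N z = 0" by (simp add: v W_def inner_commute[of "rot (N z)"])
  moreover have "omega v w = 0" if "w \<bullet> N z = 0" for w
    using that by (simp add: v W_def omega_inner inner_commute)
  ultimately show "v \<in> characteristic_direction K z"
    unfolding characteristic_direction_def tangent_space_N[OF z] by auto
qed

text \<open>The locally extended normal, precomposed with the projection to a small ball, yields a
  Lipschitz vector field on the whole space. It is tangent to the level sets of the local
  equation \<open>f\<close>, since \<open>n \<bullet> rot n = 0\<close>, so its solutions stay on the frontier.\<close>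

lemma local_trajectory:
  assumes z: "z \<in> frontier K"
  obtains \<beta> \<delta> where "\<delta> > 0" "\<beta> 0 = z" "\<And>t. \<bar>t\<bar> < \<delta> \<Longrightarrow> \<beta> t \<in> frontier K"
    "\<And>t. \<bar>t\<bar> < \<delta> \<Longrightarrow> (\<beta> has_vector_derivative W (\<beta> t)) (at t)"
proof -
  obtain r M n f k where r: "r > 0"
    and lip: "\<And>x y. x \<in> ball z r \<Longrightarrow> y \<in> ball z r \<Longrightarrow> norm (n x - n y) \<le> M * norm (x - y)"
    and n1: "\<And>x. x \<in> ball z r \<Longrightarrow> norm (n x) = 1"
    and f: "\<And>x. x \<in> ball z r \<Longrightarrow> (f has_derivative (\<lambda>v. k x * (n x \<bullet> v))) (at x)"
    and zero: "\<And>x. x \<in> ball z r \<Longrightarrow> x \<in> frontier K \<longleftrightarrow> f x = (0 :: real)"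
    and N: "\<And>x. x \<in> ball z r \<Longrightarrow> x \<in> frontier K \<Longrightarrow> N x = n x"
    by (rule local_normal[OF z]) blast
  define c where "c = closest_point (cball z (r / 2))"
  have c: "c x \<in> ball z r" for x
    using closest_point_in_set[of "cball z (r / 2)" x] r by (auto simp: c_def)
  have c_self: "c x = x" if "x \<in> cball z (r / 2)" for x
    using that by (simp add: c_def closest_point_self)
  define V where "V x = - rot (n (c x))" for x
  have "norm (V x - V y) \<le> \<bar>M\<bar> * norm (x - y)" for x y
  proof -
    have "V x - V y = - rot (n (c x) - n (c y))" by (simp add: V_def rot_diff)
    then have "norm (V x - V y) = norm (n (c x) - n (c y))" by simp
    also have "\<dots> \<le> M * norm (c x - c y)" by (rule lip[OF c c])
    also have "\<dots> \<le> \<bar>M\<bar> * norm (c x - c y)" by (intro mult_right_mono) auto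
    also have "norm (c x - c y) \<le> norm (x - y)"
      using closest_point_lipschitz[of "cball z (r / 2)" x y] r by (simp add: c_def dist_norm)
    finally show ?thesis by (simp add: mult_left_mono)
  qed
  then obtain \<beta> where \<beta>: "\<beta> 0 = z" "\<And>t. (\<beta> has_vector_derivative V (\<beta> t)) (at t)"
    by (rule global_solution_exists) blast
  have "isCont \<beta> 0" by (rule has_vector_derivative_continuous[OF \<beta>(2)])
  then obtain \<delta> where \<delta>: "\<delta> > 0" "\<And>t. dist t 0 < \<delta> \<Longrightarrow> dist (\<beta> t) (\<beta> 0) < r / 2"
    using r unfolding continuous_at_eps_delta by (metis half_gt_zero)
  have near: "\<beta> t \<in> cball z (r / 2)" if "\<bar>t\<bar> < \<delta>" for t
    using \<delta>(2)[of t] that \<beta>(1) by (simp add: dist_real_def dist_commute)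
  have near': "\<beta> t \<in> ball z r" if "\<bar>t\<bar> < \<delta>" for t
    using near[OF that] r by auto
  have V: "V (\<beta> t) = - rot (n (\<beta> t))" if "\<bar>t\<bar> < \<delta>" for t
    by (simp add: V_def c_self[OF near[OF that]])
  have fr: "\<beta> t \<in> frontier K" if t: "\<bar>t\<bar> < \<delta>" for t
  proof -
    have "((\<lambda>t. f (\<beta> t)) has_derivative (\<lambda>h. 0)) (at s within {-\<delta><..<\<delta>})" if "s \<in> {-\<delta><..<\<delta>}" for s
    proof -
      have s: "\<bar>s\<bar> < \<delta>" using that by auto
      have "(\<beta> has_derivative (\<lambda>h. h *\<^sub>R V (\<beta> s))) (at s)"
        using \<beta>(2)[of s] by (simp add: has_vector_derivative_def)
      from has_derivative_compose[OF this f[OF near'[OF s]]]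
      show ?thesis by (simp add: V[OF s] has_derivative_at_withinI)
    qed
    from has_derivative_zero_unique[OF _ this, of t 0]
    have "f (\<beta> t) = f (\<beta> 0)" using t \<delta>(1) by (auto simp: abs_less_iff)
    moreover have "f (\<beta> 0) = 0" using zero[of z] z r by (simp add: \<beta>(1))
    ultimately show ?thesis using zero[OF near'[OF t]] by simp
  qed
  have "(\<beta> has_vector_derivative W (\<beta> t)) (at t)" if "\<bar>t\<bar> < \<delta>" for t
    using \<beta>(2)[of t] unfolding V[OF that] W_def N[OF near'[OF that] fr[OF that]] .
  with \<delta>(1) \<beta>(1) fr show ?thesis by (rule that)
qed

text \<open>A solution for a Lipschitz extension \<open>V\<close> of the field \<open>W\<close> exists for all times. The set of
  times at which it is on the frontier is closed, and it is open because the solution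
  coincides with a local trajectory as long as the latter exists.\<close>

lemma trajectory:
  assumes z: "z \<in> frontier K"
  obtains x where "x 0 = z" "\<And>t. x t \<in> frontier K" "\<And>t. (x has_vector_derivative W (x t)) (at t)"
proof -
  obtain M where M: "M \<ge> 0"
    and Wlip: "\<And>x y. x \<in> frontier K \<Longrightarrow> y \<in> frontier K \<Longrightarrow> norm (W x - W y) \<le> M * dist x y"
    unfolding dist_norm by (rule W_lipschitz) blast
  have ne: "frontier K \<noteq> {}" using z by blast
  obtain V where V: "\<And>x. x \<in> frontier K \<Longrightarrow> V x = W x"
    "\<And>x y. norm (V x - V y) \<le> (real DIM((real^'n) \<times> (real^'n)) * M) * dist x y"
    by (rule lipschitz_extension[OF ne M Wlip]) blast+
  have Vn: "norm (V x - V y) \<le> (real DIM((real^'n) \<times> (real^'n)) * M) * norm (x - y)" for x y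
    using V(2)[of x y] by (simp add: dist_norm)
  obtain x where x: "x 0 = z" "\<And>t. (x has_vector_derivative V (x t)) (at t)"
    by (rule global_solution_exists[OF Vn]) blast
  define T where "T = {t. x t \<in> frontier K}"
  have contx: "continuous_on UNIV x"
    by (intro continuous_at_imp_continuous_on ballI has_vector_derivative_continuous[OF x(2)])
  have "closed (x -` frontier K)"
    by (rule closed_vimage[OF compact_imp_closed[OF compact_frontier_K] contx])
  then have "closed T" by (simp add: T_def vimage_def)
  moreover have "open T"
    unfolding open_dist
  proof (intro ballI)
    fix t0 assume "t0 \<in> T"
    then have xt0: "x t0 \<in> frontier K" by (simp add: T_def)
    obtain \<beta> \<delta> where \<beta>: "\<delta> > 0" "\<beta> 0 = x t0"
      "\<And>t. \<bar>t\<bar> < \<delta> \<Longrightarrow> \<beta> t \<in> frontier K"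
      "\<And>t. \<bar>t\<bar> < \<delta> \<Longrightarrow> (\<beta> has_vector_derivative W (\<beta> t)) (at t)"
      by (rule local_trajectory[OF xt0]) blast
    have "x t = \<beta> (t - t0)" if "dist t t0 < \<delta>" for t
    proof (rule ode_unique[of "{t0 - \<delta><..<t0 + \<delta>}" t0 t x "\<lambda>_. 1" V UNIV "\<lambda>t. \<beta> (t - t0)"])
      show "t \<in> {t0 - \<delta><..<t0 + \<delta>}" using that by (auto simp: dist_real_def)
      fix s assume "s \<in> {t0 - \<delta><..<t0 + \<delta>}"
      then have s: "\<bar>s - t0\<bar> < \<delta>" by auto
      have "((\<lambda>s. s - t0) has_vector_derivative 1) (at s)" by (auto intro!: derivative_eq_intros)
      from vector_diff_chain_at[OF this \<beta>(4)[OF s]]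
      show "((\<lambda>t. \<beta> (t - t0)) has_vector_derivative 1 *\<^sub>R V (\<beta> (s - t0))) (at s)"
        by (simp add: o_def V(1)[OF \<beta>(3)[OF s]])
      show "(x has_vector_derivative 1 *\<^sub>R V (x s)) (at s)" using x(2)[of s] by simp
    next
      show "is_interval {t0 - \<delta><..<t0 + \<delta>}" by (simp add: is_interval_1)
      show "t0 \<in> {t0 - \<delta><..<t0 + \<delta>}" using \<beta>(1) by simp
      show "x t0 = \<beta> (t0 - t0)" using \<beta>(2) by simp
    qed (rule Vn continuous_on_const UNIV_I)+
    moreover have "\<beta> (t - t0) \<in> frontier K" if "dist t t0 < \<delta>" for t
      using that by (intro \<beta>(3)) (simp add: dist_real_def)
    ultimately have "t \<in> T" if "dist t t0 < \<delta>" for t using that by (simp add: T_def)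
    then show "\<exists>e>0. \<forall>t. dist t t0 < e \<longrightarrow> t \<in> T" using \<beta>(1) by (intro exI[of _ \<delta>]) simp
  qed
  ultimately have "T = {} \<or> T = UNIV" using clopen by blast
  moreover have "0 \<in> T" using z x(1) by (simp add: T_def)
  ultimately have "T = UNIV" by blast
  then have fr: "x t \<in> frontier K" for t by (auto simp: T_def)
  then have "(x has_vector_derivative W (x t)) (at t)" for t using x(2)[of t] V(1) by simp
  with x(1) fr show ?thesis by (rule that)
qed

lemma W_continuous: "continuous_on (frontier K) W"
  unfolding W_def[abs_def]
  by (intro continuous_on_minus bounded_linear.continuous_on[OF bounded_linear_rot] N_continuous)

text \<open>Maximality comes from uniqueness: an arc \<open>\<gamma>\<close> whose trace contains the trajectory satisfies
  \<open>\<gamma>' = v W(\<gamma>)\<close>, so that it is the trajectory reparametrized by the antiderivative \<open>s\<close> of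
  \<open>v\<close>, and its trace is not larger.\<close>

lemma trajectory_characteristic:
  assumes x: "\<And>t. x t \<in> frontier K" "\<And>t. (x has_vector_derivative W (x t)) (at t)"
  shows "characteristic K (range x)"
  unfolding characteristic_def
proof (intro conjI allI impI)
  have contx: "continuous_on UNIV x"
    by (intro continuous_at_imp_continuous_on ballI has_vector_derivative_continuous[OF x(2)])
  have "characteristic_arc K UNIV x"
    unfolding characteristic_arc_def
  proof (intro conjI ballI)
    show "x C1_differentiable_on UNIV"
      unfolding C1_differentiable_on_def
    proof (intro exI conjI ballI)
      show "(x has_vector_derivative W (x t)) (at t)" for t by (rule x(2))
      show "continuous_on UNIV (\<lambda>t. W (x t))"
        by (rule continuous_on_compose2[OF W_continuous contx]) (use x(1) in auto)
    qed
    fix t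
    have vd: "vector_derivative x (at t) = W (x t)" by (rule vector_derivative_at[OF x(2)])
    show "vector_derivative x (at t) \<noteq> 0" unfolding vd using norm_W[OF x(1)[of t]] by auto
    show "vector_derivative x (at t) \<in> characteristic_direction K (x t)"
      unfolding vd characteristic_direction_eq[OF x(1)] by (rule exI[of _ 1]) simp
  qed (use x(1) in auto)
  then show "\<exists>I \<gamma>. characteristic_arc K I \<gamma> \<and> range x = \<gamma> ` I" by blast
  fix I \<gamma> assume "characteristic_arc K I \<gamma> \<and> range x \<subseteq> \<gamma> ` I"
  then have arc: "characteristic_arc K I \<gamma>" and sub: "range x \<subseteq> \<gamma> ` I" by auto
  have I: "open I" "is_interval I" and \<gamma>S: "\<And>t. t \<in> I \<Longrightarrow> \<gamma> t \<in> frontier K"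
    using arc by (auto simp: characteristic_arc_def)
  obtain D where D: "\<And>t. t \<in> I \<Longrightarrow> (\<gamma> has_vector_derivative D t) (at t)" "continuous_on I D"
    using arc unfolding characteristic_arc_def C1_differentiable_on_def by blast
  have cont\<gamma>: "continuous_on I \<gamma>"
    by (intro continuous_at_imp_continuous_on ballI has_vector_derivative_continuous[OF D(1)])
  obtain t0 where t0: "t0 \<in> I" "\<gamma> t0 = x 0"
  proof -
    have "x 0 \<in> \<gamma> ` I" using sub by blast
    then show ?thesis using that by auto
  qed
  define v where "v t = D t \<bullet> W (\<gamma> t)" for t
  have Dv: "D t = v t *\<^sub>R W (\<gamma> t)" if t: "t \<in> I" for t
  proof -
    have "vector_derivative \<gamma> (at t) \<in> characteristic_direction K (\<gamma> t)"
      using arc t by (simp add: characteristic_arc_def)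
    then have "D t \<in> characteristic_direction K (\<gamma> t)"
      unfolding vector_derivative_at[OF D(1)[OF t]] .
    then obtain k where "D t = k *\<^sub>R W (\<gamma> t)"
      unfolding characteristic_direction_eq[OF \<gamma>S[OF t]] by blast
    moreover have "W (\<gamma> t) \<bullet> W (\<gamma> t) = 1" using norm_W[OF \<gamma>S[OF t]] by (simp add: dot_square_norm)
    ultimately show ?thesis by (simp add: v_def)
  qed
  have contv: "continuous_on I v"
    unfolding v_def[abs_def]
    by (intro continuous_on_inner D(2) continuous_on_compose2[OF W_continuous cont\<gamma>]) (use \<gamma>S in auto)
  obtain s where s: "s t0 = 0" "\<And>t. t \<in> I \<Longrightarrow> (s has_vector_derivative v t) (at t)"
    by (rule antiderivative_on_interval[OF I t0(1) contv]) blast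
  obtain M where WM: "\<And>x y. x \<in> frontier K \<Longrightarrow> y \<in> frontier K \<Longrightarrow> norm (W x - W y) \<le> M * norm (x - y)"
    by (rule W_lipschitz) blast
  have "\<gamma> t = x (s t)" if t: "t \<in> I" for t
  proof (rule ode_unique[of I t0 t \<gamma> v W "frontier K" "\<lambda>t. x (s t)"])
    fix u assume u: "u \<in> I"
    show "(\<gamma> has_vector_derivative v u *\<^sub>R W (\<gamma> u)) (at u)" using D(1)[OF u] unfolding Dv[OF u] .
    from vector_diff_chain_at[OF s(2)[OF u] x(2)]
    show "((\<lambda>t. x (s t)) has_vector_derivative v u *\<^sub>R W (x (s u))) (at u)" by (simp add: o_def)
  qed (use I t0 t \<gamma>S x(1) WM contv s(1) in auto)
  then have "\<gamma> ` I \<subseteq> range x" by auto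
  with sub show "\<gamma> ` I = range x" by blast
qed

end

section \<open>Planar characteristics give a foliation by planes\<close>

locale planar_characteristics = symplectic_body K for K :: "((real^'n::finite) \<times> (real^'n)) set" +
  assumes planar: "\<And>C. characteristic K C \<Longrightarrow> planar C"
begin

text \<open>\<open>Xs w\<close> is the boundary point at which the field \<open>W\<close> is a positive multiple of \<open>w\<close>. The
  vector \<open>Z w\<close> is the velocity of \<open>W\<close> along the trajectory through that point when \<open>w\<close> has
  length one, so \<open>L w\<close> is the direction of the osculating plane of the characteristic.\<close>

definition Xs where "Xs w = Xp (rot w)"
definition Z where "Z w = - rot (A (Xs w) w)"
definition L where "L w = span {w, Z w}"

lemma Xs_frontier: "w \<noteq> 0 \<Longrightarrow> Xs w \<in> frontier K"
  and N_Xs: "w \<noteq> 0 \<Longrightarrow> N (Xs w) = rot (w /\<^sub>R norm w)"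
  using Xp_frontier[of "rot w"] N_Xp[of "rot w"] by (simp_all add: Xs_def rot_scaleR)

lemma W_Xs: "w \<noteq> 0 \<Longrightarrow> W (Xs w) = w /\<^sub>R norm w"
  by (simp add: W_def N_Xs)

lemma Xs_W: assumes "z \<in> frontier K" shows "Xs (W z) = z"
  using Xp_N[OF assms] by (simp add: Xs_def W_def rot_minus)

lemma Xs_scale: "w \<noteq> 0 \<Longrightarrow> c > 0 \<Longrightarrow> Xs (c *\<^sub>R w) = Xs w"
  by (simp add: Xs_def rot_scaleR Xp_scale)

lemma Xs_max: "omega (Xs w') w \<le> omega (Xs w) w"
  using Xp by (simp add: Xs_def omega_inner)

lemma linear_A: "z \<in> frontier K \<Longrightarrow> linear (A z)"
  using N_derivative has_derivative_linear by blast

lemma Z_scale: assumes "w \<noteq> 0" "c > 0" shows "Z (c *\<^sub>R w) = c *\<^sub>R Z w"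
  using assms by (simp add: Z_def Xs_scale linear_cmul[OF linear_A[OF Xs_frontier]] rot_scaleR)

lemma L_scale: assumes w: "w \<noteq> 0" "c > 0" shows "L (c *\<^sub>R w) = L w"
proof -
  have "span {c *\<^sub>R w, c *\<^sub>R Z w} = span {w, Z w}"
    using span_image_scale[of "{w, Z w}" "\<lambda>_. c"] w by simp
  then show ?thesis by (simp add: L_def Z_scale[OF w])
qed

text \<open>Up to a positive factor this is the second fundamental form in the characteristic
  direction.\<close>

lemma omega_Z: assumes w: "w \<noteq> 0" shows "omega w (Z w) > 0"
proof -
  have "w \<bullet> N (Xs w) = 0" by (simp add: N_Xs[OF w] rot_scaleR)
  from A_pos[OF Xs_frontier[OF w] this w] show ?thesis
    by (simp add: Z_def omega_inner rot_minus inner_commute)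
qed

lemma L_subspace: "subspace (L w)" by (simp add: L_def)

lemma L_dim: "w \<noteq> 0 \<Longrightarrow> dim (L w) = 2"
  unfolding L_def by (rule dim_span_pair) (use omega_Z[of w] in simp)

lemma L_self: "w \<in> L w" and Z_in_L: "Z w \<in> L w"
  by (simp_all add: L_def span_base)

lemma L_eqI: assumes "w \<noteq> 0" "subspace S" "dim S = 2" "w \<in> S" "Z w \<in> S" shows "L w = S"
proof -
  have "L w \<subseteq> S" unfolding L_def using assms by (intro span_minimal) auto
  then show ?thesis using subspace_dim_equal[OF L_subspace assms(2)] L_dim[OF assms(1)] assms(3) by simp
qed

lemma in_L_coordinates:
  assumes w: "w \<noteq> 0" and v: "v \<in> L w"
  shows "v = (omega v (Z w) / omega w (Z w)) *\<^sub>R w + (omega w v / omega w (Z w)) *\<^sub>R Z w"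
proof -
  obtain a b where v: "v = a *\<^sub>R w + b *\<^sub>R Z w"
    using v unfolding L_def span_insert span_singleton by (auto simp: algebra_simps)
  have "omega v (Z w) = a * omega w (Z w)" "omega w v = b * omega w (Z w)"
    by (simp_all add: v omega_linear)
  then show ?thesis using omega_Z[OF w] v by simp
qed

text \<open>Along the trajectory through \<open>Xs w\<close> the velocity \<open>p\<close> and its derivative \<open>Z p\<close> remain in
  the direction \<open>S\<close> of the plane that contains the characteristic. They are linearly
  independent, so they span \<open>S\<close> at all times.\<close>

lemma leaf_trajectory:
  assumes w: "w \<noteq> 0"
  obtains p where "p 0 = w /\<^sub>R norm w" "\<And>t. p t \<noteq> 0"
    "\<And>t. (p has_vector_derivative Z (p t)) (at t)" "\<And>t. L (p t) = L w" "\<And>t. Xs (p t) - Xs w \<in> L w"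
proof -
  obtain x where x: "x 0 = Xs w" "\<And>t. x t \<in> frontier K" "\<And>t. (x has_vector_derivative W (x t)) (at t)"
    by (rule trajectory[OF Xs_frontier[OF w]]) blast
  define p where "p t = W (x t)" for t
  have p0: "p 0 = w /\<^sub>R norm w" by (simp add: p_def x(1) W_Xs[OF w])
  have p_nz: "p t \<noteq> 0" for t using norm_W[OF x(2)[of t]] by (auto simp: p_def)
  have Xp: "Xs (p t) = x t" for t by (simp add: p_def Xs_W[OF x(2)])
  have dp: "(p has_vector_derivative Z (p t)) (at t)" for t
  proof -
    have "(x has_derivative (\<lambda>h. h *\<^sub>R p t)) (at t)"
      using x(3)[of t] by (simp add: has_vector_derivative_def p_def)
    moreover have "(N has_derivative A (x t)) (at (x t) within range x)"
      by (rule has_derivative_subset[OF N_derivative[OF x(2)]]) (use x(2) in auto)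
    ultimately have "((\<lambda>t. N (x t)) has_derivative (\<lambda>h. A (x t) (h *\<^sub>R p t))) (at t)"
      by (rule has_derivative_in_compose)
    then have "((\<lambda>t. N (x t)) has_vector_derivative A (x t) (p t)) (at t)"
      by (simp add: has_vector_derivative_def linear_cmul[OF linear_A[OF x(2)]])
    then have "((\<lambda>t. - rot (N (x t))) has_vector_derivative - rot (A (x t) (p t))) (at t)"
      by (intro has_vector_derivative_minus bounded_linear.has_vector_derivative[OF bounded_linear_rot])
    then show ?thesis unfolding p_def[abs_def] W_def[symmetric] Z_def Xp[unfolded p_def] .
  qed
  have "planar (range x)" by (intro planar trajectory_characteristic x)
  then obtain P where P: "affine P" "aff_dim P = 2" "range x \<subseteq> P" unfolding planar_def by blast
  define S where "S = (\<lambda>y. y - x 0) ` P"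
  have x0: "x 0 \<in> P" using P(3) by auto
  have S: "subspace S" unfolding S_def by (rule affine_diffs_subspace_subtract[OF P(1) x0])
  have dimS: "dim S = 2"
    using aff_dim_subspace[OF S] P(2) unfolding S_def aff_dim_translation_eq_subtract by simp
  have xS: "x t - x 0 \<in> S" for t using P(3) by (auto simp: S_def)
  have pS: "p t \<in> S" for t
  proof -
    have d: "(x has_derivative (\<lambda>h. h *\<^sub>R p t)) (at t)"
      using x(3)[of t] by (simp add: has_vector_derivative_def p_def)
    have "x (t + s *\<^sub>R 1) - x t \<in> S" for s
      using subspace_diff[OF S xS[of "t + s *\<^sub>R 1"] xS[of t]] by simp
    then have "\<exists>\<^sub>F s in at (0::real). x (t + s *\<^sub>R 1) - x t \<in> S"
      by (intro eventually_frequently always_eventually) auto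
    from derivative_in_subspace[OF d S this] show ?thesis by simp
  qed
  have ZS: "Z (p t) \<in> S" for t
  proof -
    have d: "(p has_derivative (\<lambda>h. h *\<^sub>R Z (p t))) (at t)"
      using dp[of t] by (simp add: has_vector_derivative_def)
    have "p (t + s *\<^sub>R 1) - p t \<in> S" for s
      using subspace_diff[OF S pS pS] by simp
    then have "\<exists>\<^sub>F s in at (0::real). p (t + s *\<^sub>R 1) - p t \<in> S"
      by (intro eventually_frequently always_eventually) auto
    from derivative_in_subspace[OF d S this] show ?thesis by simp
  qed
  have LS: "L (p t) = S" for t by (rule L_eqI[OF p_nz S dimS pS ZS])
  have "L w = S" using LS[of 0] L_scale[OF w, of "inverse (norm w)"] w by (simp add: p0)
  then show ?thesis
    using xS LS by (intro that[OF p0 p_nz dp]) (simp_all add: Xp x(1)[symmetric])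
qed

text \<open>The hodograph \<open>p\<close> of the characteristic crosses the ray of \<open>w\<close> transversally in the plane
  \<open>L w\<close>, hence meets every ray close to it; all quantities depend on the ray only.\<close>

lemma local_leaf:
  assumes w: "w \<noteq> 0"
  obtains \<epsilon> where "\<epsilon> > 0"
    "\<And>\<sigma>. \<bar>\<sigma>\<bar> < \<epsilon> \<Longrightarrow> L (w + \<sigma> *\<^sub>R Z w) = L w \<and> Xs (w + \<sigma> *\<^sub>R Z w) - Xs w \<in> L w"
proof -
  obtain p where p0: "p 0 = w /\<^sub>R norm w" and p_nz: "\<And>t. p t \<noteq> 0"
    and dp: "\<And>t. (p has_vector_derivative Z (p t)) (at t)" and Lp: "\<And>t. L (p t) = L w"
    and Xp: "\<And>t. Xs (p t) - Xs w \<in> L w"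
    by (rule leaf_trajectory[OF w]) blast
  define q where "q = omega w (Z w)"
  have q: "q > 0" by (simp add: q_def omega_Z[OF w])
  \<comment> \<open>The coordinates of \<open>p t\<close> with respect to \<open>w\<close> and \<open>Z w\<close>; the ray of \<open>p t\<close> is
    determined by the slope \<open>b t / a t\<close>.\<close>
  define a where "a t = omega (p t) (Z w) / q" for t
  define b where "b t = omega w (p t) / q" for t
  have p_eq: "p t = a t *\<^sub>R w + b t *\<^sub>R Z w" for t
    unfolding a_def b_def q_def using Lp[of t] L_self[of "p t"] by (intro in_L_coordinates[OF w]) simp
  have contp: "continuous_on UNIV p"
    by (intro continuous_at_imp_continuous_on ballI has_vector_derivative_continuous[OF dp])
  have conta: "continuous_on UNIV a" and contb: "continuous_on UNIV b"
    unfolding a_def[abs_def] b_def[abs_def] using q by (intro continuous_intros contp; simp)+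
  have a0: "a 0 > 0" using w q by (simp add: a_def p0 omega_linear q_def)
  have b0: "b 0 = 0" by (simp add: b_def p0 omega_linear)
  have "(b has_vector_derivative omega w (Z (p 0)) / q) (at 0)"
    unfolding b_def[abs_def]
    by (rule bounded_linear.has_vector_derivative[OF bounded_linear_divide
          bounded_linear.has_vector_derivative[OF bounded_linear_omega_right dp]])
  then have db: "(b has_real_derivative omega w (Z (p 0)) / q) (at 0)"
    by (simp add: has_real_derivative_iff_has_vector_derivative)
  have "Z (p 0) = inverse (norm w) *\<^sub>R Z w" using w by (simp add: p0 Z_scale)
  then have pos: "omega w (Z (p 0)) / q > 0" using w q by (simp add: omega_linear q_def)
  obtain d1 where "d1 > 0" "\<forall>h>0. 0 + h \<in> UNIV \<longrightarrow> h < d1 \<longrightarrow> b 0 < b (0 + h)"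
    using has_real_derivative_pos_inc_right[OF db pos] by blast
  then have d1: "d1 > 0" "\<And>h. 0 < h \<Longrightarrow> h < d1 \<Longrightarrow> b h > 0" by (simp_all add: b0)
  obtain d2 where "d2 > 0" "\<forall>h>0. 0 - h \<in> UNIV \<longrightarrow> h < d2 \<longrightarrow> b (0 - h) < b 0"
    using has_real_derivative_pos_inc_left[OF db pos] by blast
  then have d2: "d2 > 0" "\<And>h. 0 < h \<Longrightarrow> h < d2 \<Longrightarrow> b (- h) < 0" by (simp_all add: b0)
  have "isCont a 0" using conta continuous_on_eq_continuous_at[OF open_UNIV] by blast
  then obtain d3 where d3: "d3 > 0" "\<And>t. dist t 0 < d3 \<Longrightarrow> dist (a t) (a 0) < a 0"
    using a0 unfolding continuous_at_eps_delta by blast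
  define t1 where "t1 = min d1 (min d2 d3) / 2"
  have mm: "min d1 (min d2 d3) > 0" using d1(1) d2(1) d3(1) by simp
  then have t1: "t1 > 0" "t1 < d1" "t1 < d2" "t1 < d3"
    unfolding t1_def by linarith+
  have apos: "a t > 0" if "t \<in> {-t1..t1}" for t
    using d3(2)[of t] that t1 by (auto simp: dist_real_def abs_less_iff)
  define \<epsilon> where "\<epsilon> = min (b t1 / a t1) (- (b (- t1) / a (- t1)))"
  have "b t1 / a t1 > 0" "b (- t1) / a (- t1) < 0"
    using d1(2)[of t1] d2(2)[of t1] apos[of t1] apos[of "- t1"] t1 by (auto simp: divide_neg_pos)
  then have \<epsilon>: "\<epsilon> > 0" by (simp add: \<epsilon>_def)
  have "L (w + \<sigma> *\<^sub>R Z w) = L w \<and> Xs (w + \<sigma> *\<^sub>R Z w) - Xs w \<in> L w" if \<sigma>: "\<bar>\<sigma>\<bar> < \<epsilon>" for \<sigma>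
  proof -
    have "continuous_on {-t1..t1} (\<lambda>t. b t / a t)"
      by (intro continuous_on_divide continuous_on_subset[OF conta] continuous_on_subset[OF contb])
        (use apos in fastforce)+
    moreover have "b (- t1) / a (- t1) \<le> \<sigma>" "\<sigma> \<le> b t1 / a t1" using \<sigma> by (auto simp: \<epsilon>_def)
    ultimately obtain t where t: "- t1 \<le> t" "t \<le> t1" "b t / a t = \<sigma>"
      using IVT'[of "\<lambda>t. b t / a t" "- t1" \<sigma> t1] t1(1) by auto
    have at: "a t > 0" using apos t by simp
    have "p t = a t *\<^sub>R (w + \<sigma> *\<^sub>R Z w)"
      using at unfolding p_eq[of t] t(3)[symmetric] by (simp add: scaleR_add_right)
    then have v: "w + \<sigma> *\<^sub>R Z w = inverse (a t) *\<^sub>R p t" using at by simp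
    have "L (w + \<sigma> *\<^sub>R Z w) = L (p t)" "Xs (w + \<sigma> *\<^sub>R Z w) = Xs (p t)"
      unfolding v using at by (simp_all add: L_scale[OF p_nz] Xs_scale[OF p_nz])
    then show ?thesis using Lp Xp by simp
  qed
  then show ?thesis by (rule that[OF \<epsilon>])
qed

lemma Xs_differentiable: assumes w: "w \<noteq> 0" shows "Xs differentiable (at w)"
proof -
  have "(Xp \<circ> rot) differentiable (at w)"
  proof (rule differentiable_chain_at)
    show "rot differentiable (at w)"
      using bounded_linear_imp_has_derivative[OF bounded_linear_rot] by (rule differentiableI)
    show "Xp differentiable (at (rot w))" by (rule Xp_differentiable) (use w in simp)
  qed
  then show ?thesis by (simp add: Xs_def[abs_def] o_def)
qed

text \<open>Differentiating \<open>N (Xs v) = rot (v / \<bar>v\<bar>)\<close> in the direction \<open>e\<close> shows that \<open>rot e\<close> is a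
  combination of \<open>rot w\<close> and of the shape operator applied to \<open>X' e = \<mu> w\<close>; that is, \<open>e\<close> is
  a combination of \<open>w\<close> and \<open>Z w\<close>.\<close>

lemma derivative_transversal_in_L:
  assumes w: "w \<noteq> 0" and X': "(Xs has_derivative X') (at w)" and e: "X' e = \<mu> *\<^sub>R w"
  shows "e \<in> L w"
proof -
  have nd: "norm differentiable (at w)" using w by simp
  then have "(\<lambda>v. inverse (norm v)) differentiable (at w)"
    using w by (intro differentiable_inverse) auto
  then obtain g where g: "((\<lambda>v. inverse (norm v)) has_derivative g) (at w)"
    unfolding differentiable_def by blast
  have "((\<lambda>v. rot (v /\<^sub>R norm v)) has_derivative (\<lambda>h. rot (inverse (norm w) *\<^sub>R h + g h *\<^sub>R w))) (at w)"
    by (rule bounded_linear.has_derivative[OF bounded_linear_rot has_derivative_scaleR[OF g has_derivative_ident]])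
  then have 1: "((\<lambda>v. N (Xs v)) has_derivative (\<lambda>h. rot (inverse (norm w) *\<^sub>R h + g h *\<^sub>R w))) (at w)"
    by (rule has_derivative_transform_within_open[of _ _ _ UNIV "- {0}"]) (use w N_Xs in auto)
  have X'w: "(Xs has_derivative X') (at w within - {0})" using X' by (rule has_derivative_at_withinI)
  have "(N has_derivative A (Xs w)) (at (Xs w) within Xs ` (- {0}))"
    by (rule has_derivative_subset[OF N_derivative[OF Xs_frontier[OF w]]]) (use Xs_frontier in blast)
  from has_derivative_in_compose[OF X'w this]
  have "((\<lambda>v. N (Xs v)) has_derivative (\<lambda>h. A (Xs w) (X' h))) (at w within - {0})" .
  moreover have "at w within - {0} = at w" by (rule at_within_open) (use w in auto)
  ultimately have 2: "((\<lambda>v. N (Xs v)) has_derivative (\<lambda>h. A (Xs w) (X' h))) (at w)" by simp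
  have "rot (inverse (norm w) *\<^sub>R e + g e *\<^sub>R w) = A (Xs w) (X' e)"
    using has_derivative_unique[OF 1 2] by metis
  then have "rot (inverse (norm w) *\<^sub>R e + g e *\<^sub>R w) = \<mu> *\<^sub>R A (Xs w) w"
    by (simp add: e linear_cmul[OF linear_A[OF Xs_frontier[OF w]]])
  then have "rot (rot (inverse (norm w) *\<^sub>R e + g e *\<^sub>R w)) = \<mu> *\<^sub>R rot (A (Xs w) w)"
    by (metis rot_scaleR)
  then have "inverse (norm w) *\<^sub>R e + g e *\<^sub>R w = \<mu> *\<^sub>R Z w"
    unfolding rot_rot Z_def scaleR_minus_right by (metis minus_minus)
  then have eq: "inverse (norm w) *\<^sub>R e = \<mu> *\<^sub>R Z w - g e *\<^sub>R w" by (simp add: eq_diff_eq)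
  have "\<mu> *\<^sub>R Z w - g e *\<^sub>R w \<in> L w"
    by (intro subspace_diff subspace_mul L_subspace L_self Z_in_L)
  then have "norm w *\<^sub>R (inverse (norm w) *\<^sub>R e) \<in> L w"
    unfolding eq by (intro subspace_mul L_subspace)
  then show ?thesis using w by simp
qed

lemma connected_leaf: assumes w: "w \<noteq> 0" shows "connected (L w - {0})"
  using aff_dim_subspace[OF L_subspace[of w]] L_dim[OF w]
  by (intro connected_punctured_convex subspace_imp_convex L_subspace) simp

text \<open>The set \<open>D\<close> of all \<open>v\<close> in \<open>L w\<close> with the asserted property is open and closed in the
  connected set \<open>L w - {0}\<close>. Openness is \<open>local_leaf\<close>. At a limit point \<open>v\<close> of \<open>D\<close> whose ray
  does not meet \<open>D\<close>, and for a complementary direction \<open>e\<close>, the derivative \<open>X' e\<close> of \<open>Xs\<close>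
  lies in \<open>L w\<close> as a limit of quotients from \<open>L w\<close>, and it is \<open>omega\<close>-orthogonal to \<open>v\<close>
  because \<open>Xs v\<close> maximizes \<open>omega\<close>. So it is a multiple of \<open>v\<close>, and then \<open>e\<close> lies in \<open>L v\<close>.\<close>

theorem leaf:
  assumes w: "w \<noteq> 0" and w': "w' \<in> L w" "w' \<noteq> 0"
  shows "L w' = L w" "Xs w' - Xs w \<in> L w"
proof -
  define D where "D = {v \<in> L w - {0}. L v = L w \<and> Xs v - Xs w \<in> L w}"
  have "openin (top_of_set (L w - {0})) D"
    unfolding openin_euclidean_subtopology_iff
  proof (intro conjI ballI)
    show "D \<subseteq> L w - {0}" by (auto simp: D_def)
    fix v assume v: "v \<in> D"
    then have v0: "v \<noteq> 0" and Lv: "L v = L w" and Xv: "Xs v - Xs w \<in> L w" by (auto simp: D_def)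
    obtain \<epsilon> where \<epsilon>: "\<epsilon> > 0"
      "\<And>\<sigma>. \<bar>\<sigma>\<bar> < \<epsilon> \<Longrightarrow> L (v + \<sigma> *\<^sub>R Z v) = L v \<and> Xs (v + \<sigma> *\<^sub>R Z v) - Xs v \<in> L v"
      by (rule local_leaf[OF v0]) blast
    define q where "q = omega v (Z v)"
    have q: "q > 0" by (simp add: q_def omega_Z[OF v0])
    define \<alpha> where "\<alpha> y = omega y (Z v) / q" for y
    define \<beta> where "\<beta> y = omega v y / q" for y
    have \<alpha>v: "\<alpha> v = 1" and \<beta>v: "\<beta> v = 0" using q by (simp_all add: \<alpha>_def \<beta>_def q_def)
    have c: "isCont \<alpha> v" "isCont \<beta> v"
      unfolding \<alpha>_def[abs_def] \<beta>_def[abs_def]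
      by (intro bounded_linear.isCont[OF bounded_linear_compose[OF bounded_linear_divide bounded_linear_omega_left]]
          bounded_linear.isCont[OF bounded_linear_compose[OF bounded_linear_divide bounded_linear_omega_right]] continuous_ident)+
    then have "isCont (\<lambda>y. \<beta> y / \<alpha> y) v" using \<alpha>v by (intro continuous_intros) auto
    then obtain d1 where d1: "d1 > 0" "\<And>y. dist y v < d1 \<Longrightarrow> dist (\<beta> y / \<alpha> y) (\<beta> v / \<alpha> v) < \<epsilon>"
      using \<epsilon>(1) unfolding continuous_at_eps_delta by blast
    obtain d2 where d2: "d2 > 0" "\<And>y. dist y v < d2 \<Longrightarrow> dist (\<alpha> y) (\<alpha> v) < 1"
      using c(1) unfolding continuous_at_eps_delta by (meson zero_less_one)
    have "y \<in> D" if y: "y \<in> L w - {0}" and near: "dist y v < min d1 d2" for y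
    proof -
      have \<alpha>: "\<alpha> y > 0" using d2(2)[of y] near by (simp add: \<alpha>v dist_real_def)
      have \<sigma>: "\<bar>\<beta> y / \<alpha> y\<bar> < \<epsilon>" using d1(2)[of y] near by (simp add: \<beta>v dist_real_def)
      have "y = \<alpha> y *\<^sub>R v + \<beta> y *\<^sub>R Z v"
        unfolding \<alpha>_def \<beta>_def q_def using y Lv by (intro in_L_coordinates[OF v0]) auto
      then have yv: "y = \<alpha> y *\<^sub>R (v + (\<beta> y / \<alpha> y) *\<^sub>R Z v)" using \<alpha> by (simp add: scaleR_add_right)
      then have nz: "v + (\<beta> y / \<alpha> y) *\<^sub>R Z v \<noteq> 0" using y by auto
      have "L y = L v" "Xs y - Xs v \<in> L v"
        using \<epsilon>(2)[OF \<sigma>] L_scale[OF nz \<alpha>] Xs_scale[OF nz \<alpha>] yv by metis+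
      moreover from this(2) have "Xs y - Xs w \<in> L w"
        using subspace_add[OF L_subspace[of w] _ Xv, of "Xs y - Xs v"] Lv by simp
      ultimately show ?thesis using y Lv by (simp add: D_def)
    qed
    then show "\<exists>e>0. \<forall>y\<in>L w - {0}. dist y v < e \<longrightarrow> y \<in> D"
      using d1(1) d2(1) by (intro exI[of _ "min d1 d2"]) auto
  qed
  moreover have "closedin (top_of_set (L w - {0})) D"
    unfolding closedin_limpt
  proof (intro conjI allI impI)
    show "D \<subseteq> L w - {0}" by (auto simp: D_def)
    fix v assume v: "v islimpt D \<and> v \<in> L w - {0}"
    then have v0: "v \<noteq> 0" and vL: "v \<in> L w" and lim: "v islimpt D" by auto
    obtain X' where X': "(Xs has_derivative X') (at v)"
      using Xs_differentiable[OF v0] unfolding differentiable_def by blast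
    have contX: "isCont Xs v" using X' has_derivative_continuous by blast
    have Xv: "Xs v - Xs w \<in> L w"
    proof (rule ccontr)
      assume "Xs v - Xs w \<notin> L w"
      moreover have "open (- L w)" by (intro open_Compl closed_subspace L_subspace)
      ultimately have "open (- L w)" "Xs v - Xs w \<in> - L w" by auto
      moreover have "isCont (\<lambda>y. Xs y - Xs w) v" using contX by (intro continuous_intros)
      ultimately obtain d where d: "d > 0" "\<And>y. dist y v < d \<Longrightarrow> Xs y - Xs w \<in> - L w"
        unfolding continuous_at_open using open_dist by (metis (no_types, lifting))
      obtain y where "y \<in> D" "dist y v < d" using lim d(1) unfolding islimpt_approachable by blast
      then show False using d(2) by (auto simp: D_def)
    qed
    obtain e where e: "e \<in> L w" "omega v e \<noteq> 0"
    proof -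
      have "v = (omega v (Z w) / omega w (Z w)) *\<^sub>R w + (omega w v / omega w (Z w)) *\<^sub>R Z w"
        by (rule in_L_coordinates[OF w vL])
      then have "omega v (Z w) \<noteq> 0 \<or> omega w v \<noteq> 0" using v0 by auto
      then have "omega v (Z w) \<noteq> 0 \<or> omega v w \<noteq> 0" using omega_commute[of w v] by simp
      then show ?thesis using that L_self[of w] Z_in_L[of w] by blast
    qed
    have Lspan: "L w = span {v, e}"
      by (rule two_dim_span[OF e(2) L_subspace L_dim[OF w] vL e(1)])
    have "v \<in> D"
    proof (cases "\<exists>y\<in>D. \<exists>k>0. y = k *\<^sub>R v")
      case True
      then obtain y k where y: "y \<in> D" "k > 0" "y = k *\<^sub>R v" by blast
      then have "L v = L w" using L_scale[OF v0 y(2)] by (simp add: D_def)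
      then show ?thesis using v0 vL Xv by (simp add: D_def)
    next
      case False
      define q where "q = omega v e"
      define \<alpha> where "\<alpha> y = omega y e / q" for y
      define \<beta> where "\<beta> y = omega v y / q" for y
      have q: "q \<noteq> 0" using e(2) by (simp add: q_def)
      have y_eq: "y = \<alpha> y *\<^sub>R v + \<beta> y *\<^sub>R e" if yL: "y \<in> L w" for y
      proof -
        obtain s t where y: "y = s *\<^sub>R v + t *\<^sub>R e"
          using yL unfolding Lspan span_insert span_singleton by (auto simp: algebra_simps)
        have "\<alpha> y = s" "\<beta> y = t" using q by (simp_all add: \<alpha>_def \<beta>_def y omega_linear q_def)
        with y show ?thesis by simp
      qed
      have \<alpha>v: "\<alpha> v = 1" and \<beta>v: "\<beta> v = 0" using q by (simp_all add: \<alpha>_def \<beta>_def q_def)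
      have c: "isCont \<alpha> v" "isCont \<beta> v"
        unfolding \<alpha>_def[abs_def] \<beta>_def[abs_def]
        by (intro bounded_linear.isCont[OF bounded_linear_compose[OF bounded_linear_divide bounded_linear_omega_left]]
            bounded_linear.isCont[OF bounded_linear_compose[OF bounded_linear_divide bounded_linear_omega_right]] continuous_ident)+
      then have c': "isCont (\<lambda>y. \<beta> y / \<alpha> y) v" using \<alpha>v by (intro continuous_intros) auto
      obtain d2 where d2: "d2 > 0" "\<And>y. dist y v < d2 \<Longrightarrow> dist (\<alpha> y) (\<alpha> v) < 1"
        using c(1) unfolding continuous_at_eps_delta by (meson zero_less_one)
      have "\<exists>\<^sub>F s in at 0. Xs (v + s *\<^sub>R e) - Xs v \<in> L w"
      proof (rule ccontr)
        assume "\<not> ?thesis"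
        then have "\<forall>\<^sub>F s in at 0. Xs (v + s *\<^sub>R e) - Xs v \<notin> L w" by (simp add: frequently_def)
        then obtain d where d: "d > 0" "\<And>s. s \<noteq> 0 \<Longrightarrow> dist s 0 < d \<Longrightarrow> Xs (v + s *\<^sub>R e) - Xs v \<notin> L w"
          unfolding eventually_at by blast
        obtain d1 where d1: "d1 > 0" "\<And>y. dist y v < d1 \<Longrightarrow> dist (\<beta> y / \<alpha> y) (\<beta> v / \<alpha> v) < d"
          using c' d(1) unfolding continuous_at_eps_delta by blast
        have "min d1 d2 > 0" using d1(1) d2(1) by simp
        then obtain y where y: "y \<in> D" "dist y v < min d1 d2"
          using lim unfolding islimpt_approachable by blast
        have \<alpha>: "\<alpha> y > 0" using d2(2)[of y] y(2) by (simp add: \<alpha>v dist_real_def)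
        define s where "s = \<beta> y / \<alpha> y"
        have yL: "y \<in> L w" "y \<noteq> 0" using y(1) by (auto simp: D_def)
        have ys: "y = \<alpha> y *\<^sub>R (v + s *\<^sub>R e)" using y_eq[OF yL(1)] \<alpha> by (simp add: s_def scaleR_add_right)
        have "s \<noteq> 0" using False y(1) ys \<alpha> by auto
        moreover have "dist s 0 < d" using d1(2)[of y] y(2) by (simp add: \<beta>v s_def)
        ultimately have no: "Xs (v + s *\<^sub>R e) - Xs v \<notin> L w" by (rule d(2))
        have nz: "v + s *\<^sub>R e \<noteq> 0" using ys yL(2) by auto
        have "Xs y = Xs (v + s *\<^sub>R e)" using Xs_scale[OF nz \<alpha>] ys by simp
        moreover have "Xs y - Xs w \<in> L w" using y(1) by (simp add: D_def)
        then have "Xs y - Xs w - (Xs v - Xs w) \<in> L w" by (rule subspace_diff[OF L_subspace _ Xv])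
        ultimately show False using no by simp
      qed
      from derivative_in_subspace[OF X' L_subspace this]
      have X'L: "X' e \<in> L w" .
      have d0: "((\<lambda>y. omega (Xs y) v) has_derivative (\<lambda>h. omega (X' h) v)) (at v)"
        by (rule bounded_linear.has_derivative[OF bounded_linear_omega_left X'])
      have "(\<lambda>h. omega (X' h) v) = (\<lambda>h. 0)"
        by (rule differential_zero_maxmin[OF _ _ d0, of UNIV]) (use Xs_max in auto)
      then have "omega (X' e) v = 0" by metis
      then have "\<beta> (X' e) = 0" using omega_commute[of v "X' e"] by (simp add: \<beta>_def)
      then have "X' e = \<alpha> (X' e) *\<^sub>R v" using y_eq[OF X'L] by simp
      then have "e \<in> L v" by (rule derivative_transversal_in_L[OF v0 X'])
      then have "L v = span {v, e}"
        by (intro two_dim_span[OF e(2) L_subspace L_dim[OF v0] L_self])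
      then show ?thesis using Lspan v0 vL Xv by (simp add: D_def)
    qed
    then show "v \<in> D" .
  qed
  ultimately have "D = {} \<or> D = L w - {0}"
    using connected_leaf[OF w] unfolding connected_clopen by blast
  moreover have "w \<in> D" using w L_self[of w] L_subspace[of w] by (simp add: D_def subspace_0)
  ultimately have "w' \<in> D" using w' by blast
  then show "L w' = L w" "Xs w' - Xs w \<in> L w" by (auto simp: D_def)
qed

end

section \<open>Foliations of the dual space by symplectic planes\<close>

text \<open>What the argument uses of the body, in the dual picture: \<open>X w\<close> is the boundary point at
  which the function \<open>omega _ w\<close> attains its maximum, and the planes \<open>L w\<close> are the
  directions of the planes that contain the characteristics. They partition the nonzero
  vectors into leaves.\<close>

locale planar_foliation =
  fixes X :: "(real^'n::finite) \<times> (real^'n) \<Rightarrow> (real^'n) \<times> (real^'n)"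
    and L :: "(real^'n) \<times> (real^'n) \<Rightarrow> ((real^'n) \<times> (real^'n)) set"
    and B :: real
  assumes dim_ge_2: "CARD('n) \<ge> 2"
    and X_diff: "\<And>w. w \<noteq> 0 \<Longrightarrow> X differentiable (at w)"
    and X_scale: "\<And>w c. w \<noteq> 0 \<Longrightarrow> c > 0 \<Longrightarrow> X (c *\<^sub>R w) = X w"
    and X_max: "\<And>w w'. omega (X w') w \<le> omega (X w) w"
    and X_width: "\<And>w. w \<noteq> 0 \<Longrightarrow> omega (X w - X (- w)) w > 0"
    and X_bdd: "\<And>w. norm (X w) \<le> B"
    and L_subspace: "\<And>w. w \<noteq> 0 \<Longrightarrow> subspace (L w)"
    and L_dim: "\<And>w. w \<noteq> 0 \<Longrightarrow> dim (L w) = 2"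
    and L_self: "\<And>w. w \<noteq> 0 \<Longrightarrow> w \<in> L w"
    and L_same: "\<And>w w'. w \<noteq> 0 \<Longrightarrow> w' \<in> L w \<Longrightarrow> w' \<noteq> 0 \<Longrightarrow> L w' = L w"
    and L_X: "\<And>w w'. w \<noteq> 0 \<Longrightarrow> w' \<in> L w \<Longrightarrow> w' \<noteq> 0 \<Longrightarrow> X w' - X w \<in> L w"
begin

text \<open>\<open>h\<close> is the support function of the body with respect to \<open>omega\<close>. Its even part \<open>H\<close> is half
  the width, and the chord from \<open>X (- w)\<close> to \<open>X w\<close> is twice the vector \<open>U w\<close> and has the
  midpoint \<open>c w\<close>. The field \<open>Y\<close> is the Hamiltonian vector field of \<open>G\<close>, and \<open>Lperp w\<close> is the
  \<open>omega\<close>-complement of the leaf of \<open>w\<close>.\<close>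

definition h where "h w = omega (X w) w"
definition U where "U w = (1/2) *\<^sub>R (X w - X (- w))"
definition c where "c w = (1/2) *\<^sub>R (X w + X (- w))"
definition H where "H w = omega (U w) w"
definition Y where "Y w = H w *\<^sub>R U w"
definition G where "G w = (H w)^2 / 2"
definition DY where "DY w = frechet_derivative Y (at w)"
definition Lperp where "Lperp w = {y. \<forall>x\<in>L w. omega y x = 0}"
definition m where "m w = G (Y w) / G w"

text \<open>The derivative of \<open>X\<close> does not contribute, since \<open>X w\<close> maximizes \<open>omega _ w\<close>.\<close>

lemma h_derivative:
  assumes "w \<noteq> 0" shows "(h has_derivative omega (X w)) (at w)"
proof -
  obtain X' where X': "(X has_derivative X') (at w)"
    using X_diff[OF assms] by (auto simp: differentiable_def)
  have d: "((\<lambda>w'. omega (X w') w) has_derivative (\<lambda>v. omega (X' v) w)) (at w)"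
    by (rule bounded_linear.has_derivative[OF bounded_linear_omega_left X'])
  have "(\<lambda>v. omega (X' v) w) = (\<lambda>v. 0)"
    by (rule differential_zero_maxmin[OF _ _ d, of UNIV]) (use X_max in auto)
  then have "omega (X' v) w = 0" for v by metis
  moreover have "(h has_derivative (\<lambda>v. omega (X w) v + omega (X' v) w)) (at w)"
    unfolding h_def by (rule has_derivative_omega[OF X' has_derivative_ident])
  ultimately show ?thesis by simp
qed

lemma X_comp_minus:
  assumes "w \<noteq> 0" "(X has_derivative X') (at (- w))"
  shows "((\<lambda>w. X (- w)) has_derivative (\<lambda>v. X' (- v))) (at w)"
  by (rule has_derivative_compose[OF has_derivative_minus[OF has_derivative_ident]])
    (use assms in simp)

lemma U_differentiable: "w \<noteq> 0 \<Longrightarrow> U differentiable (at w)"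
  and c_differentiable: "w \<noteq> 0 \<Longrightarrow> c differentiable (at w)"
proof -
  assume w: "w \<noteq> 0"
  obtain X' X'' where "(X has_derivative X') (at w)" "(X has_derivative X'') (at (- w))"
    using X_diff[of w] X_diff[of "- w"] w by (auto simp: differentiable_def)
  note X' = this(1) X_comp_minus[OF w this(2)]
  show "U differentiable (at w)" unfolding U_def[abs_def]
    by (rule differentiableI, rule has_derivative_scaleR_right, rule has_derivative_diff[OF X'])
  show "c differentiable (at w)" unfolding c_def[abs_def]
    by (rule differentiableI, rule has_derivative_scaleR_right, rule has_derivative_add[OF X'])
qed

lemma H_eq: "H w = (h w + h (- w)) / 2"
  by (simp add: H_def U_def h_def omega_linear)

lemma H_derivative:
  assumes w: "w \<noteq> 0" shows "(H has_derivative omega (U w)) (at w)"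
proof -
  have "((\<lambda>w. h (- w)) has_derivative (\<lambda>v. omega (X (- w)) (- v))) (at w)"
    by (rule has_derivative_compose[OF has_derivative_minus[OF has_derivative_ident]])
      (use h_derivative w in simp)
  from has_derivative_add[OF h_derivative[OF w] this]
  have "((\<lambda>w. (h w + h (- w)) / 2) has_derivative
      (\<lambda>v. (omega (X w) v + omega (X (- w)) (- v)) / 2)) (at w)"
    by (rule bounded_linear.has_derivative[OF bounded_linear_divide])
  moreover have "(\<lambda>v. (omega (X w) v + omega (X (- w)) (- v)) / 2) = omega (U w)"
    by (auto simp: U_def omega_linear)
  ultimately show ?thesis by (simp add: H_eq[abs_def])
qed

lemma H_pos: "w \<noteq> 0 \<Longrightarrow> H w > 0"
  using X_width[of w] by (simp add: H_def U_def omega_linear)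

lemma G_pos: "w \<noteq> 0 \<Longrightarrow> G w > 0"
  using H_pos[of w] by (simp add: G_def)

lemma U_scale: "w \<noteq> 0 \<Longrightarrow> a > 0 \<Longrightarrow> U (a *\<^sub>R w) = U w"
  using X_scale[of w a] X_scale[of "- w" a] by (simp add: U_def)

lemma U_minus: "U (- w) = - U w" and c_minus: "c (- w) = c w"
  by (simp_all add: U_def c_def add.commute scaleR_diff_right)

lemma H_minus: "H (- w) = H w"
  by (simp add: H_def U_minus omega_linear)

lemma Y_0 [simp]: "Y 0 = 0" by (simp add: Y_def H_def omega_linear)

lemma Y_scale: "Y (a *\<^sub>R w) = a *\<^sub>R Y w"
proof (cases "w = 0 \<or> a = 0")
  case False
  have pos: "Y (b *\<^sub>R w) = b *\<^sub>R Y w" if "b > 0" for b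
    using U_scale[of w b] False that by (simp add: Y_def H_def omega_linear)
  have min: "Y (- v) = - Y v" for v by (simp add: Y_def H_minus U_minus)
  show ?thesis
  proof (cases "a > 0")
    case False
    then have "- a > 0" using \<open>\<not> (w = 0 \<or> a = 0)\<close> by simp
    from pos[OF this] show ?thesis using min[of "a *\<^sub>R w"] by simp
  qed (rule pos)
qed auto

lemma G_Y: "omega (Y w) w = 2 * G w"
  by (simp add: Y_def G_def H_def omega_linear power2_eq_square)

lemma G_scale: "G (a *\<^sub>R w) = a^2 * G w"
  using G_Y[of "a *\<^sub>R w"] G_Y[of w] by (simp add: Y_scale omega_linear power2_eq_square)

lemma G_derivative:
  assumes w: "w \<noteq> 0" shows "(G has_derivative omega (Y w)) (at w)"
proof -
  have "(G has_derivative (\<lambda>v. (of_nat 2 * omega (U w) v * H w ^ (2 - 1)) / 2)) (at w)"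
    unfolding G_def
    by (rule bounded_linear.has_derivative[OF bounded_linear_divide has_derivative_power[OF H_derivative[OF w]]])
  moreover have "(\<lambda>v. (of_nat 2 * omega (U w) v * H w ^ (2 - 1)) / 2) = omega (Y w)"
    by (auto simp: Y_def omega_linear)
  ultimately show ?thesis by simp
qed

lemma Y_derivative:
  assumes w: "w \<noteq> 0" shows "(Y has_derivative DY w) (at w)"
proof -
  obtain U' where "(U has_derivative U') (at w)"
    using U_differentiable[OF w] by (auto simp: differentiable_def)
  from has_derivative_scaleR[OF H_derivative[OF w] this]
  have "Y differentiable (at w)" unfolding differentiable_def Y_def by blast
  then show ?thesis by (simp add: DY_def frechet_derivative_works)
qed

lemma linear_DY: "w \<noteq> 0 \<Longrightarrow> linear (DY w)"
  using Y_derivative has_derivative_linear by blast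

lemma DY_symmetric:
  assumes w: "w \<noteq> 0" shows "omega (DY w u) v = omega (DY w v) u"
proof (rule second_derivative_symmetric[of "- {0}" w G "\<lambda>x. omega (Y x)"])
  show "((\<lambda>x. omega (Y x) v) has_derivative (\<lambda>u. omega (DY w u) v)) (at w)" for v
    by (rule bounded_linear.has_derivative[OF bounded_linear_omega_left Y_derivative[OF w]])
qed (use w G_derivative in auto)

lemma minus_in_L: "w \<noteq> 0 \<Longrightarrow> - w \<in> L w"
  using L_self L_subspace subspace_neg by blast

lemma Y_in_L: assumes w: "w \<noteq> 0" shows "Y w \<in> L w"
proof -
  have "X (- w) - X w \<in> L w" using L_X[OF w minus_in_L[OF w]] w by simp
  then have "(- H w / 2) *\<^sub>R (X (- w) - X w) \<in> L w"
    using L_subspace[OF w] by (intro subspace_mul)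
  then show ?thesis by (simp add: Y_def U_def scaleR_diff_right)
qed

lemma L_eq: assumes w: "w \<noteq> 0" shows "L w = span {w, Y w}"
  using G_Y[of w] G_pos[OF w] omega_commute[of "Y w" w]
  by (intro two_dim_span) (auto simp: L_subspace L_dim L_self Y_in_L w)

lemma in_L_iff: assumes w: "w \<noteq> 0" shows "x \<in> L w \<longleftrightarrow> (\<exists>\<alpha> \<beta>. x = \<alpha> *\<^sub>R w + \<beta> *\<^sub>R Y w)"
  unfolding L_eq[OF w] span_insert span_singleton by (auto simp: algebra_simps)

lemma comb_in_L: "w \<noteq> 0 \<Longrightarrow> \<alpha> *\<^sub>R w + \<beta> *\<^sub>R Y w \<in> L w"
  using in_L_iff by blast

lemma comb_nonzero:
  assumes w: "w \<noteq> 0" and ab: "\<alpha> \<noteq> 0 \<or> \<beta> \<noteq> 0" shows "\<alpha> *\<^sub>R w + \<beta> *\<^sub>R Y w \<noteq> 0"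
proof
  assume *: "\<alpha> *\<^sub>R w + \<beta> *\<^sub>R Y w = 0"
  have "omega (\<alpha> *\<^sub>R w + \<beta> *\<^sub>R Y w) w = 2 * \<beta> * G w" by (simp add: omega_linear G_Y)
  moreover have "omega (Y w) (\<alpha> *\<^sub>R w + \<beta> *\<^sub>R Y w) = 2 * \<alpha> * G w" by (simp add: omega_linear G_Y)
  ultimately show False using ab G_pos[OF w] unfolding * by (simp add: omega_linear)
qed

lemma in_Lperp_iff: assumes w: "w \<noteq> 0" shows "y \<in> Lperp w \<longleftrightarrow> omega y w = 0 \<and> omega y (Y w) = 0"
proof
  assume y: "omega y w = 0 \<and> omega y (Y w) = 0"
  have "omega y x = 0" if x: "x \<in> L w" for x
  proof -
    obtain \<alpha> \<beta> where "x = \<alpha> *\<^sub>R w + \<beta> *\<^sub>R Y w" using x in_L_iff[OF w] by blast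
    then show ?thesis using y by (simp add: omega_linear)
  qed
  then show "y \<in> Lperp w" by (simp add: Lperp_def)
next
  assume "y \<in> Lperp w"
  then show "omega y w = 0 \<and> omega y (Y w) = 0"
    using L_self[OF w] Y_in_L[OF w] unfolding Lperp_def by blast
qed

lemma Lperp_same: "w \<noteq> 0 \<Longrightarrow> x \<in> L w \<Longrightarrow> x \<noteq> 0 \<Longrightarrow> Lperp x = Lperp w"
  using L_same[of w x] by (simp add: Lperp_def)

lemma Lperp_comb: "y \<in> Lperp w \<Longrightarrow> z \<in> Lperp w \<Longrightarrow> \<alpha> *\<^sub>R y + \<beta> *\<^sub>R z \<in> Lperp w"
  by (auto simp: Lperp_def omega_linear)

lemma decompose:
  assumes w: "w \<noteq> 0"
  obtains \<alpha> \<beta> y where "v = \<alpha> *\<^sub>R w + \<beta> *\<^sub>R Y w + y" "y \<in> Lperp w"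
proof -
  define \<alpha> where "\<alpha> = - omega v (Y w) / (2 * G w)"
  define \<beta> where "\<beta> = omega v w / (2 * G w)"
  have "\<alpha> * (2 * G w) = - omega v (Y w)" "\<beta> * (2 * G w) = omega v w"
    using G_pos[OF w] by (auto simp: \<alpha>_def \<beta>_def)
  moreover have "omega w (Y w) = - (2 * G w)" by (simp only: G_Y omega_commute[of w "Y w"])
  ultimately have "v - (\<alpha> *\<^sub>R w + \<beta> *\<^sub>R Y w) \<in> Lperp w"
    by (simp add: in_Lperp_iff[OF w] omega_linear G_Y)
  then show ?thesis using that[of \<alpha> \<beta> "v - (\<alpha> *\<^sub>R w + \<beta> *\<^sub>R Y w)"] by simp
qed

lemma Lperp_nondegenerate:
  assumes w: "w \<noteq> 0" and z: "z \<in> Lperp w" "\<And>y. y \<in> Lperp w \<Longrightarrow> omega z y = 0" shows "z = 0"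
proof (rule omega_nondegenerate)
  fix v
  obtain \<alpha> \<beta> y where "v = \<alpha> *\<^sub>R w + \<beta> *\<^sub>R Y w + y" "y \<in> Lperp w" by (rule decompose[OF w])
  then show "omega z v = 0" using z in_Lperp_iff[OF w, of z] by (simp add: omega_linear)
qed

lemma DIM_ge_4: "DIM((real^'n) \<times> (real^'n)) \<ge> 4"
  using dim_ge_2 by simp

text \<open>The dimension enters here: in the plane the complement of a leaf is zero, and every convex
  body has planar characteristics.\<close>

lemma Lperp_pair:
  assumes w: "w \<noteq> 0" obtains y y' where "y \<in> Lperp w" "y' \<in> Lperp w" "omega y y' \<noteq> 0"
proof (rule ccontr)
  assume "\<not> thesis"
  with that have "z = 0" if "z \<in> Lperp w" for z using Lperp_nondegenerate[OF w that] that by blast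
  then have "L w = UNIV"
    using decompose[OF w] comb_in_L[OF w] by (metis UNIV_eq_I add.right_neutral)
  with L_dim[OF w] have "DIM((real^'n) \<times> (real^'n)) = 2" by (metis dim_UNIV)
  with DIM_ge_4 show False by linarith
qed

lemma eventually_line_nonzero:
  "w \<noteq> 0 \<Longrightarrow> \<forall>\<^sub>F t in nhds 0. w + t *\<^sub>R (x :: (real^'n) \<times> (real^'n)) \<noteq> 0"
proof -
  assume w: "w \<noteq> 0"
  have "((\<lambda>t. w + t *\<^sub>R x) \<longlongrightarrow> w + 0 *\<^sub>R x) (nhds 0)"
    by (intro tendsto_intros filterlim_ident)
  then show ?thesis using tendsto_imp_eventually_ne[of _ "w + 0 *\<^sub>R x" _ 0] w by simp
qed

lemma DY_L: assumes w: "w \<noteq> 0" and x: "x \<in> L w" shows "DY w x \<in> L w"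
proof (rule derivative_in_subspace[OF Y_derivative[OF w] L_subspace[OF w]])
  have "Y (w + t *\<^sub>R x) - Y w \<in> L w" if nz: "w + t *\<^sub>R x \<noteq> 0" for t
  proof -
    have "w + t *\<^sub>R x \<in> L w"
      using L_subspace[OF w] L_self[OF w] x by (simp add: subspace_add subspace_mul)
    then have "Y (w + t *\<^sub>R x) \<in> L w" using Y_in_L[OF nz] L_same[OF w _ nz] by simp
    then show ?thesis using Y_in_L[OF w] L_subspace[OF w] by (simp add: subspace_diff)
  qed
  then have "\<forall>\<^sub>F t in at 0. Y (w + t *\<^sub>R x) - Y w \<in> L w"
    using eventually_line_nonzero[OF w, of x] by (auto simp: eventually_at_filter elim!: eventually_mono)
  then show "\<exists>\<^sub>F t in at 0. Y (w + t *\<^sub>R x) - Y w \<in> L w"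
    by (rule eventually_frequently[OF trivial_limit_at])
qed

lemma DY_self: assumes w: "w \<noteq> 0" shows "DY w w = Y w"
proof (rule derivative_along_line_eqI[OF Y_derivative[OF w]])
  have "w + t *\<^sub>R w = (1 + t) *\<^sub>R w" for t by (simp add: scaleR_add_left)
  then show "\<forall>\<^sub>F t in nhds 0. Y (w + t *\<^sub>R w) = (1 + t) *\<^sub>R Y w" by (simp add: Y_scale)
  show "((\<lambda>t. (1 + t) *\<^sub>R Y w) has_vector_derivative Y w) (at 0)"
    by (auto intro!: derivative_eq_intros simp: has_vector_derivative_def)
qed

text \<open>\<open>DY w\<close> is symmetric with respect to \<open>omega\<close> and preserves the leaf, so it preserves the
  complement.\<close>

lemma DY_Lperp: assumes w: "w \<noteq> 0" and y: "y \<in> Lperp w" shows "DY w y \<in> Lperp w"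
proof -
  have "omega (DY w y) x = 0" if "x \<in> L w" for x
  proof -
    have "omega (DY w x) y = - omega y (DY w x)" by (rule omega_commute)
    then show ?thesis using DY_symmetric[OF w, of y x] DY_L[OF w that] y by (auto simp: Lperp_def)
  qed
  then show ?thesis by (simp add: Lperp_def)
qed

section \<open>The squared width is quadratic on every leaf\<close>

text \<open>The coordinates of \<open>Y (\<alpha> v + \<beta> Y v)\<close> with respect to the basis \<open>v\<close>, \<open>Y v\<close> of the leaf.\<close>

definition Ycoef_w where "Ycoef_w \<alpha> \<beta> v = - omega (Y (\<alpha> *\<^sub>R v + \<beta> *\<^sub>R Y v)) (Y v) / (2 * G v)"
definition Ycoef_Y where "Ycoef_Y \<alpha> \<beta> v = omega (Y (\<alpha> *\<^sub>R v + \<beta> *\<^sub>R Y v)) v / (2 * G v)"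

lemma omega_w_Y: "omega w (Y w) = - (2 * G w)"
  by (simp only: G_Y omega_commute[of w "Y w"])

lemma Y_comb:
  assumes w: "w \<noteq> 0" and ab: "\<alpha> \<noteq> 0 \<or> \<beta> \<noteq> 0"
  shows "Y (\<alpha> *\<^sub>R w + \<beta> *\<^sub>R Y w) = Ycoef_w \<alpha> \<beta> w *\<^sub>R w + Ycoef_Y \<alpha> \<beta> w *\<^sub>R Y w"
proof -
  let ?w = "\<alpha> *\<^sub>R w + \<beta> *\<^sub>R Y w"
  have "L ?w = L w" using L_same[OF w comb_in_L[OF w] comb_nonzero[OF w ab]] .
  then have "Y ?w \<in> L w" using Y_in_L[OF comb_nonzero[OF w ab]] by simp
  then obtain a b where ab: "Y ?w = a *\<^sub>R w + b *\<^sub>R Y w" using in_L_iff[OF w] by blast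
  have "a = Ycoef_w \<alpha> \<beta> w" "b = Ycoef_Y \<alpha> \<beta> w"
    using G_pos[OF w] unfolding Ycoef_w_def Ycoef_Y_def ab by (auto simp: omega_linear G_Y omega_w_Y)
  with ab show ?thesis by simp
qed

lemma coefficient_differentiable:
  assumes w: "w \<noteq> 0" and ab: "\<alpha> \<noteq> 0 \<or> \<beta> \<noteq> 0"
  shows "((\<lambda>v. Y (\<alpha> *\<^sub>R v + \<beta> *\<^sub>R Y v)) has_derivative
      (\<lambda>y. DY (\<alpha> *\<^sub>R w + \<beta> *\<^sub>R Y w) (\<alpha> *\<^sub>R y + \<beta> *\<^sub>R DY w y))) (at w)"
    and "Ycoef_w \<alpha> \<beta> differentiable (at w)" and "Ycoef_Y \<alpha> \<beta> differentiable (at w)"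
proof -
  have "((\<lambda>v. \<alpha> *\<^sub>R v + \<beta> *\<^sub>R Y v) has_derivative (\<lambda>y. \<alpha> *\<^sub>R y + \<beta> *\<^sub>R DY w y)) (at w)"
    by (intro has_derivative_add has_derivative_scaleR_right has_derivative_ident Y_derivative w)
  from has_derivative_compose[OF this Y_derivative[OF comb_nonzero[OF w ab]]]
  show d: "((\<lambda>v. Y (\<alpha> *\<^sub>R v + \<beta> *\<^sub>R Y v)) has_derivative
      (\<lambda>y. DY (\<alpha> *\<^sub>R w + \<beta> *\<^sub>R Y w) (\<alpha> *\<^sub>R y + \<beta> *\<^sub>R DY w y))) (at w)" .
  have G: "(\<lambda>v. 2 * G v) differentiable (at w)" "2 * G w \<noteq> 0"
    using G_derivative[OF w] G_pos[OF w] by (auto intro!: derivative_intros differentiableI)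
  have "(\<lambda>v. omega (Y (\<alpha> *\<^sub>R v + \<beta> *\<^sub>R Y v)) (Y v)) differentiable (at w)"
    by (rule differentiableI, rule has_derivative_omega[OF d Y_derivative[OF w]])
  then show "Ycoef_w \<alpha> \<beta> differentiable (at w)"
    unfolding Ycoef_w_def[abs_def] by (intro differentiable_divide differentiable_minus G)
  have "(\<lambda>v. omega (Y (\<alpha> *\<^sub>R v + \<beta> *\<^sub>R Y v)) v) differentiable (at w)"
    by (rule differentiableI, rule has_derivative_omega[OF d has_derivative_ident])
  then show "Ycoef_Y \<alpha> \<beta> differentiable (at w)"
    unfolding Ycoef_Y_def[abs_def] by (intro differentiable_divide G)
qed

text \<open>Differentiate the identity \<open>Y_comb\<close> in a direction \<open>y\<close> that is \<open>omega\<close>-orthogonal to the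
  leaf. The leaf components of the result are the derivatives of the two coordinates; they
  vanish because \<open>DY\<close> preserves \<open>Lperp w\<close> at every point of the leaf.\<close>

lemma leaf_variation:
  assumes w: "w \<noteq> 0" and ab: "\<alpha> \<noteq> 0 \<or> \<beta> \<noteq> 0" and y: "y \<in> Lperp w"
    and p': "(Ycoef_w \<alpha> \<beta> has_derivative p') (at w)"
  shows "DY (\<alpha> *\<^sub>R w + \<beta> *\<^sub>R Y w) (\<alpha> *\<^sub>R y + \<beta> *\<^sub>R DY w y) =
      Ycoef_w \<alpha> \<beta> w *\<^sub>R y + Ycoef_Y \<alpha> \<beta> w *\<^sub>R DY w y"
    and "p' y = 0"
proof -
  let ?w = "\<alpha> *\<^sub>R w + \<beta> *\<^sub>R Y w"
  obtain r' where r': "(Ycoef_Y \<alpha> \<beta> has_derivative r') (at w)"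
    using coefficient_differentiable(3)[OF w ab] unfolding differentiable_def by blast
  let ?lhs = "DY ?w (\<alpha> *\<^sub>R y + \<beta> *\<^sub>R DY w y)"
  have "((\<lambda>v. Ycoef_w \<alpha> \<beta> v *\<^sub>R v + Ycoef_Y \<alpha> \<beta> v *\<^sub>R Y v) has_derivative
      (\<lambda>y. (Ycoef_w \<alpha> \<beta> w *\<^sub>R y + p' y *\<^sub>R w) + (Ycoef_Y \<alpha> \<beta> w *\<^sub>R DY w y + r' y *\<^sub>R Y w))) (at w)"
    by (intro has_derivative_add has_derivative_scaleR p' r' has_derivative_ident Y_derivative w)
  then have "((\<lambda>v. Y (\<alpha> *\<^sub>R v + \<beta> *\<^sub>R Y v)) has_derivative
      (\<lambda>y. (Ycoef_w \<alpha> \<beta> w *\<^sub>R y + p' y *\<^sub>R w) + (Ycoef_Y \<alpha> \<beta> w *\<^sub>R DY w y + r' y *\<^sub>R Y w))) (at w)"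
    by (rule has_derivative_transform_within_open[of _ _ w UNIV "- {0}"])
      (use w Y_comb[OF _ ab] in auto)
  from has_derivative_unique[OF coefficient_differentiable(1)[OF w ab] this]
  have eq: "?lhs = (Ycoef_w \<alpha> \<beta> w *\<^sub>R y + p' y *\<^sub>R w) + (Ycoef_Y \<alpha> \<beta> w *\<^sub>R DY w y + r' y *\<^sub>R Y w)"
    by metis
  have Dy: "DY w y \<in> Lperp w" by (rule DY_Lperp[OF w y])
  have same: "Lperp ?w = Lperp w" by (rule Lperp_same[OF w comb_in_L[OF w] comb_nonzero[OF w ab]])
  have "?lhs \<in> Lperp w"
    using DY_Lperp[OF comb_nonzero[OF w ab], of "\<alpha> *\<^sub>R y + \<beta> *\<^sub>R DY w y"] Lperp_comb[OF y Dy] same by simp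
  then have "omega ?lhs w = 0" "omega ?lhs (Y w) = 0" using in_Lperp_iff[OF w] by blast+
  moreover have "omega y w = 0" "omega y (Y w) = 0" "omega (DY w y) w = 0" "omega (DY w y) (Y w) = 0"
    using y Dy in_Lperp_iff[OF w] by blast+
  ultimately have 0: "p' y = 0" "r' y = 0"
    unfolding eq using G_pos[OF w] by (auto simp: omega_linear G_Y omega_w_Y)
  show "p' y = 0" by fact
  show "?lhs = Ycoef_w \<alpha> \<beta> w *\<^sub>R y + Ycoef_Y \<alpha> \<beta> w *\<^sub>R DY w y" unfolding eq 0 by simp
qed

text \<open>Pairing \<open>leaf_variation\<close> for \<open>y\<close> with \<open>\<alpha> y' + \<beta> DY y'\<close> and antisymmetrizing in \<open>y\<close> and
  \<open>y'\<close> cancels the left-hand side, as the second derivative of \<open>G\<close> is symmetric.\<close>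

lemma variation_pairing:
  assumes w: "w \<noteq> 0" and ab: "\<alpha> \<noteq> 0 \<or> \<beta> \<noteq> 0" and y: "y \<in> Lperp w" "y' \<in> Lperp w"
  shows "\<alpha> * Ycoef_w \<alpha> \<beta> w * omega y y' + \<beta> * Ycoef_Y \<alpha> \<beta> w * omega (DY w y) (DY w y') = 0"
proof -
  let ?w = "\<alpha> *\<^sub>R w + \<beta> *\<^sub>R Y w"
  let ?E = "\<lambda>y. \<alpha> *\<^sub>R y + \<beta> *\<^sub>R DY w y"
  obtain p' where p': "(Ycoef_w \<alpha> \<beta> has_derivative p') (at w)"
    using coefficient_differentiable(2)[OF w ab] unfolding differentiable_def by blast
  have v: "DY ?w (?E z) = Ycoef_w \<alpha> \<beta> w *\<^sub>R z + Ycoef_Y \<alpha> \<beta> w *\<^sub>R DY w z" if "z \<in> Lperp w" for z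
    by (rule leaf_variation(1)[OF w ab that p'])
  have "omega (DY ?w (?E y)) (?E y') = omega (DY ?w (?E y')) (?E y)"
    by (rule DY_symmetric[OF comb_nonzero[OF w ab]])
  then have "omega (Ycoef_w \<alpha> \<beta> w *\<^sub>R y + Ycoef_Y \<alpha> \<beta> w *\<^sub>R DY w y) (?E y') =
      omega (Ycoef_w \<alpha> \<beta> w *\<^sub>R y' + Ycoef_Y \<alpha> \<beta> w *\<^sub>R DY w y') (?E y)"
    by (simp only: v y)
  moreover have "omega (DY w y) y' = omega (DY w y') y" by (rule DY_symmetric[OF w])
  moreover have "omega y' y = - omega y y'" "omega y (DY w y') = - omega (DY w y') y"
    "omega y' (DY w y) = - omega (DY w y) y'" "omega (DY w y') (DY w y) = - omega (DY w y) (DY w y')"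
    by (rule omega_commute)+
  ultimately show ?thesis by (simp add: omega_linear algebra_simps)
qed

lemma G_line_derivative:
  assumes w: "w \<noteq> 0"
  shows "((\<lambda>\<beta>. G (w + \<beta> *\<^sub>R Y w)) has_real_derivative - 2 * G w * Ycoef_w 1 \<beta> w) (at \<beta>)"
proof -
  have nz: "w + \<beta> *\<^sub>R Y w \<noteq> 0" using comb_nonzero[OF w, of 1 \<beta>] by simp
  have "((\<lambda>\<beta>. w + \<beta> *\<^sub>R Y w) has_derivative (\<lambda>t. t *\<^sub>R Y w)) (at \<beta>)"
    by (auto intro!: derivative_eq_intros)
  from has_derivative_compose[OF this G_derivative[OF nz]]
  have "((\<lambda>\<beta>. G (w + \<beta> *\<^sub>R Y w)) has_derivative (\<lambda>t. t * omega (Y (w + \<beta> *\<^sub>R Y w)) (Y w))) (at \<beta>)"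
    by (simp only: omega_scaleR_right)
  moreover have "omega (Y (w + \<beta> *\<^sub>R Y w)) (Y w) = - 2 * G w * Ycoef_w 1 \<beta> w"
    using G_pos[OF w] by (simp add: Ycoef_w_def)
  then have "(\<lambda>t. t * omega (Y (w + \<beta> *\<^sub>R Y w)) (Y w)) = (*) (- 2 * G w * Ycoef_w 1 \<beta> w)"
    by (simp add: fun_eq_iff)
  ultimately show ?thesis by (simp only: has_field_derivative_def)
qed

lemma G_line_eq:
  assumes w: "w \<noteq> 0"
  shows "G (w + \<beta> *\<^sub>R Y w) = G w * (Ycoef_Y 1 \<beta> w - \<beta> * Ycoef_w 1 \<beta> w)"
proof -
  have "2 * G (w + \<beta> *\<^sub>R Y w) = omega (Y (w + \<beta> *\<^sub>R Y w)) (w + \<beta> *\<^sub>R Y w)" by (simp only: G_Y)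
  also have "Y (w + \<beta> *\<^sub>R Y w) = Ycoef_w 1 \<beta> w *\<^sub>R w + Ycoef_Y 1 \<beta> w *\<^sub>R Y w"
    using Y_comb[OF w, of 1 \<beta>] by simp
  finally show ?thesis by (simp add: omega_linear G_Y omega_w_Y algebra_simps)
qed

lemma G_continuous: "w \<noteq> 0 \<Longrightarrow> isCont G w"
  using G_derivative has_derivative_continuous by blast

lemma Y_nonzero: "w \<noteq> 0 \<Longrightarrow> Y w \<noteq> 0"
  using comb_nonzero[of w 0 1] by simp

lemma m_pos: "w \<noteq> 0 \<Longrightarrow> m w > 0"
  by (simp add: m_def G_pos Y_nonzero)

text \<open>With \<open>k\<close> the ratio of \<open>omega (DY y) (DY y')\<close> and \<open>omega y y'\<close>, the relation
  \<open>variation_pairing\<close> on the line \<open>w + \<beta> Y w\<close> becomes a linear differential equation for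
  \<open>g \<beta> = G (w + \<beta> Y w)\<close>, with solution \<open>G w (1 + k \<beta>\<^sup>2)\<close>.\<close>

lemma leaf_quadratic_of_pair:
  assumes w: "w \<noteq> 0" and y: "y \<in> Lperp w" "y' \<in> Lperp w" and s: "omega y y' \<noteq> 0"
  shows "omega (DY w y) (DY w y') = m w * omega y y'"
    and "G (w + \<beta> *\<^sub>R Y w) = G w * (1 + m w * \<beta>^2)"
proof -
  define k where "k = omega (DY w y) (DY w y') / omega y y'"
  define g where "g \<beta> = G (w + \<beta> *\<^sub>R Y w)" for \<beta>
  have g0: "g \<beta> > 0" for \<beta>
    using G_pos[OF comb_nonzero[OF w, of 1 \<beta>]] by (simp add: g_def)
  have Gw: "G w > 0" by (rule G_pos[OF w])
  define g' where "g' \<beta> = - 2 * G w * Ycoef_w 1 \<beta> w" for \<beta>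
  have dg: "(g has_real_derivative g' \<beta>) (at \<beta>)" for \<beta>
    unfolding g_def g'_def by (rule G_line_derivative[OF w])
  have ode: "g' \<beta> * (1 + k * \<beta>^2) = 2 * \<beta> * k * g \<beta>" for \<beta>
  proof -
    have "Ycoef_w 1 \<beta> w * omega y y' + \<beta> * Ycoef_Y 1 \<beta> w * (k * omega y y') = 0"
      using variation_pairing[OF w _ y, of 1 \<beta>] s by (simp add: k_def)
    then have "(Ycoef_w 1 \<beta> w + \<beta> * Ycoef_Y 1 \<beta> w * k) * omega y y' = 0" by (simp only: distrib_right mult.assoc)
    then have 1: "Ycoef_w 1 \<beta> w = - (\<beta> * Ycoef_Y 1 \<beta> w * k)" using s by simp
    show ?thesis
      unfolding g_def G_line_eq[OF w] g'_def 1 by (simp add: power2_eq_square algebra_simps)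
  qed
  \<comment> \<open>For negative \<open>k\<close> the equation would force \<open>g\<close> to vanish where \<open>1 + k \<beta>\<^sup>2\<close> does.\<close>
  have k0: "k \<ge> 0"
  proof (rule ccontr)
    assume k: "\<not> k \<ge> 0"
    define \<beta> where "\<beta> = 1 / sqrt (- k)"
    have "\<beta>^2 = 1 / (- k)" using k by (simp add: \<beta>_def power_divide)
    then have "1 + k * \<beta>^2 = 0" using k by (simp add: field_simps)
    with ode[of \<beta>] have "2 * \<beta> * k * g \<beta> = 0" by simp
    moreover have "\<beta> \<noteq> 0" using k by (simp add: \<beta>_def)
    ultimately show False using k g0[of \<beta>] by simp
  qed
  have pos: "1 + k * \<beta>^2 > 0" for \<beta> using k0 by (simp add: add_pos_nonneg)
  have "((\<lambda>\<beta>. g \<beta> / (1 + k * \<beta>^2)) has_real_derivative 0) (at \<beta>)" for \<beta>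
    by (rule derivative_eq_intros dg refl | use pos[of \<beta>] ode[of \<beta>] in \<open>simp add: algebra_simps\<close>)+
  then have "g \<beta> / (1 + k * \<beta>^2) = g 0 / (1 + k * 0^2)" for \<beta>
    using DERIV_isconst_all by blast
  then have g: "g \<beta> = G w * (1 + k * \<beta>^2)" for \<beta>
    using pos[of \<beta>] by (simp add: g_def divide_eq_eq)
  \<comment> \<open>The value at infinity: by homogeneity, \<open>g \<beta> / \<beta>\<^sup>2\<close> tends to \<open>G (Y w)\<close>.\<close>
  have "k = m w"
  proof -
    have lim1: "((\<lambda>\<epsilon>. G (\<epsilon> *\<^sub>R w + Y w)) \<longlongrightarrow> G (0 *\<^sub>R w + Y w)) (at 0)"
      by (rule isCont_tendsto_compose[of _ G]) (use G_continuous Y_nonzero[OF w] in \<open>auto intro!: tendsto_eq_intros\<close>)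
    have eq: "G (\<epsilon> *\<^sub>R w + Y w) = G w * (\<epsilon>^2 + k)" if "\<epsilon> \<noteq> 0" for \<epsilon>
    proof -
      have "\<epsilon> *\<^sub>R w + Y w = \<epsilon> *\<^sub>R (w + (1 / \<epsilon>) *\<^sub>R Y w)" using that by (simp add: scaleR_add_right)
      then have "G (\<epsilon> *\<^sub>R w + Y w) = \<epsilon>^2 * g (1 / \<epsilon>)" by (simp only: G_scale g_def)
      also have "\<dots> = G w * (\<epsilon>^2 + k)" using that unfolding g by (simp add: power_divide field_simps)
      finally show ?thesis .
    qed
    have "((\<lambda>\<epsilon>. G w * (\<epsilon>^2 + k)) \<longlongrightarrow> G w * (0^2 + k)) (at 0)"
      by (intro tendsto_intros)
    then have "((\<lambda>\<epsilon>. G (\<epsilon> *\<^sub>R w + Y w)) \<longlongrightarrow> G w * (0^2 + k)) (at 0)"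
      by (rule Lim_transform_eventually) (simp add: eventually_at_filter eq)
    from tendsto_unique[OF _ lim1 this] have "G (Y w) = G w * k" by simp
    then show ?thesis using Gw by (simp add: m_def)
  qed
  moreover have "omega (DY w y) (DY w y') = k * omega y y'" using s by (simp add: k_def)
  ultimately show "omega (DY w y) (DY w y') = m w * omega y y'" "G (w + \<beta> *\<^sub>R Y w) = G w * (1 + m w * \<beta>^2)"
    using g[of \<beta>] by (auto simp: g_def)
qed

lemma G_line: "w \<noteq> 0 \<Longrightarrow> G (w + \<beta> *\<^sub>R Y w) = G w * (1 + m w * \<beta>^2)"
  using Lperp_pair leaf_quadratic_of_pair(2) by metis

lemma Ycoef_w_1: assumes w: "w \<noteq> 0" shows "Ycoef_w 1 \<beta> w = - m w * \<beta>"
proof -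
  have "((\<lambda>\<beta>. G w * (1 + m w * \<beta>^2)) has_real_derivative G w * (m w * (2 * \<beta>))) (at \<beta>)"
    by (auto intro!: derivative_eq_intros)
  then have "((\<lambda>\<beta>. G (w + \<beta> *\<^sub>R Y w)) has_real_derivative G w * (m w * (2 * \<beta>))) (at \<beta>)"
    by (simp only: G_line[OF w])
  from DERIV_unique[OF G_line_derivative[OF w] this]
  have "G w * (Ycoef_w 1 \<beta> w + m w * \<beta>) = 0" by (simp add: distrib_left mult.commute mult.left_commute)
  then show ?thesis using G_pos[OF w] by simp
qed

lemma Ycoef_Y_1: assumes w: "w \<noteq> 0" shows "Ycoef_Y 1 \<beta> w = 1"
proof -
  have "G w * (1 + m w * \<beta>^2) = G w * (Ycoef_Y 1 \<beta> w - \<beta> * Ycoef_w 1 \<beta> w)"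
    using G_line_eq[OF w, of \<beta>] G_line[OF w, of \<beta>] by simp
  then have "1 + m w * \<beta>^2 = Ycoef_Y 1 \<beta> w - \<beta> * Ycoef_w 1 \<beta> w" using G_pos[OF w] by simp
  then show ?thesis by (simp add: Ycoef_w_1[OF w] power2_eq_square)
qed

lemma omega_DY_DY:
  assumes w: "w \<noteq> 0" and y: "y \<in> Lperp w" "y' \<in> Lperp w"
  shows "omega (DY w y) (DY w y') = m w * omega y y'"
proof (cases "omega y y' = 0")
  case True
  then show ?thesis using variation_pairing[OF w _ y, of 1 1] by (simp add: Ycoef_Y_1[OF w])
qed (rule leaf_quadratic_of_pair(1)[OF w y])

lemma Ycoef_w_0_1: assumes w: "w \<noteq> 0" shows "Ycoef_w 0 1 w = - m w"
proof -
  have "omega (Y (Y w)) (Y w) = 2 * G (Y w)" by (rule G_Y)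
  then show ?thesis by (simp add: Ycoef_w_def m_def)
qed

lemma Ycoef_Y_0_1: assumes w: "w \<noteq> 0" shows "Ycoef_Y 0 1 w = 0"
proof -
  obtain y y' where y: "y \<in> Lperp w" "y' \<in> Lperp w" "omega y y' \<noteq> 0" by (rule Lperp_pair[OF w])
  then show ?thesis
    using variation_pairing[OF w _ y(1,2), of 0 1] omega_DY_DY[OF w y(1,2)] m_pos[OF w] by simp
qed

lemma Y_Y: assumes w: "w \<noteq> 0" shows "Y (Y w) = - m w *\<^sub>R w"
  using Y_comb[OF w, of 0 1] by (simp add: Ycoef_w_0_1[OF w] Ycoef_Y_0_1[OF w])

lemma Y_leaf: assumes w: "w \<noteq> 0" shows "Y (\<alpha> *\<^sub>R w + \<beta> *\<^sub>R Y w) = \<alpha> *\<^sub>R Y w - (m w * \<beta>) *\<^sub>R w"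
proof (cases "\<alpha> = 0")
  case True
  then show ?thesis using Y_scale[of \<beta> "Y w"] by (simp add: Y_Y[OF w])
next
  case False
  have "Y (w + (\<beta> / \<alpha>) *\<^sub>R Y w) = Y w - (m w * (\<beta> / \<alpha>)) *\<^sub>R w"
    using Y_comb[OF w, of 1 "\<beta> / \<alpha>"] by (simp add: Ycoef_w_1[OF w] Ycoef_Y_1[OF w])
  then have "Y (\<alpha> *\<^sub>R (w + (\<beta> / \<alpha>) *\<^sub>R Y w)) = \<alpha> *\<^sub>R (Y w - (m w * (\<beta> / \<alpha>)) *\<^sub>R w)"
    by (simp only: Y_scale)
  then show ?thesis using False by (simp add: scaleR_add_right scaleR_diff_right)
qed

lemma G_leaf:
  assumes w: "w \<noteq> 0" shows "G (\<alpha> *\<^sub>R w + \<beta> *\<^sub>R Y w) = G w * (\<alpha>^2 + m w * \<beta>^2)"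
proof -
  have "2 * G (\<alpha> *\<^sub>R w + \<beta> *\<^sub>R Y w) = 2 * (G w * (\<alpha>^2 + m w * \<beta>^2))"
    by (simp only: G_Y[symmetric] Y_leaf[OF w])
      (simp add: omega_linear G_Y omega_w_Y power2_eq_square algebra_simps)
  then show ?thesis by simp
qed

lemma DY_Y: assumes w: "w \<noteq> 0" shows "DY w (Y w) = - m w *\<^sub>R w"
proof (rule derivative_along_line_eqI[OF Y_derivative[OF w]])
  show "\<forall>\<^sub>F t in nhds 0. Y (w + t *\<^sub>R Y w) = Y w - (m w * t) *\<^sub>R w"
    using Y_leaf[OF w, of 1] by simp
  show "((\<lambda>t. Y w - (m w * t) *\<^sub>R w) has_vector_derivative - m w *\<^sub>R w) (at 0)"
    by (auto intro!: derivative_eq_intros simp: has_vector_derivative_def mult.commute)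
qed

text \<open>On the leaf this is read off from \<open>Y_leaf\<close>. On the complement it follows from
  \<open>omega_DY_DY\<close> by moving one factor \<open>DY\<close> to the other side.\<close>

lemma DY_DY: assumes w: "w \<noteq> 0" shows "DY w (DY w v) = - m w *\<^sub>R v"
proof -
  obtain \<alpha> \<beta> y where v: "v = \<alpha> *\<^sub>R w + \<beta> *\<^sub>R Y w + y" and y: "y \<in> Lperp w" by (rule decompose[OF w])
  have "1 *\<^sub>R DY w (DY w y) + m w *\<^sub>R y = 0"
  proof (rule Lperp_nondegenerate[OF w])
    show "1 *\<^sub>R DY w (DY w y) + m w *\<^sub>R y \<in> Lperp w" by (intro Lperp_comb DY_Lperp w y)
    fix y' assume y': "y' \<in> Lperp w"
    have "omega (DY w (DY w y)) y' = omega (DY w y') (DY w y)" by (rule DY_symmetric[OF w])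
    also have "\<dots> = m w * omega y' y" by (rule omega_DY_DY[OF w y' y])
    finally show "omega (1 *\<^sub>R DY w (DY w y) + m w *\<^sub>R y) y' = 0"
      using omega_commute[of y y'] by (simp add: omega_linear)
  qed
  then have "DY w (DY w y) = - m w *\<^sub>R y" by (simp add: add_eq_0_iff)
  then show ?thesis
    unfolding v by (simp add: linear_add[OF linear_DY[OF w]] linear_cmul[OF linear_DY[OF w]]
        linear_diff[OF linear_DY[OF w]] DY_self[OF w] DY_Y[OF w] scaleR_add_right mult.commute)
qed

lemma m_leaf: assumes w: "w \<noteq> 0" and ab: "\<alpha> \<noteq> 0 \<or> \<beta> \<noteq> 0" shows "m (\<alpha> *\<^sub>R w + \<beta> *\<^sub>R Y w) = m w"
proof -
  have "Y (\<alpha> *\<^sub>R w + \<beta> *\<^sub>R Y w) = (- (m w * \<beta>)) *\<^sub>R w + \<alpha> *\<^sub>R Y w" by (simp add: Y_leaf[OF w])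
  then have "G (Y (\<alpha> *\<^sub>R w + \<beta> *\<^sub>R Y w)) = G w * ((- (m w * \<beta>))^2 + m w * \<alpha>^2)" by (simp only: G_leaf[OF w])
  also have "\<dots> = m w * G (\<alpha> *\<^sub>R w + \<beta> *\<^sub>R Y w)"
    by (simp add: G_leaf[OF w] power2_eq_square algebra_simps)
  finally show ?thesis
    using G_pos[OF comb_nonzero[OF w ab]] unfolding m_def[of "\<alpha> *\<^sub>R w + \<beta> *\<^sub>R Y w"] by simp
qed

text \<open>Along the leaf \<open>m\<close> is constant by \<open>m_leaf\<close>. Across it, \<open>- m\<close> is the coordinate
  \<open>Ycoef_w 0 1\<close>, whose derivative vanishes by \<open>leaf_variation\<close>.\<close>

lemma m_derivative: assumes w: "w \<noteq> 0" shows "(m has_derivative (\<lambda>_. 0)) (at w)"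
proof -
  obtain p' where p': "(Ycoef_w 0 1 has_derivative p') (at w)"
    using coefficient_differentiable(2)[OF w, of 0 1] unfolding differentiable_def by auto
  have "p' v = 0" for v
  proof -
    obtain \<alpha> \<beta> y where v: "v = \<alpha> *\<^sub>R w + \<beta> *\<^sub>R Y w + y" and y: "y \<in> Lperp w" by (rule decompose[OF w])
    have "p' (\<alpha> *\<^sub>R w + \<beta> *\<^sub>R Y w) = 0"
    proof (rule derivative_along_line_eqI[OF p'])
      have "Ycoef_w 0 1 (w + t *\<^sub>R (\<alpha> *\<^sub>R w + \<beta> *\<^sub>R Y w)) = - m w" if nz: "w + t *\<^sub>R (\<alpha> *\<^sub>R w + \<beta> *\<^sub>R Y w) \<noteq> 0" for t
      proof -
        have eq: "w + t *\<^sub>R (\<alpha> *\<^sub>R w + \<beta> *\<^sub>R Y w) = (1 + t * \<alpha>) *\<^sub>R w + (t * \<beta>) *\<^sub>R Y w"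
          by (simp add: algebra_simps)
        then have "1 + t * \<alpha> \<noteq> 0 \<or> t * \<beta> \<noteq> 0" using nz by auto
        from m_leaf[OF w this] show ?thesis using Ycoef_w_0_1[OF nz] eq by simp
      qed
      then show "\<forall>\<^sub>F t in nhds 0. Ycoef_w 0 1 (w + t *\<^sub>R (\<alpha> *\<^sub>R w + \<beta> *\<^sub>R Y w)) = - m w"
        by (rule eventually_mono[OF eventually_line_nonzero[OF w]])
    qed (rule has_vector_derivative_const)
    moreover have "p' y = 0" using leaf_variation(2)[OF w _ y p'] by simp
    ultimately show ?thesis
      unfolding v by (simp add: linear_add[OF has_derivative_linear[OF p']])
  qed
  then have "((\<lambda>w. - Ycoef_w 0 1 w) has_derivative (\<lambda>_. 0)) (at w)"
    using has_derivative_minus[OF p'] by simp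
  then show ?thesis
    by (rule has_derivative_transform_within_open[of _ _ w UNIV "- {0}"]) (use w Ycoef_w_0_1 in auto)
qed

lemma m_constant: "w \<noteq> 0 \<Longrightarrow> w' \<noteq> 0 \<Longrightarrow> m w = m w'"
proof -
  assume w: "w \<noteq> 0" "w' \<noteq> 0"
  have "connected (- {0 :: (real^'n) \<times> (real^'n)})"
    by (rule connected_punctured_universe) (use DIM_ge_4 in linarith)
  then show ?thesis
    by (rule has_derivative_zero_unique_connected[rotated, of _ m]) (use w m_derivative in auto)
qed

section \<open>Linearity of the Hamiltonian field\<close>

text \<open>The function \<open>m\<close> has the same value at all nonzero points, and the square root of that
  value turns \<open>Y\<close> into a field whose derivative \<open>M\<close> squares to \<open>- 1\<close>.\<close>

definition a where "a = sqrt (m (SOME w. w \<noteq> 0))"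
definition I where "I w = (1 / a) *\<^sub>R Y w"
definition M where "M w v = (1 / a) *\<^sub>R DY w v"

lemma nonzero_vector: obtains v :: "(real^'n) \<times> (real^'n)" where "v \<noteq> 0"
proof -
  obtain i :: "(real^'n) \<times> (real^'n)" where "i \<in> Basis" using nonempty_Basis by blast
  then show ?thesis using that nonzero_Basis by blast
qed

lemma a_pos: "a > 0" and m_eq: "w \<noteq> 0 \<Longrightarrow> m w = a^2"
proof -
  obtain i :: "(real^'n) \<times> (real^'n)" where "i \<noteq> 0" by (rule nonzero_vector)
  define v where "v = (SOME w :: (real^'n) \<times> (real^'n). w \<noteq> 0)"
  have v: "v \<noteq> 0" unfolding v_def using \<open>i \<noteq> 0\<close> by (rule someI)
  show "a > 0" using m_pos[OF v] by (simp add: a_def v_def)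
  show "m w = a^2" if "w \<noteq> 0"
    using m_pos[OF v] m_constant[OF that v] by (simp add: a_def flip: v_def)
qed

lemma I_derivative: "w \<noteq> 0 \<Longrightarrow> (I has_derivative M w) (at w)"
  unfolding I_def[abs_def] M_def[abs_def] by (rule has_derivative_scaleR_right[OF Y_derivative])

lemma M_M: "w \<noteq> 0 \<Longrightarrow> M w (M w v) = - v"
  using a_pos by (simp add: M_def DY_DY m_eq linear_cmul[OF linear_DY] power2_eq_square)

lemma U_bound: "norm (U w) \<le> B"
proof -
  have "norm (X w - X (- w)) \<le> B + B"
    using norm_triangle_ineq4[of "X w" "X (- w)"] X_bdd[of w] X_bdd[of "- w"] by linarith
  then show ?thesis by (simp add: U_def)
qed

lemma B_nonneg: "B \<ge> 0"
  using X_bdd[of 0] norm_ge_zero order_trans by blast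

lemma I_bound: "norm (I w) \<le> (B * B / a) * norm w"
proof -
  have "\<bar>H w\<bar> \<le> norm (U w) * norm (rot w)"
    unfolding H_def omega_inner by (rule Cauchy_Schwarz_ineq2)
  also have "\<dots> \<le> B * norm w" using U_bound by (simp add: mult_right_mono)
  finally have "\<bar>H w\<bar> * norm (U w) \<le> (B * norm w) * B"
    using U_bound B_nonneg by (intro mult_mono) auto
  then have "norm (Y w) / a \<le> (B * norm w) * B / a"
    unfolding Y_def using a_pos by (simp add: divide_right_mono)
  then show ?thesis using a_pos by (simp add: I_def mult.commute mult.left_commute)
qed

lemma I_continuous: "continuous_on UNIV I"
proof -
  have "isCont I w" for w
  proof (cases "w = 0")
    case False
    then show ?thesis using I_derivative has_derivative_continuous by blast
  next
    case True
    have "((\<lambda>w. (B * B / a) * norm w) \<longlongrightarrow> 0) (at (0 :: (real^'n) \<times> (real^'n)))"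
      by (rule tendsto_mult_right_zero[OF tendsto_norm_zero[OF tendsto_ident_at]])
    then have "(I \<longlongrightarrow> 0) (at 0)"
      by (rule Lim_null_comparison[rotated]) (rule always_eventually[OF allI[OF I_bound]])
    then show ?thesis using True by (simp add: isCont_def I_def)
  qed
  then show ?thesis by (simp add: continuous_on_eq_continuous_at)
qed

lemma I_scale: "I (s *\<^sub>R w) = s *\<^sub>R I w"
  by (simp add: I_def Y_scale)

lemma U_max: "omega (U w) w' \<le> H w'"
  using X_max[of w w'] X_max[of "- w" "- w'"] by (simp add: H_eq h_def U_def omega_linear)

lemma H_nonneg: "H w \<ge> 0"
  using H_pos[of w] by (cases "w = 0") (auto simp: H_def omega_linear)

text \<open>The field \<open>Y\<close> is the gradient, with respect to \<open>omega\<close>, of the convex function \<open>G\<close>; for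
  \<open>Y\<close> the pairing is at least \<open>(H w - H w')\<^sup>2\<close>.\<close>

lemma I_monotone: "omega (I w - I w') (w - w') \<ge> 0"
proof -
  have "omega (Y w) (w - w') = H w * (H w - omega (U w) w')"
    by (simp add: Y_def H_def omega_linear right_diff_distrib)
  also have "\<dots> \<ge> H w * (H w - H w')" using U_max H_nonneg by (intro mult_left_mono) auto
  finally have 1: "omega (Y w) (w - w') \<ge> H w * (H w - H w')" .
  have "omega (Y w') (w - w') = H w' * (omega (U w') w - H w')"
    by (simp add: Y_def H_def omega_linear right_diff_distrib)
  also have "\<dots> \<le> H w' * (H w - H w')" using U_max H_nonneg by (intro mult_left_mono) auto
  finally have "omega (Y w - Y w') (w - w') \<ge> H w * (H w - H w') - H w' * (H w - H w')"
    using 1 by (simp add: omega_diff_left)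
  also have "H w * (H w - H w') - H w' * (H w - H w') = (H w - H w')^2"
    by (simp add: power2_eq_square algebra_simps)
  finally have "omega (Y w - Y w') (w - w') \<ge> 0" by (rule order_trans[OF zero_le_power2])
  moreover have "I w - I w' = (1 / a) *\<^sub>R (Y w - Y w')" by (simp add: I_def scaleR_diff_right)
  ultimately show ?thesis using a_pos by (simp add: omega_scaleR_left)
qed

lemma M_positive:
  assumes w: "w \<noteq> 0" shows "omega (M w v) v \<ge> 0"
proof (rule ccontr)
  assume neg: "\<not> omega (M w v) v \<ge> 0"
  have "((\<lambda>t. omega (I (w + t *\<^sub>R v)) v) has_vector_derivative omega (M w v) v) (at 0)"
    by (rule bounded_linear.has_vector_derivative[OF bounded_linear_omega_left
          has_vector_derivative_along_line[OF I_derivative[OF w]]])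
  then have "((\<lambda>t. omega (I (w + t *\<^sub>R v)) v) has_real_derivative omega (M w v) v) (at 0)"
    by (simp add: has_real_derivative_iff_has_vector_derivative)
  from has_real_derivative_neg_dec_right[OF this] neg
  obtain d where d: "d > 0" "\<And>t. 0 < t \<Longrightarrow> t < d \<Longrightarrow> omega (I (w + t *\<^sub>R v)) v < omega (I w) v" by auto
  from d(2)[of "d / 2"] d(1) have "omega (I (w + (d / 2) *\<^sub>R v) - I w) v < 0" by (simp add: omega_diff_left)
  then have "(d / 2) * omega (I (w + (d / 2) *\<^sub>R v) - I w) v < 0" using d(1) by (simp add: mult_pos_neg)
  then show False using I_monotone[of "w + (d / 2) *\<^sub>R v" w] by (simp add: omega_scaleR_right)
qed

text \<open>Denominator and numerator of a Cayley transform. Since the derivative \<open>M\<close> of \<open>I\<close> satisfies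
  \<open>M\<^sup>2 = - 1\<close>, one has \<open>(1 - rot M) M = rot (1 - rot M)\<close> and
  \<open>(1 + rot M) M = - rot (1 + rot M)\<close>. The quotient of the two maps therefore has a
  derivative that anticommutes with \<open>rot\<close>, the complex structure of the space itself.\<close>

definition cay_den where "cay_den w = w - rot (I w)"
definition cay_num where "cay_num w = w + rot (I w)"

lemma cay_den_expanding: "norm (w - w') \<le> norm (cay_den w - cay_den w')"
proof (cases "w = w'")
  case False
  have "(norm (w - w'))^2 \<le> (cay_den w - cay_den w') \<bullet> (w - w')"
  proof -
    have "cay_den w - cay_den w' = (w - w') - rot (I w - I w')" by (simp add: cay_den_def rot_diff)
    then have "(cay_den w - cay_den w') \<bullet> (w - w') = (w - w') \<bullet> (w - w') + omega (I w - I w') (w - w')"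
      by (simp add: inner_diff_left rot_inner omega_inner)
    then show ?thesis using I_monotone[of w w'] by (simp add: dot_square_norm)
  qed
  also have "\<dots> \<le> norm (cay_den w - cay_den w') * norm (w - w')" by (rule norm_cauchy_schwarz)
  finally show ?thesis using False by (simp add: power2_eq_square)
qed simp

lemma cay_den_continuous: "continuous_on UNIV cay_den" and cay_num_continuous: "continuous_on UNIV cay_num"
  unfolding cay_den_def[abs_def] cay_num_def[abs_def]
  by (intro continuous_intros bounded_linear.continuous_on[OF bounded_linear_rot] I_continuous)+

lemma inj_cay_den: "inj cay_den"
proof (rule injI)
  fix x y assume "cay_den x = cay_den y"
  then show "x = y" using cay_den_expanding[of x y] by simp
qed

text \<open>The range is open by invariance of domain and closed because the map does not decrease
  distances.\<close>

lemma surj_cay_den: "surj cay_den"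
proof -
  have "open (range cay_den)"
    by (rule invariance_of_domain[OF cay_den_continuous open_UNIV inj_cay_den])
  moreover have "closed (range cay_den)"
  proof (rule closed_sequential_limits[THEN iffD2], intro allI impI)
    fix y l assume "(\<forall>n. y n \<in> range cay_den) \<and> y \<longlonglongrightarrow> l"
    then have y: "\<And>n. y n \<in> range cay_den" "y \<longlonglongrightarrow> l" by auto
    define x where "x n = inv cay_den (y n)" for n
    have x: "y n = cay_den (x n)" for n using y(1)[of n] by (simp add: x_def f_inv_into_f)
    have "Cauchy y" using y(2) by (rule LIMSEQ_imp_Cauchy)
    have "Cauchy x"
    proof (rule metric_CauchyI)
      fix e :: real assume "e > 0"
      then obtain N where N: "\<And>i j. i \<ge> N \<Longrightarrow> j \<ge> N \<Longrightarrow> dist (y i) (y j) < e"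
        using metric_CauchyD[OF \<open>Cauchy y\<close>] by blast
      have "dist (x i) (x j) < e" if "i \<ge> N" "j \<ge> N" for i j
        using cay_den_expanding[of "x i" "x j"] N[OF that] unfolding dist_norm x by (rule le_less_trans)
      then show "\<exists>N. \<forall>i\<ge>N. \<forall>j\<ge>N. dist (x i) (x j) < e" by blast
    qed
    then have "convergent x" by (rule Cauchy_convergent)
    then obtain l' where "x \<longlonglongrightarrow> l'" by (auto simp: convergent_def)
    moreover have "isCont cay_den l'"
      using cay_den_continuous continuous_on_eq_continuous_at[OF open_UNIV] by blast
    ultimately have "(\<lambda>n. cay_den (x n)) \<longlonglongrightarrow> cay_den l'" by (rule isCont_tendsto_compose[rotated])
    then have "y \<longlonglongrightarrow> cay_den l'" by (simp only: x[symmetric])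
    then have "l = cay_den l'" using y(2) by (rule LIMSEQ_unique[rotated])
    then show "l \<in> range cay_den" by simp
  qed
  ultimately have "range cay_den = {} \<or> range cay_den = UNIV" using clopen[of "range cay_den"] by blast
  then show ?thesis by blast
qed

definition cay_den_inv where "cay_den_inv = inv cay_den"

lemma cay_den_inv_right [simp]: "cay_den (cay_den_inv p) = p" and cay_den_inv_left [simp]: "cay_den_inv (cay_den w) = w"
  by (simp_all add: cay_den_inv_def surj_f_inv_f surj_cay_den inv_f_f inj_cay_den)

lemma cay_den_scale: "cay_den (s *\<^sub>R w) = s *\<^sub>R cay_den w" and cay_num_scale: "cay_num (s *\<^sub>R w) = s *\<^sub>R cay_num w"
  by (simp_all add: cay_den_def cay_num_def I_scale rot_scaleR scaleR_diff_right scaleR_add_right)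

lemma cay_den_inv_scale: "cay_den_inv (s *\<^sub>R p) = s *\<^sub>R cay_den_inv p"
  using cay_den_inv_left[of "s *\<^sub>R cay_den_inv p"] unfolding cay_den_scale cay_den_inv_right .

lemma cay_den_inv_0: "cay_den_inv 0 = 0" using cay_den_inv_scale[of 0 0] by simp

lemma cay_den_inv_nonzero: "p \<noteq> 0 \<Longrightarrow> cay_den_inv p \<noteq> 0"
  using cay_den_inv_right[of p] by (auto simp: cay_den_def I_def)

lemma cay_den_inv_lipschitz: "norm (cay_den_inv p - cay_den_inv q) \<le> norm (p - q)"
  using cay_den_expanding[of "cay_den_inv p" "cay_den_inv q"] by simp

lemma cay_den_inv_continuous: "continuous_on UNIV cay_den_inv"
proof (rule continuous_on_iff[THEN iffD2], intro ballI allI impI)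
  fix x e assume "(0::real) < e"
  then show "\<exists>d>0. \<forall>x'\<in>UNIV. dist x' x < d \<longrightarrow> dist (cay_den_inv x') (cay_den_inv x) < e"
    using cay_den_inv_lipschitz unfolding dist_norm by (intro exI[of _ e]) (blast intro: le_less_trans)
qed

definition cayley where "cayley p = cay_num (cay_den_inv p)"

lemma cayley_derivative:
  assumes p: "p \<noteq> 0"
  obtains D where "(cayley has_derivative D) (at p)" "\<And>v. D (rot v) = - rot (D v)"
proof -
  define w where "w = cay_den_inv p"
  have w: "w \<noteq> 0" unfolding w_def by (rule cay_den_inv_nonzero[OF p])
  have dr: "((\<lambda>w. rot (I w)) has_derivative (\<lambda>v. rot (M w v))) (at w)"
    by (rule bounded_linear.has_derivative[OF bounded_linear_rot I_derivative[OF w]])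
  define da where "da v = v - rot (M w v)" for v
  define db where "db v = v + rot (M w v)" for v
  have da: "(cay_den has_derivative da) (at w)" and db: "(cay_num has_derivative db) (at w)"
    unfolding cay_den_def[abs_def] cay_num_def[abs_def] da_def[abs_def] db_def[abs_def]
    by (intro has_derivative_diff has_derivative_add has_derivative_ident dr)+
  have lda: "linear da" using da by (rule has_derivative_linear)
  have "inj da"
  proof (rule linear_injective_0[OF lda, THEN iffD2], intro allI impI)
    fix v assume "da v = 0"
    then have "v \<bullet> v = rot (M w v) \<bullet> v" by (simp add: da_def)
    then have "v \<bullet> v = - omega (M w v) v" by (simp add: rot_inner omega_inner)
    then have "v \<bullet> v \<le> 0" using M_positive[OF w, of v] by linarith
    then show "v = 0" using inner_gt_zero_iff[of v] by (metis not_le)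
  qed
  then obtain g where g: "linear g" "g \<circ> da = id"
    using linear_injective_left_inverse[OF lda] by blast
  then have g2: "da \<circ> g = id" using linear_inverse_left[OF lda g(1)] by simp
  have dg: "(cay_den_inv has_derivative g) (at p)"
  proof (rule has_derivative_inverse_basic[where f = cay_den and f' = da and g = cay_den_inv and T = UNIV])
    show "(cay_den has_derivative da) (at (cay_den_inv p))" using da by (simp add: w_def)
    show "bounded_linear g" using g(1) by (simp add: linear_conv_bounded_linear)
    show "continuous (at p) cay_den_inv" using cay_den_inv_continuous continuous_on_eq_continuous_at[OF open_UNIV] by blast
  qed (use g in auto)
  have "(cayley has_derivative (\<lambda>v. db (g v))) (at p)"
    unfolding cayley_def[abs_def]
    using has_derivative_compose[OF dg, of cay_num db] db unfolding w_def by blast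
  moreover have "db (g (rot v)) = - rot (db (g v))" for v
  proof -
    define u where "u = g v"
    have "(da \<circ> g) v = v" by (simp only: g2 id_apply)
    then have v: "v = da u" by (simp add: u_def)
    have "rot v = da (M w u)"
      unfolding v da_def by (simp add: M_M[OF w] rot_diff rot_minus)
    then have "g (rot v) = (g \<circ> da) (M w u)" by simp
    then have "g (rot v) = M w u" by (simp only: g(2) id_apply)
    then show ?thesis
      by (simp add: db_def M_M[OF w] rot_add rot_minus flip: u_def)
  qed
  ultimately show ?thesis by (rule that)
qed

text \<open>The Cayley transform is antiholomorphic away from the origin, homogeneous and of linear
  growth.\<close>

lemma cayley_additive: "cayley (p + q) = cayley p + cayley q"
proof -
  have "\<forall>p. \<exists>D. p \<noteq> 0 \<longrightarrow> (cayley has_derivative D) (at p) \<and> (\<forall>v. D (rot v) = - rot (D v))"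
    using cayley_derivative by metis
  then obtain D where D: "\<And>p. p \<noteq> 0 \<Longrightarrow> (cayley has_derivative D p) (at p)"
    "\<And>p v. p \<noteq> 0 \<Longrightarrow> D p (rot v) = - rot (D p v)" by metis
  show ?thesis
  proof (rule antiholomorphic_additive[where F' = D and I = rot and B = "1 + B * B / a"])
    show "3 \<le> DIM((real^'n) \<times> (real^'n))" using DIM_ge_4 by linarith
    show "norm (cayley x) \<le> (1 + B * B / a) * norm x" for x
    proof -
      have "norm (cayley x) \<le> norm (cay_den_inv x) + norm (I (cay_den_inv x))"
        unfolding cayley_def cay_num_def using norm_triangle_ineq[of "cay_den_inv x" "rot (I (cay_den_inv x))"] by simp
      also have "\<dots> \<le> (1 + B * B / a) * norm (cay_den_inv x)" using I_bound[of "cay_den_inv x"] by (simp add: distrib_right)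
      also have "\<dots> \<le> (1 + B * B / a) * norm x"
        using cay_den_inv_lipschitz[of x 0] a_pos B_nonneg by (intro mult_left_mono) (auto simp: cay_den_inv_0)
      finally show ?thesis .
    qed
    show "continuous_on UNIV cayley"
      unfolding cayley_def[abs_def]
      by (rule continuous_on_compose2[OF cay_num_continuous cay_den_inv_continuous]) simp
    show "cayley (s *\<^sub>R x) = s *\<^sub>R cayley x" for s x by (simp add: cayley_def cay_den_inv_scale cay_num_scale)
  qed (use D linear_rot in auto)
qed

text \<open>A vector \<open>w\<close> is half the sum of \<open>cay_den w\<close> and \<open>cay_num w\<close>, hence an additive function
  \<open>P\<close> of \<open>cay_den w\<close>; so \<open>cay_den\<close> is additive, and \<open>I\<close> with it.\<close>

lemma linear_I: "linear I"
proof -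
  define P where "P p = (1/2) *\<^sub>R (p + cayley p)" for p
  have P_cay_den: "P (cay_den w) = w" for w
    unfolding P_def cayley_def cay_den_inv_left by (simp add: cay_den_def cay_num_def flip: scaleR_2)
  have P_add: "P (p + q) = P p + P q" for p q
    by (simp add: P_def cayley_additive flip: scaleR_add_right)
  have "cay_den (x + y) = cay_den x + cay_den y" for x y
  proof -
    have "P (cay_den x + cay_den y) = x + y" by (simp add: P_add P_cay_den)
    moreover obtain z where z: "cay_den x + cay_den y = cay_den z" using surj_cay_den by (metis surjD)
    ultimately show ?thesis by (simp add: P_cay_den)
  qed
  moreover have "I w = rot (cay_den w - w)" for w by (simp add: cay_den_def rot_minus)
  ultimately have "I (x + y) = I x + I y" for x y
    by (simp add: rot_add rot_diff)
  then show ?thesis by (intro linearI) (simp_all add: I_scale)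
qed

lemma M_eq: assumes w: "w \<noteq> 0" shows "M w = I"
proof -
  have "(I has_derivative I) (at w)"
    using linear_I by (simp add: linear_imp_has_derivative)
  with I_derivative[OF w] show ?thesis by (rule has_derivative_unique)
qed

lemma I_I: "I (I v) = - v"
proof -
  obtain w :: "(real^'n) \<times> (real^'n)" where "w \<noteq> 0" by (rule nonzero_vector)
  from M_M[OF this, of v] show ?thesis by (simp add: M_eq[OF \<open>w \<noteq> 0\<close>])
qed

lemma I_symmetric: "omega (I u) v = omega (I v) u"
proof -
  obtain w :: "(real^'n) \<times> (real^'n)" where w: "w \<noteq> 0" by (rule nonzero_vector)
  have "omega (M w u) v = omega (M w v) u"
    unfolding M_def omega_scaleR_left using DY_symmetric[OF w, of u v] by simp
  then show ?thesis by (simp add: M_eq[OF w])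
qed

lemma Y_eq: "Y w = a *\<^sub>R I w"
  using a_pos by (simp add: I_def)

lemma I_pos: "w \<noteq> 0 \<Longrightarrow> omega (I w) w > 0"
  using G_Y[of w] G_pos[of w] a_pos by (simp add: I_def omega_scaleR_left)

lemma H_formula: "H w = sqrt (a * omega (I w) w)"
proof -
  have "a * omega (I w) w = (H w)^2"
    using G_Y[of w] by (simp add: Y_eq omega_scaleR_left G_def)
  then show ?thesis using H_nonneg by simp
qed

lemma in_Lperp_iff_I: "w \<noteq> 0 \<Longrightarrow> y \<in> Lperp w \<longleftrightarrow> omega y w = 0 \<and> omega y (I w) = 0"
  using a_pos by (simp add: in_Lperp_iff Y_eq omega_scaleR_right)

lemma in_L_iff_I: assumes w: "w \<noteq> 0" shows "x \<in> L w \<longleftrightarrow> (\<exists>\<alpha> \<beta>. x = \<alpha> *\<^sub>R w + \<beta> *\<^sub>R I w)"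
proof
  assume "x \<in> L w"
  then obtain \<alpha> \<beta> where "x = \<alpha> *\<^sub>R w + \<beta> *\<^sub>R Y w" using in_L_iff[OF w] by blast
  then have "x = \<alpha> *\<^sub>R w + (\<beta> * a) *\<^sub>R I w" by (simp add: Y_eq)
  then show "\<exists>\<alpha> \<beta>. x = \<alpha> *\<^sub>R w + \<beta> *\<^sub>R I w" by blast
next
  assume "\<exists>\<alpha> \<beta>. x = \<alpha> *\<^sub>R w + \<beta> *\<^sub>R I w"
  then obtain \<alpha> \<beta> where "x = \<alpha> *\<^sub>R w + \<beta> *\<^sub>R I w" by blast
  then have "x = \<alpha> *\<^sub>R w + (\<beta> / a) *\<^sub>R Y w" by (simp add: I_def)
  then show "x \<in> L w" using comb_in_L[OF w] by simp
qed

lemma I_Lperp: "w \<noteq> 0 \<Longrightarrow> y \<in> Lperp w \<Longrightarrow> I y \<in> Lperp w"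
  using I_symmetric[of y w] I_symmetric[of y "I w"] omega_commute[of "I w" y]
    omega_commute[of w y]
  by (simp add: in_Lperp_iff_I I_I omega_linear)

lemma omega_I_I: "omega (I u) (I v) = omega u v"
  using I_symmetric[of u "I v"] omega_commute[of v u] by (simp add: I_I omega_linear)

section \<open>The centre of symmetry\<close>

text \<open>The odd part of the support function, with \<open>c\<close> as its gradient with respect to \<open>omega\<close>.\<close>

definition h_odd where "h_odd w = omega (c w) w"
definition Dc where "Dc w = frechet_derivative c (at w)"

lemma c_derivative: "w \<noteq> 0 \<Longrightarrow> (c has_derivative Dc w) (at w)"
  unfolding Dc_def using c_differentiable frechet_derivative_works by blast

lemma linear_Dc: "w \<noteq> 0 \<Longrightarrow> linear (Dc w)"
  using c_derivative has_derivative_linear by blast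

lemma h_odd_eq: "h_odd w = (h w - h (- w)) / 2"
  by (simp add: h_odd_def c_def h_def omega_linear)

lemma h_odd_minus: "h_odd (- w) = - h_odd w"
  by (simp add: h_odd_def c_minus omega_linear)

lemma h_odd_derivative:
  assumes w: "w \<noteq> 0" shows "(h_odd has_derivative omega (c w)) (at w)"
proof -
  have "((\<lambda>w. h (- w)) has_derivative (\<lambda>v. omega (X (- w)) (- v))) (at w)"
    by (rule has_derivative_compose[OF has_derivative_minus[OF has_derivative_ident]])
      (use h_derivative w in simp)
  from has_derivative_diff[OF h_derivative[OF w] this]
  have "((\<lambda>w. (h w - h (- w)) / 2) has_derivative
      (\<lambda>v. (omega (X w) v - omega (X (- w)) (- v)) / 2)) (at w)"
    by (rule bounded_linear.has_derivative[OF bounded_linear_divide])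
  moreover have "(\<lambda>v. (omega (X w) v - omega (X (- w)) (- v)) / 2) = omega (c w)"
    by (auto simp: c_def omega_linear)
  ultimately show ?thesis by (simp add: h_odd_eq[abs_def])
qed

lemma Dc_symmetric:
  assumes w: "w \<noteq> 0" shows "omega (Dc w u) v = omega (Dc w v) u"
proof (rule second_derivative_symmetric[of "- {0}" w h_odd "\<lambda>x. omega (c x)"])
  show "((\<lambda>x. omega (c x) v) has_derivative (\<lambda>u. omega (Dc w u) v)) (at w)" for v
    by (rule bounded_linear.has_derivative[OF bounded_linear_omega_left c_derivative[OF w]])
qed (use w h_odd_derivative in auto)

lemma c_in_L:
  assumes w: "w \<noteq> 0" and w': "w' \<in> L w" "w' \<noteq> 0" shows "c w' - c w \<in> L w"
proof -
  have "- w' \<in> L w" using w' L_subspace[OF w] by (simp add: subspace_neg)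
  moreover have "L (- w) = L w" using L_same[OF w minus_in_L[OF w]] w by simp
  ultimately have "X (- w') - X (- w) \<in> L w" using L_X[of "- w" "- w'"] w w' by simp
  then have "(1/2) *\<^sub>R ((X w' - X w) + (X (- w') - X (- w))) \<in> L w"
    using L_X[OF w w'] L_subspace[OF w] by (intro subspace_mul subspace_add)
  then show ?thesis by (simp add: c_def algebra_simps)
qed

lemma combI_nonzero:
  assumes w: "w \<noteq> 0" and ab: "\<alpha> \<noteq> 0 \<or> \<beta> \<noteq> 0" shows "\<alpha> *\<^sub>R w + \<beta> *\<^sub>R I w \<noteq> 0"
  using comb_nonzero[OF w, of \<alpha> "\<beta> / a"] ab a_pos by (auto simp: I_def)

lemma combI_in_L: "w \<noteq> 0 \<Longrightarrow> \<alpha> *\<^sub>R w + \<beta> *\<^sub>R I w \<in> L w"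
  using in_L_iff_I by blast

text \<open>The coordinates of the displacement of \<open>c\<close> from \<open>v\<close> to \<open>\<alpha> v + \<beta> I v\<close>, with respect to the
  basis \<open>v\<close>, \<open>I v\<close> of the leaf.\<close>

definition ccoef_w where "ccoef_w \<alpha> \<beta> v = omega (c (\<alpha> *\<^sub>R v + \<beta> *\<^sub>R I v) - c v) (I v) / omega v (I v)"
definition ccoef_I where "ccoef_I \<alpha> \<beta> v = omega (c (\<alpha> *\<^sub>R v + \<beta> *\<^sub>R I v) - c v) v / omega (I v) v"

lemma omega_w_I: "omega w (I w) = - omega (I w) w"
  by (rule omega_commute)

lemma c_comb:
  assumes w: "w \<noteq> 0" and ab: "\<alpha> \<noteq> 0 \<or> \<beta> \<noteq> 0"
  shows "c (\<alpha> *\<^sub>R w + \<beta> *\<^sub>R I w) - c w = ccoef_w \<alpha> \<beta> w *\<^sub>R w + ccoef_I \<alpha> \<beta> w *\<^sub>R I w"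
proof -
  obtain p r where pr: "c (\<alpha> *\<^sub>R w + \<beta> *\<^sub>R I w) - c w = p *\<^sub>R w + r *\<^sub>R I w"
    using c_in_L[OF w combI_in_L[OF w] combI_nonzero[OF w ab]] in_L_iff_I[OF w] by blast
  have "omega w (I w) \<noteq> 0" "omega (I w) w \<noteq> 0" using I_pos[OF w] omega_w_I[of w] by auto
  then have "ccoef_w \<alpha> \<beta> w = p" "ccoef_I \<alpha> \<beta> w = r"
    unfolding ccoef_w_def ccoef_I_def pr by (simp_all add: omega_linear)
  then show ?thesis using pr by simp
qed

text \<open>The displacement of \<open>c\<close> within a leaf, differentiated in a direction across the leaf and
  paired with another such direction; the derivatives of the coordinates multiply vectors of
  the leaf and drop out.\<close>

lemma c_variation:
  assumes w: "w \<noteq> 0" and ab: "\<alpha> \<noteq> 0 \<or> \<beta> \<noteq> 0" and y: "y \<in> Lperp w" and z: "z \<in> Lperp w"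
  shows "omega (Dc (\<alpha> *\<^sub>R w + \<beta> *\<^sub>R I w) (\<alpha> *\<^sub>R y + \<beta> *\<^sub>R I y)) z =
      omega (Dc w y) z + ccoef_w \<alpha> \<beta> w * omega y z + ccoef_I \<alpha> \<beta> w * omega (I y) z"
proof -
  let ?w = "\<alpha> *\<^sub>R w + \<beta> *\<^sub>R I w"
  have dI: "(I has_derivative I) (at w)" using linear_I by (simp add: linear_imp_has_derivative)
  have "((\<lambda>v. \<alpha> *\<^sub>R v + \<beta> *\<^sub>R I v) has_derivative (\<lambda>y. \<alpha> *\<^sub>R y + \<beta> *\<^sub>R I y)) (at w)"
    by (intro has_derivative_add has_derivative_scaleR_right has_derivative_ident dI)
  from has_derivative_compose[OF this c_derivative[OF combI_nonzero[OF w ab]]]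
  have "((\<lambda>v. c (\<alpha> *\<^sub>R v + \<beta> *\<^sub>R I v)) has_derivative (\<lambda>y. Dc ?w (\<alpha> *\<^sub>R y + \<beta> *\<^sub>R I y))) (at w)" .
  from has_derivative_diff[OF this c_derivative[OF w]]
  have d: "((\<lambda>v. c (\<alpha> *\<^sub>R v + \<beta> *\<^sub>R I v) - c v) has_derivative
      (\<lambda>y. Dc ?w (\<alpha> *\<^sub>R y + \<beta> *\<^sub>R I y) - Dc w y)) (at w)" .
  have nz: "omega w (I w) \<noteq> 0" "omega (I w) w \<noteq> 0" using I_pos[OF w] omega_w_I[of w] by auto
  have wI: "(\<lambda>v. omega v (I v)) differentiable (at w)" "(\<lambda>v. omega (I v) v) differentiable (at w)"
    by (rule differentiableI, rule has_derivative_omega[OF has_derivative_ident dI])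
      (rule differentiableI, rule has_derivative_omega[OF dI has_derivative_ident])
  have "(\<lambda>v. omega (c (\<alpha> *\<^sub>R v + \<beta> *\<^sub>R I v) - c v) (I v)) differentiable (at w)"
    "(\<lambda>v. omega (c (\<alpha> *\<^sub>R v + \<beta> *\<^sub>R I v) - c v) v) differentiable (at w)"
    by (rule differentiableI, rule has_derivative_omega[OF d dI])
      (rule differentiableI, rule has_derivative_omega[OF d has_derivative_ident])
  note num = this
  have "ccoef_w \<alpha> \<beta> differentiable (at w)"
    unfolding ccoef_w_def[abs_def] by (rule differentiable_divide[OF num(1) wI(1) nz(1)])
  moreover have "ccoef_I \<alpha> \<beta> differentiable (at w)"
    unfolding ccoef_I_def[abs_def] by (rule differentiable_divide[OF num(2) wI(2) nz(2)])
  ultimately obtain p' r' where p': "(ccoef_w \<alpha> \<beta> has_derivative p') (at w)" and r': "(ccoef_I \<alpha> \<beta> has_derivative r') (at w)"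
    unfolding differentiable_def by blast
  have "((\<lambda>v. ccoef_w \<alpha> \<beta> v *\<^sub>R v + ccoef_I \<alpha> \<beta> v *\<^sub>R I v) has_derivative
      (\<lambda>y. (ccoef_w \<alpha> \<beta> w *\<^sub>R y + p' y *\<^sub>R w) + (ccoef_I \<alpha> \<beta> w *\<^sub>R I y + r' y *\<^sub>R I w))) (at w)"
    by (intro has_derivative_add has_derivative_scaleR p' r' has_derivative_ident dI)
  then have "((\<lambda>v. c (\<alpha> *\<^sub>R v + \<beta> *\<^sub>R I v) - c v) has_derivative
      (\<lambda>y. (ccoef_w \<alpha> \<beta> w *\<^sub>R y + p' y *\<^sub>R w) + (ccoef_I \<alpha> \<beta> w *\<^sub>R I y + r' y *\<^sub>R I w))) (at w)"
    by (rule has_derivative_transform_within_open[of _ _ w UNIV "- {0}"])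
      (use w c_comb[OF _ ab] in auto)
  from has_derivative_unique[OF d this]
  have eq: "Dc ?w (\<alpha> *\<^sub>R y + \<beta> *\<^sub>R I y) - Dc w y =
      (ccoef_w \<alpha> \<beta> w *\<^sub>R y + p' y *\<^sub>R w) + (ccoef_I \<alpha> \<beta> w *\<^sub>R I y + r' y *\<^sub>R I w)" by metis
  have "omega z w = 0" "omega z (I w) = 0" using z in_Lperp_iff_I[OF w] by blast+
  then have "omega w z = 0" "omega (I w) z = 0"
    using omega_commute[of w z] omega_commute[of "I w" z] by simp_all
  then have "omega (Dc ?w (\<alpha> *\<^sub>R y + \<beta> *\<^sub>R I y) - Dc w y) z = ccoef_w \<alpha> \<beta> w * omega y z + ccoef_I \<alpha> \<beta> w * omega (I y) z"
    unfolding eq by (simp add: omega_linear)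
  then show ?thesis by (simp add: omega_diff_left)
qed

text \<open>Inserting \<open>\<alpha> y' + \<beta> I y'\<close> for the second direction in \<open>c_variation\<close> and antisymmetrizing
  leaves a linear relation, since the second derivative of \<open>h_odd\<close> is symmetric.\<close>

lemma c_coefficients:
  assumes w: "w \<noteq> 0"
  obtains \<kappa> where "\<And>\<alpha> \<beta>. \<alpha> \<noteq> 0 \<or> \<beta> \<noteq> 0 \<Longrightarrow> \<alpha> * ccoef_w \<alpha> \<beta> w + \<beta> * ccoef_I \<alpha> \<beta> w = \<beta> * \<kappa>"
proof -
  obtain y y' where y: "y \<in> Lperp w" and y': "y' \<in> Lperp w" and s: "omega y y' \<noteq> 0" by (rule Lperp_pair[OF w])
  define \<kappa> where "\<kappa> = - (omega (Dc w y) (I y') - omega (Dc w y') (I y)) / (2 * omega y y')"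
  have "\<alpha> * ccoef_w \<alpha> \<beta> w + \<beta> * ccoef_I \<alpha> \<beta> w = \<beta> * \<kappa>" if ab: "\<alpha> \<noteq> 0 \<or> \<beta> \<noteq> 0" for \<alpha> \<beta>
  proof -
    define w' where "w' = \<alpha> *\<^sub>R w + \<beta> *\<^sub>R I w"
    define E where "E y = \<alpha> *\<^sub>R y + \<beta> *\<^sub>R I y" for y
    have E: "E u \<in> Lperp w" if "u \<in> Lperp w" for u
      unfolding E_def by (rule Lperp_comb[OF that I_Lperp[OF w that]])
    have v: "omega (Dc w' (E u)) z = omega (Dc w u) z + ccoef_w \<alpha> \<beta> w * omega u z + ccoef_I \<alpha> \<beta> w * omega (I u) z"
      if "u \<in> Lperp w" "z \<in> Lperp w" for u z
      unfolding w'_def E_def by (rule c_variation[OF w ab that])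
    have "omega (Dc w' (E y)) (E y') = omega (Dc w' (E y')) (E y)"
      unfolding w'_def by (rule Dc_symmetric[OF combI_nonzero[OF w ab]])
    then have eq: "omega (Dc w y) (E y') + ccoef_w \<alpha> \<beta> w * omega y (E y') + ccoef_I \<alpha> \<beta> w * omega (I y) (E y') =
       omega (Dc w y') (E y) + ccoef_w \<alpha> \<beta> w * omega y' (E y) + ccoef_I \<alpha> \<beta> w * omega (I y') (E y)"
      unfolding v[OF y E[OF y']] v[OF y' E[OF y]] .
    have sw: "omega y' y = - omega y y'" by (rule omega_commute)
    have sym: "omega y' (I y) = omega y (I y')"
      using I_symmetric[of y y'] omega_commute[of "I y" y'] omega_commute[of "I y'" y] by simp
    have sym2: "omega (I y') y = omega (I y) y'" "omega (I y) (I y') = omega y y'" "omega (I y') (I y) = - omega y y'"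
      using omega_I_I[of y' y] sw by (simp_all add: I_symmetric[of y' y] omega_I_I)
    have D: "omega (Dc w y') y = omega (Dc w y) y'" by (rule Dc_symmetric[OF w])
    have "2 * omega y y' * (\<alpha> * ccoef_w \<alpha> \<beta> w + \<beta> * ccoef_I \<alpha> \<beta> w) +
        \<beta> * (omega (Dc w y) (I y') - omega (Dc w y') (I y)) = 0"
      using eq unfolding E_def omega_add_right omega_scaleR_right sym sym2 sw D
      by (simp add: algebra_simps)
    then have "2 * omega y y' * (\<alpha> * ccoef_w \<alpha> \<beta> w + \<beta> * ccoef_I \<alpha> \<beta> w) =
        \<beta> * (- (omega (Dc w y) (I y') - omega (Dc w y') (I y)))"
      by (simp only: eq_neg_iff_add_eq_0[symmetric] mult_minus_right)
    also have "- (omega (Dc w y) (I y') - omega (Dc w y') (I y)) = \<kappa> * (2 * omega y y')"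
      using s by (simp add: \<kappa>_def)
    finally have "(2 * omega y y') * (\<alpha> * ccoef_w \<alpha> \<beta> w + \<beta> * ccoef_I \<alpha> \<beta> w) = (2 * omega y y') * (\<beta> * \<kappa>)"
      by (simp only: mult.commute mult.left_commute mult.assoc)
    then show ?thesis using s by simp
  qed
  then show ?thesis by (rule that)
qed

text \<open>By \<open>c_coefficients\<close> the function \<open>k\<close> is constant on the ellipse through \<open>w\<close> and \<open>I w\<close> in
  the leaf, and it changes sign under \<open>\<theta> \<mapsto> \<theta> + \<pi>\<close>; so it vanishes. This gives \<open>\<kappa> = 0\<close> first
  and then \<open>c (I w) = c w\<close>.\<close>

lemma c_I: assumes w: "w \<noteq> 0" shows "c (I w) = c w"
proof -
  obtain \<kappa> where \<kappa>: "\<And>\<alpha> \<beta>. \<alpha> \<noteq> 0 \<or> \<beta> \<noteq> 0 \<Longrightarrow> \<alpha> * ccoef_w \<alpha> \<beta> w + \<beta> * ccoef_I \<alpha> \<beta> w = \<beta> * \<kappa>"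
    by (rule c_coefficients[OF w]) blast
  define q where "q = omega w (I w)"
  have q: "q \<noteq> 0" using I_pos[OF w] omega_w_I[of w] by (simp add: q_def)
  define W where "W \<theta> = cos \<theta> *\<^sub>R w + sin \<theta> *\<^sub>R I w" for \<theta>
  define W' where "W' \<theta> = (- sin \<theta>) *\<^sub>R w + cos \<theta> *\<^sub>R I w" for \<theta>
  have cs: "cos \<theta> \<noteq> 0 \<or> sin \<theta> \<noteq> 0" for \<theta> :: real
    using sin_cos_squared_add[of \<theta>] by (metis add.right_neutral power_zero_numeral zero_neq_one)
  have W0: "W \<theta> \<noteq> 0" for \<theta> unfolding W_def by (rule combI_nonzero[OF w cs])
  have dW: "(W has_vector_derivative W' \<theta>) (at \<theta>)" for \<theta>
    unfolding W_def[abs_def] W'_def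
    by (auto intro!: derivative_eq_intros)
  define k where "k \<theta> = h_odd (W \<theta>) - omega (c w) (W \<theta>) + cos \<theta> * (\<kappa> * q)" for \<theta>
  have "(k has_real_derivative 0) (at \<theta>)" for \<theta>
  proof -
    have "(W has_derivative (\<lambda>t. t *\<^sub>R W' \<theta>)) (at \<theta>)"
      using dW[of \<theta>] by (simp add: has_vector_derivative_def)
    from has_derivative_compose[OF this h_odd_derivative[OF W0]]
    have "((\<lambda>\<theta>. h_odd (W \<theta>)) has_derivative (*) (omega (c (W \<theta>)) (W' \<theta>))) (at \<theta>)"
      by (simp add: omega_scaleR_right mult_commute_abs)
    then have d1: "((\<lambda>\<theta>. h_odd (W \<theta>)) has_real_derivative omega (c (W \<theta>)) (W' \<theta>)) (at \<theta>)"
      by (simp add: has_field_derivative_def)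
    have "((\<lambda>\<theta>. omega (c w) (W \<theta>)) has_vector_derivative omega (c w) (W' \<theta>)) (at \<theta>)"
      by (rule bounded_linear.has_vector_derivative[OF bounded_linear_omega_right dW])
    then have d2: "((\<lambda>\<theta>. omega (c w) (W \<theta>)) has_real_derivative omega (c w) (W' \<theta>)) (at \<theta>)"
      by (simp add: has_real_derivative_iff_has_vector_derivative)
    have "omega (c (W \<theta>)) (W' \<theta>) - omega (c w) (W' \<theta>) = omega (c (W \<theta>) - c w) (W' \<theta>)"
      by (simp add: omega_diff_left)
    also have "\<dots> = (cos \<theta> * ccoef_w (cos \<theta>) (sin \<theta>) w + sin \<theta> * ccoef_I (cos \<theta>) (sin \<theta>) w) * q"
      unfolding W_def c_comb[OF w cs] unfolding W'_def q_def
      using omega_commute[of "I w" w] by (simp add: omega_linear algebra_simps)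
    also have "\<dots> = sin \<theta> * \<kappa> * q" using \<kappa>[OF cs, of \<theta>] by simp
    finally have e: "omega (c (W \<theta>)) (W' \<theta>) - omega (c w) (W' \<theta>) + (- sin \<theta>) * (\<kappa> * q) = 0" by simp
    have "(k has_real_derivative omega (c (W \<theta>)) (W' \<theta>) - omega (c w) (W' \<theta>) + (- sin \<theta>) * (\<kappa> * q)) (at \<theta>)"
      unfolding k_def[abs_def] by (intro DERIV_add DERIV_diff d1 d2 DERIV_cmult_right DERIV_cos)
    then show ?thesis unfolding e .
  qed
  then have const: "k \<theta> = k 0" for \<theta> using DERIV_isconst_all by blast
  have "k pi = - k 0"
    by (simp add: k_def W_def h_odd_minus omega_linear)
  then have k0: "k 0 = 0" using const[of pi] by simp
  then have "\<kappa> * q = 0" by (simp add: k_def W_def h_odd_def)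
  then have \<kappa>0: "\<kappa> = 0" using q by simp
  have "ccoef_I 0 1 w = 0" using \<kappa>[of 0 1] \<kappa>0 by simp
  then have cI: "c (I w) - c w = ccoef_w 0 1 w *\<^sub>R w" using c_comb[OF w, of 0 1] by simp
  have "k (pi / 2) = 0" using const[of "pi / 2"] k0 by simp
  then have "omega (c (I w) - c w) (I w) = 0" by (simp add: k_def W_def h_odd_def omega_diff_left)
  then have "ccoef_w 0 1 w = 0" using q unfolding cI by (simp add: omega_scaleR_left q_def)
  then show ?thesis using cI by simp
qed

text \<open>Differentiating \<open>c (I x) = c x\<close> gives \<open>Dc (I x) (I u) = Dc x u\<close>. Together with the
  symmetry of the second derivatives of \<open>h_odd\<close> at \<open>x\<close> and at \<open>I x\<close> this shows that \<open>Dc\<close>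
  anticommutes with \<open>I\<close>. So \<open>c\<close> is a bounded antiholomorphic map.\<close>

lemma c_constant: assumes w: "w \<noteq> 0" "w' \<noteq> 0" shows "c w = c w'"
proof (rule antiholomorphic_bounded_constant[where F = c and F' = Dc and I = I and B = B])
  show "3 \<le> DIM((real^'n) \<times> (real^'n))" using DIM_ge_4 by linarith
  show "norm (c x) \<le> B" for x
  proof -
    have "norm (X x + X (- x)) \<le> B + B"
      using norm_triangle_ineq[of "X x" "X (- x)"] X_bdd[of x] X_bdd[of "- x"] by linarith
    then show ?thesis by (simp add: c_def)
  qed
  show "Dc x (I v) = - I (Dc x v)" if x: "x \<noteq> 0" for x v
  proof -
    have Ix: "I x \<noteq> 0" using combI_nonzero[OF x, of 0 1] by simp
    have DI: "Dc (I x) (I u) = Dc x u" for u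
    proof -
      have "(I has_derivative I) (at x)" using linear_I by (simp add: linear_imp_has_derivative)
      from has_derivative_compose[OF this c_derivative[OF Ix]]
      have "(c has_derivative (\<lambda>u. Dc (I x) (I u))) (at x)"
        by (rule has_derivative_transform_within_open[of _ _ x UNIV "- {0}"]) (use x c_I in auto)
      from has_derivative_unique[OF this c_derivative[OF x]] show ?thesis by metis
    qed
    have DII: "Dc x (I u) = - Dc (I x) u" for u
      using DI[of "I u"] by (simp add: I_I linear_neg[OF linear_Dc[OF Ix]])
    have "Dc x (I v) + I (Dc x v) = 0"
    proof (rule omega_nondegenerate)
      fix u
      have "omega (Dc x (I v)) u = omega (Dc x (I u)) v"
        using Dc_symmetric[OF Ix, of v u] by (simp add: DII omega_minus_left)
      also have "\<dots> = omega (Dc x v) (I u)" by (rule Dc_symmetric[OF x])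
      also have "\<dots> = - omega (I (Dc x v)) u"
        using omega_commute[of "Dc x v" "I u"] by (simp add: I_symmetric[of u])
      finally show "omega (Dc x (I v) + I (Dc x v)) u = 0" by (simp add: omega_add_left)
    qed
    then show ?thesis by (simp add: add_eq_0_iff2)
  qed
qed (use w linear_I I_I c_derivative in auto)

text \<open>The chord from \<open>X (- w)\<close> to \<open>X w\<close> has the fixed midpoint \<open>c0\<close>, and its half length in the
  direction \<open>w\<close> is the square root of a quadratic form.\<close>

theorem support_formula:
  obtains c0 a I where "a > 0" "linear I" "\<And>v. I (I v) = - v"
    "\<And>u v. omega (I u) v = omega (I v) u" "\<And>w. w \<noteq> 0 \<Longrightarrow> omega (I w) w > 0"
    "\<And>w. omega (X w) w = omega c0 w + sqrt (a * omega (I w) w)"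
proof -
  obtain v :: "(real^'n) \<times> (real^'n)" where v: "v \<noteq> 0" by (rule nonzero_vector)
  have "omega (X w) w = omega (c v) w + sqrt (a * omega (I w) w)" for w
  proof (cases "w = 0")
    case False
    have "X w = c w + U w" by (simp add: c_def U_def flip: scaleR_add_right scaleR_2)
    then have "omega (X w) w = omega (c w) w + H w" by (simp add: H_def omega_add_left)
    then show ?thesis unfolding H_formula c_constant[OF False v] .
  qed (simp add: omega_linear)
  then show ?thesis using a_pos linear_I I_I I_symmetric I_pos by (intro that[of a I "c v"]) auto
qed

end

section \<open>Unitary bases\<close>

text \<open>Gram-Schmidt orthonormalization for the Hermitian form with real part \<open>omega (I u) v\<close> and
  imaginary part \<open>omega u v\<close>. A further vector orthogonal to \<open>k < n\<close> given ones exists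
  because these impose \<open>2 k < 2 n\<close> real conditions.\<close>

lemma unitary_family:
  fixes I :: "(real^'n::finite) \<times> (real^'n) \<Rightarrow> (real^'n) \<times> (real^'n)" and F :: "'n set"
  assumes I: "linear I" "\<And>v. I (I v) = - v" "\<And>u v. omega (I u) v = omega (I v) u"
    "\<And>w. w \<noteq> 0 \<Longrightarrow> omega (I w) w > 0"
  shows "\<exists>e. \<forall>i\<in>F. \<forall>j\<in>F. omega (I (e i)) (e j) = (if i = j then 1 else 0) \<and> omega (e i) (e j) = 0"
proof (induction F rule: finite_induct[OF finite])
  case 1
  show ?case by simp
next
  case (2 k F)
  then obtain e where e: "\<And>i j. i \<in> F \<Longrightarrow> j \<in> F \<Longrightarrow> omega (I (e i)) (e j) = (if i = j then 1 else 0)"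
    "\<And>i j. i \<in> F \<Longrightarrow> j \<in> F \<Longrightarrow> omega (e i) (e j) = 0" by blast
  define T where "T = (\<lambda>i. rot (I (e i))) ` F \<union> (\<lambda>i. rot (e i)) ` F"
  have finF: "finite F" by simp
  have "card T \<le> card F + card F"
    unfolding T_def by (intro order_trans[OF card_Un_le] add_mono card_image_le finF)
  moreover have "card (insert k F) \<le> CARD('n)" by (intro card_mono) auto
  then have "card F < CARD('n)" using 2(2) by simp
  moreover have "dim T \<le> card T" by (rule dim_le_card') (simp add: T_def)
  ultimately have "dim T < DIM((real^'n) \<times> (real^'n))" by simp
  then obtain v where v: "v \<noteq> 0" "\<And>y. y \<in> span T \<Longrightarrow> orthogonal v y"
    by (rule orthogonal_to_subspace_exists) blast
  have vT: "rot x \<bullet> v = 0" if "rot x \<in> T" for x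
    using v(2)[OF span_base[OF that]] by (simp add: orthogonal_def inner_commute)
  have ov: "omega (I (e i)) v = 0" "omega (e i) v = 0" if "i \<in> F" for i
    using vT[of "I (e i)"] vT[of "e i"] that by (auto simp: T_def omega_inner rot_inner)
  define q where "q = omega (I v) v"
  have q: "q > 0" unfolding q_def by (rule I(4)[OF v(1)])
  define u where "u = (1 / sqrt q) *\<^sub>R v"
  have Iu: "I u = (1 / sqrt q) *\<^sub>R I v" by (simp add: u_def linear_cmul[OF I(1)])
  have uu: "omega (I u) u = 1"
    unfolding Iu unfolding u_def omega_scaleR_left omega_scaleR_right q_def[symmetric]
    using q by (simp add: field_simps)
  have ou: "omega (I (e i)) u = 0" "omega (e i) u = 0" "omega (I u) (e i) = 0" "omega u (e i) = 0" if "i \<in> F" for i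
  proof -
    show 1: "omega (I (e i)) u = 0" "omega (e i) u = 0"
      using ov[OF that] by (simp_all add: u_def omega_scaleR_right)
    show "omega (I u) (e i) = 0" using 1(1) I(3)[of u "e i"] by simp
    show "omega u (e i) = 0" using 1(2) omega_commute[of u "e i"] by simp
  qed
  show ?case
    using e uu ou 2(2) by (intro exI[of _ "e(k := u)"]) auto
qed

lemma omega_sum_left: "omega (\<Sum>i\<in>S. f i) y = (\<Sum>i\<in>S. omega (f i) y)"
  by (rule linear_sum[OF bounded_linear.linear[OF bounded_linear_omega_left]])

lemma omega_sum_right: "omega x (\<Sum>i\<in>S. f i) = (\<Sum>i\<in>S. omega x (f i))"
  by (rule linear_sum[OF bounded_linear.linear[OF bounded_linear_omega_right]])

text \<open>The vectors \<open>e i\<close> and \<open>- I (e i)\<close> of a unitary basis form a symplectic basis that is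
  orthonormal for \<open>omega (I u) v\<close>.\<close>

lemma symplectic_diagonalization:
  fixes I :: "(real^'n::finite) \<times> (real^'n) \<Rightarrow> (real^'n) \<times> (real^'n)"
  assumes I: "linear I" "\<And>v. I (I v) = - v" "\<And>u v. omega (I u) v = omega (I v) u"
    "\<And>w. w \<noteq> 0 \<Longrightarrow> omega (I w) w > 0"
  obtains T S :: "(real^'n) \<times> (real^'n) \<Rightarrow> (real^'n) \<times> (real^'n)"
  where "linear T" "linear S" "\<And>x. S (T x) = x" "\<And>x. T (S x) = x"
    "\<And>x y. omega (T x) (T y) = omega x y" "\<And>x. omega (I (T x)) (T x) = x \<bullet> x"
proof -
  obtain e :: "'n \<Rightarrow> (real^'n) \<times> (real^'n)"
    where e: "\<And>i j. omega (I (e i)) (e j) = (if i = j then 1 else 0)" "\<And>i j. omega (e i) (e j) = 0"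
    using unitary_family[OF I, of UNIV] by auto
  define T where "T x = (\<Sum>i\<in>UNIV. fst x $ i *\<^sub>R e i - snd x $ i *\<^sub>R I (e i))" for x :: "(real^'n) \<times> (real^'n)"
  have linT: "linear T"
    by (rule linearI) (simp_all add: T_def sum.distrib[symmetric] scaleR_sum_right algebra_simps)
  have omI: "omega (I u) (I v) = omega u v" for u v
    using I(3)[of u "I v"] omega_commute[of v u] by (simp add: I(2) omega_linear)
  have om_e: "omega (e i) (I (e j)) = - (if i = j then 1 else 0)" for i j
    using omega_commute[of "e i" "I (e j)"] e(1)[of j i] by auto
  have eT: "omega (e i) (T y) = snd y $ i" for i y
    by (simp add: T_def omega_sum_right omega_linear e(2) om_e if_distrib[of "\<lambda>x. _ * x"] cong: if_cong)
  have IeT: "omega (I (e i)) (T y) = fst y $ i" for i y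
    by (simp add: T_def omega_sum_right omega_linear e omI if_distrib[of "\<lambda>x. _ * x"] cong: if_cong)
  have om: "omega (T x) (T y) = omega x y" for x y
  proof -
    have "omega (T x) (T y) = (\<Sum>i\<in>UNIV. fst x $ i * snd y $ i - snd x $ i * fst y $ i)"
      unfolding T_def[of x] omega_sum_left by (simp add: omega_linear eT IeT)
    then show ?thesis by (simp add: omega_def)
  qed
  have q: "omega (I (T x)) (T x) = x \<bullet> x" for x
  proof -
    have "omega (I (T x)) (T x) = omega (I (T x)) (\<Sum>i\<in>UNIV. fst x $ i *\<^sub>R e i - snd x $ i *\<^sub>R I (e i))"
      by (simp only: T_def[of x, symmetric])
    also have "\<dots> = (\<Sum>i\<in>UNIV. fst x $ i * omega (I (T x)) (e i) - snd x $ i * omega (I (T x)) (I (e i)))"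
      by (simp only: omega_sum_right omega_diff_right omega_scaleR_right)
    also have "\<dots> = (\<Sum>i\<in>UNIV. fst x $ i * fst x $ i + snd x $ i * snd x $ i)"
    proof (rule sum.cong[OF refl])
      fix i
      have "omega (I (T x)) (e i) = fst x $ i" using I(3)[of "T x" "e i"] IeT[of i x] by simp
      moreover have "omega (I (T x)) (I (e i)) = - snd x $ i"
        using omI[of "T x" "e i"] omega_commute[of "T x" "e i"] eT[of i x] by simp
      ultimately show "fst x $ i * omega (I (T x)) (e i) - snd x $ i * omega (I (T x)) (I (e i)) =
          fst x $ i * fst x $ i + snd x $ i * snd x $ i" by simp
    qed
    also have "\<dots> = x \<bullet> x" by (simp add: inner_prod_def inner_vec_def sum.distrib)
    finally show ?thesis .
  qed
  have "inj T"
  proof (rule linear_injective_0[OF linT, THEN iffD2], intro allI impI)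
    fix x assume "T x = 0"
    then show "x = 0" using q[of x] by (simp add: omega_linear)
  qed
  then obtain S where S: "linear S" "\<And>x. S (T x) = x" "\<And>x. T (S x) = x"
    using linear_injective_isomorphism[OF linT] by blast
  show ?thesis by (rule that[OF linT S om q])
qed

section \<open>Bodies with planar characteristics are balls\<close>

context planar_characteristics
begin

text \<open>A closed convex set is the intersection of its supporting half-spaces.\<close>

lemma support_description: "K = {x. \<forall>w. omega x w \<le> omega (Xs w) w}"
proof (intro equalityI subsetI)
  fix x assume "x \<in> K"
  then show "x \<in> {x. \<forall>w. omega x w \<le> omega (Xs w) w}"
    using Xp(2) by (simp add: Xs_def omega_inner)
next
  fix x assume x: "x \<in> {x. \<forall>w. omega x w \<le> omega (Xs w) w}"
  show "x \<in> K"
  proof (rule ccontr)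
    assume "x \<notin> K"
    then obtain a b where ab: "a \<bullet> x < b" "\<forall>y\<in>K. a \<bullet> y > b"
      using separating_hyperplane_closed_point[OF convex_K closed_K] by blast
    have "omega x (rot a) = - (a \<bullet> x)" for x by (simp add: omega_inner inner_commute)
    moreover have "a \<bullet> Xs (rot a) > b" using ab(2) Xp(1) by (simp add: Xs_def)
    ultimately have "omega x (rot a) > omega (Xs (rot a)) (rot a)" using ab(1) by simp
    moreover have "omega x (rot a) \<le> omega (Xs (rot a)) (rot a)" using x by blast
    ultimately show False by linarith
  qed
qed

lemma width_pos: assumes w: "w \<noteq> 0" shows "omega (Xs w - Xs (- w)) w > 0"
proof -
  obtain c where c: "c \<in> interior K" using interior_K by blast
  then have "c \<in> K" using interior_subset by blast
  then have "c \<bullet> rot (- w) \<le> Xs (- w) \<bullet> rot (- w)" using Xp(2) by (simp add: Xs_def)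
  moreover have "(c - Xs w) \<bullet> N (Xs w) < 0"
    by (rule support_strict[OF N_supports[OF Xs_frontier[OF w]] c])
  then have "inverse (norm w) * ((c - Xs w) \<bullet> rot w) < 0"
    unfolding N_Xs[OF w] rot_scaleR inner_scaleR_right .
  then have "(c - Xs w) \<bullet> rot w < 0" using w by (simp add: mult_less_0_iff)
  ultimately show ?thesis by (simp add: omega_inner rot_minus inner_diff_left)
qed

text \<open>In a symplectic basis adapted to \<open>I\<close> the support function of \<open>support_formula\<close> is that of
  a ball of radius \<open>sqrt a\<close>, translated by \<open>c0\<close>.\<close>

theorem ball_of_planar:
  assumes n: "CARD('n) \<ge> 2"
  shows "\<exists>\<phi> r. affine_symplectomorphism \<phi> \<and> r > 0 \<and> \<phi> ` K = cball 0 r"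
proof -
  obtain B where B: "\<And>x. x \<in> K \<Longrightarrow> norm x \<le> B"
    using compact_imp_bounded[OF compact_K] unfolding bounded_iff by blast
  interpret F: planar_foliation Xs L B
  proof
    show "2 \<le> CARD('n)" by (rule n)
    show "norm (Xs w) \<le> B" for w by (rule B) (simp add: Xs_def Xp)
  next
    fix w w' assume "w \<noteq> 0" "w' \<in> L w" "w' \<noteq> 0"
    then show "L w' = L w" "Xs w' - Xs w \<in> L w" using leaf by blast+
  qed (simp_all add: Xs_differentiable Xs_scale Xs_max width_pos L_subspace L_dim L_self)
  obtain c0 a I where a: "a > 0" and I: "linear I" "\<And>v. I (I v) = - v"
    "\<And>u v. omega (I u) v = omega (I v) u" "\<And>w. w \<noteq> 0 \<Longrightarrow> omega (I w) w > 0"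
    and h: "\<And>w. omega (Xs w) w = omega c0 w + sqrt (a * omega (I w) w)"
    by (rule F.support_formula) blast
  obtain T S :: "(real^'n) \<times> (real^'n) \<Rightarrow> (real^'n) \<times> (real^'n)" where TS: "linear T" "linear S" "\<And>x. S (T x) = x" "\<And>x. T (S x) = x"
    and om: "\<And>x y. omega (T x) (T y) = omega x y" and q: "\<And>x. omega (I (T x)) (T x) = x \<bullet> x"
    by (rule symplectic_diagonalization[OF I]) blast+
  define \<phi> where "\<phi> x = S x + (- S c0)" for x
  define \<psi> where "\<psi> y = T y + c0" for y
  have \<phi>\<psi>: "\<phi> (\<psi> y) = y" and \<psi>\<phi>: "\<psi> (\<phi> x) = x" for x y
    by (simp_all add: \<phi>_def \<psi>_def linear_add[OF TS(2)] linear_diff[OF TS(1)] TS)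
  have "omega (S x) (S y) = omega x y" for x y using om[of "S x" "S y"] by (simp add: TS)
  moreover have "bij \<phi>" by (rule o_bij[of \<psi>]) (simp_all add: fun_eq_iff \<phi>\<psi> \<psi>\<phi>)
  ultimately have "affine_symplectomorphism \<phi>"
    unfolding affine_symplectomorphism_def \<phi>_def using TS(2) by blast
  moreover have "\<psi> y \<in> K \<longleftrightarrow> norm y \<le> sqrt a" for y
  proof -
    have "\<psi> y \<in> K \<longleftrightarrow> (\<forall>w. omega (\<psi> y) w \<le> omega c0 w + sqrt (a * omega (I w) w))"
      using support_description h by (subst support_description) simp
    also have "\<dots> \<longleftrightarrow> (\<forall>v. omega (\<psi> y) (T v) \<le> omega c0 (T v) + sqrt (a * omega (I (T v)) (T v)))"
      (is "(\<forall>w. ?P w) \<longleftrightarrow> _")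
    proof (intro iffI allI)
      fix w assume "\<forall>v. ?P (T v)"
      then have "?P (T (S w))" ..
      then show "?P w" unfolding TS(4) .
    qed blast
    also have "\<dots> \<longleftrightarrow> (\<forall>v. omega y v \<le> sqrt a * norm v)"
      by (simp add: q \<psi>_def omega_add_left om real_sqrt_mult norm_eq_sqrt_inner)
    also have "\<dots> \<longleftrightarrow> norm y \<le> sqrt a"
    proof
      assume *: "\<forall>v. omega y v \<le> sqrt a * norm v"
      have "omega y (- rot y) = norm y * norm y" by (simp add: omega_inner rot_minus dot_square_norm power2_eq_square)
      then have "norm y * norm y \<le> sqrt a * norm y" using *[rule_format, of "- rot y"] by simp
      then show "norm y \<le> sqrt a" using a by (cases "y = 0") auto
    next
      assume *: "norm y \<le> sqrt a"
      show "\<forall>v. omega y v \<le> sqrt a * norm v"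
      proof
        fix v
        have "omega y v \<le> norm y * norm v" unfolding omega_inner using norm_cauchy_schwarz[of y "rot v"] by simp
        also have "\<dots> \<le> sqrt a * norm v" using * by (intro mult_right_mono) auto
        finally show "omega y v \<le> sqrt a * norm v" .
      qed
    qed
    finally show ?thesis .
  qed
  then have "\<phi> ` K = cball 0 (sqrt a)"
  proof -
    assume *: "\<And>y. \<psi> y \<in> K \<longleftrightarrow> norm y \<le> sqrt a"
    have "y \<in> \<phi> ` K \<longleftrightarrow> \<psi> y \<in> K" for y by (metis \<phi>\<psi> \<psi>\<phi> image_iff)
    then show ?thesis unfolding set_eq_iff mem_cball_0 using * by blast
  qed
  ultimately show ?thesis using a by (intro exI[of _ \<phi>] exI[of _ "sqrt a"]) simp
qed

end

section \<open>Characteristics of symplectic balls\<close>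

context symplectic_body
begin

text \<open>The symplectomorphism carries characteristics to curves \<open>\<sigma>\<close> on the sphere with
  \<open>\<sigma>' = k rot \<sigma>\<close>. For a vector \<open>e\<close> orthogonal to the initial point \<open>p\<close> and to \<open>rot p\<close>, the
  quantity \<open>(e \<bullet> \<sigma>)\<^sup>2 + (e \<bullet> rot \<sigma>)\<^sup>2\<close> is constant, hence zero, so \<open>\<sigma>\<close> stays in the plane of
  \<open>p\<close> and \<open>rot p\<close>.\<close>

theorem planar_of_ball:
  assumes \<phi>: "affine_symplectomorphism \<phi>" and r: "r > 0" and ball: "\<phi> ` K = cball 0 r"
    and C: "characteristic K C"
  shows "planar C"
proof -
  obtain L a where L: "linear L" and om: "\<And>u v. omega (L u) (L v) = omega u v"
    and \<phi>L: "\<And>x. \<phi> x = L x + a" and bij: "bij \<phi>"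
    using \<phi> unfolding affine_symplectomorphism_def by blast
  have inK: "x \<in> K \<longleftrightarrow> norm (\<phi> x) \<le> r" for x
  proof -
    have "x \<in> K \<longleftrightarrow> \<phi> x \<in> \<phi> ` K" using bij by (simp add: bij_def inj_image_mem_iff)
    then show ?thesis by (simp add: ball)
  qed
  have "inj L"
  proof (rule linear_injective_0[OF L, THEN iffD2], intro allI impI)
    fix x assume "L x = 0"
    then have "omega x y = 0" for y using om[of x y] by (simp add: omega_linear)
    then show "x = 0" by (rule omega_nondegenerate)
  qed
  then obtain S where S: "linear S" "\<And>x. S (L x) = x" "\<And>x. L (S x) = x"
    using linear_injective_isomorphism[OF L] by blast
  have cont: "continuous_on UNIV \<phi>"
    unfolding \<phi>L[abs_def] by (intro continuous_intros linear_continuous_on) (use L in \<open>simp add: linear_conv_bounded_linear\<close>)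
  have on_sphere: "norm (\<phi> z) = r" if z: "z \<in> frontier K" for z
  proof (rule ccontr)
    assume "norm (\<phi> z) \<noteq> r"
    then have "z \<in> \<phi> -` ball 0 r" using z inK[of z] by (auto simp: in_frontier_iff)
    moreover have "open (\<phi> -` ball 0 r)" by (rule open_vimage[OF open_ball cont])
    moreover have "\<phi> -` ball 0 r \<subseteq> K" using inK by auto
    ultimately have "z \<in> interior K" using interior_maximal by blast
    then show False using z by (simp add: in_frontier_iff)
  qed
  have direction: "\<exists>k. L v = k *\<^sub>R rot (\<phi> z)"
    if z: "z \<in> frontier K" and v: "v \<in> characteristic_direction K z" for z v
  proof -
    define l where "l = adjoint L (\<phi> z)"
    have l: "x \<bullet> l = L x \<bullet> \<phi> z" for x by (simp add: l_def adjoint_works[OF L])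
    have "S (\<phi> z) \<bullet> l = r * r" using on_sphere[OF z] by (simp add: l S dot_square_norm power2_eq_square)
    then have l0: "l \<noteq> 0" using r by auto
    have "supports z (l /\<^sub>R norm l)"
    proof (rule supports_normalize[OF l0])
      fix x assume x: "x \<in> K"
      have "(x - z) \<bullet> l = (\<phi> x - \<phi> z) \<bullet> \<phi> z" by (simp add: l \<phi>L linear_diff[OF L])
      also have "\<dots> = \<phi> x \<bullet> \<phi> z - r * r" using on_sphere[OF z] by (simp add: inner_diff_left dot_square_norm power2_eq_square)
      also have "\<phi> x \<bullet> \<phi> z \<le> norm (\<phi> x) * norm (\<phi> z)" by (rule norm_cauchy_schwarz)
      also have "\<dots> \<le> r * r" using x inK on_sphere[OF z] r by (simp add: mult_right_mono)
      finally show "(x - z) \<bullet> l \<le> 0" by simp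
    qed
    then have tan: "w \<in> tangent_space (frontier K) z \<longleftrightarrow> L w \<bullet> \<phi> z = 0" for w
      using l0 by (simp add: tangent_space_eq[OF z] l)
    have "omega (L v) u = 0" if u: "u \<bullet> \<phi> z = 0" for u
    proof -
      have "S u \<in> tangent_space (frontier K) z" using u by (simp add: tan S)
      then have "omega v (S u) = 0" using v by (simp add: characteristic_direction_def)
      then show ?thesis using om[of v "S u"] by (simp add: S)
    qed
    then obtain k where "L v = k *\<^sub>R rot (\<phi> z)" by (rule omega_orthogonal_hyperplane)
    then show ?thesis ..
  qed
  obtain J \<gamma> where arc: "characteristic_arc K J \<gamma>" and C: "C = \<gamma> ` J"
    using C unfolding characteristic_def by blast
  have J: "is_interval J" "J \<noteq> {}" and \<gamma>K: "\<And>t. t \<in> J \<Longrightarrow> \<gamma> t \<in> frontier K"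
    using arc by (auto simp: characteristic_arc_def)
  have d\<gamma>: "\<exists>k. ((\<lambda>t. \<phi> (\<gamma> t)) has_vector_derivative k *\<^sub>R rot (\<phi> (\<gamma> t))) (at t)" if t: "t \<in> J" for t
  proof -
    obtain D where D: "(\<gamma> has_vector_derivative D) (at t)"
      using arc t unfolding characteristic_arc_def C1_differentiable_on_def by blast
    have "D \<in> characteristic_direction K (\<gamma> t)"
      using arc t vector_derivative_at[OF D] unfolding characteristic_arc_def by auto
    then obtain k where k: "L D = k *\<^sub>R rot (\<phi> (\<gamma> t))" using direction[OF \<gamma>K[OF t]] by blast
    have "((\<lambda>t. L (\<gamma> t) + a) has_vector_derivative L D + 0) (at t)"
      using L D by (intro has_vector_derivative_add has_vector_derivative_const
          bounded_linear.has_vector_derivative[OF _ D]) (simp add: linear_conv_bounded_linear)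
    then show ?thesis using k by (auto simp: \<phi>L)
  qed
  then obtain k where k: "\<And>t. t \<in> J \<Longrightarrow> ((\<lambda>t. \<phi> (\<gamma> t)) has_vector_derivative k t *\<^sub>R rot (\<phi> (\<gamma> t))) (at t)"
    by metis
  obtain t0 where t0: "t0 \<in> J" using J(2) by blast
  define p where "p = \<phi> (\<gamma> t0)"
  have pr: "norm p = r" unfolding p_def by (rule on_sphere[OF \<gamma>K[OF t0]])
  have pp: "p \<bullet> p = r * r" using pr by (simp add: dot_square_norm power2_eq_square)
  have orth: "e \<bullet> \<phi> (\<gamma> t) = 0" if e: "e \<bullet> p = 0" "e \<bullet> rot p = 0" and t: "t \<in> J" for e t
  proof -
    define g where "g t = (e \<bullet> \<phi> (\<gamma> t))^2 + (e \<bullet> rot (\<phi> (\<gamma> t)))^2" for t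
    have "(g has_derivative (\<lambda>h. 0)) (at s within J)" if s: "s \<in> J" for s
    proof -
      have 1: "((\<lambda>t. e \<bullet> \<phi> (\<gamma> t)) has_real_derivative k s * (e \<bullet> rot (\<phi> (\<gamma> s)))) (at s)"
        unfolding has_real_derivative_iff_has_vector_derivative
        using bounded_linear.has_vector_derivative[OF bounded_linear_inner_right k[OF s], of e] by simp
      have 2: "((\<lambda>t. e \<bullet> rot (\<phi> (\<gamma> t))) has_real_derivative - (k s * (e \<bullet> \<phi> (\<gamma> s)))) (at s)"
        unfolding has_real_derivative_iff_has_vector_derivative
        using bounded_linear.has_vector_derivative[OF bounded_linear_inner_right
            bounded_linear.has_vector_derivative[OF bounded_linear_rot k[OF s]], of e]
        by (simp add: rot_scaleR)
      have "(g has_real_derivative 0) (at s)"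
        unfolding g_def[abs_def] by (auto intro!: derivative_eq_intros 1 2)
      then show ?thesis
        unfolding has_field_derivative_def lambda_zero by (rule has_derivative_at_withinI)
    qed
    then have "g t = g t0"
      by (rule has_derivative_zero_unique[OF is_interval_convex[OF J(1)] _ t t0])
    also have "\<dots> = 0" using e by (simp add: g_def p_def)
    finally show ?thesis by (simp add: g_def sum_power2_eq_zero_iff)
  qed
  have span: "\<phi> (\<gamma> t) \<in> span {p, rot p}" if t: "t \<in> J" for t
  proof -
    define x where "x = \<phi> (\<gamma> t)"
    define y where "y = ((x \<bullet> p) / (r * r)) *\<^sub>R p + ((x \<bullet> rot p) / (r * r)) *\<^sub>R rot p"
    define e where "e = x - y"
    have rp: "rot p \<bullet> p = 0" using inner_rot_self[of p] by (simp only: inner_commute)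
    have e: "e \<bullet> p = 0" "e \<bullet> rot p = 0"
      using r by (simp_all add: e_def y_def inner_diff_left inner_add_left pp rp)
    have "e \<bullet> x = 0" unfolding x_def by (rule orth[OF e t])
    moreover have "e \<bullet> y = 0" using e by (simp add: y_def inner_add_right)
    ultimately have "e \<bullet> e = 0" by (simp add: e_def inner_diff_right)
    then have "x = y" by (simp add: e_def)
    moreover have "y \<in> span {p, rot p}"
      unfolding y_def by (intro span_add span_scale span_base) auto
    ultimately show ?thesis by (simp add: x_def)
  qed
  define V where "V = S ` span {p, rot p}"
  define P where "P = (+) (- S a) ` V"
  have V: "subspace V" unfolding V_def by (rule linear_subspace_image[OF S(1) subspace_span])
  have "inj S" by (rule inj_on_inverseI[of _ L]) (simp add: S)
  have "dim (span {p, rot p}) = 2" by (rule dim_span_pair) (use pp r in \<open>simp add: omega_inner\<close>)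
  then have dimV: "dim V = 2"
    unfolding V_def using dim_image_eq[OF S(1), of "span {p, rot p}"] \<open>inj S\<close> inj_on_subset by auto
  have "affine P" unfolding P_def using subspace_imp_affine[OF V] affine_translation by blast
  moreover have "aff_dim P = 2" unfolding P_def aff_dim_translation_eq using aff_dim_subspace[OF V] dimV by simp
  moreover have "C \<subseteq> P"
  proof
    fix x assume "x \<in> C"
    then obtain t where t: "t \<in> J" "x = \<gamma> t" using C by blast
    have "S (\<phi> x) = x + S a" by (simp add: \<phi>L linear_add[OF S(1)] S)
    then have "x = - S a + S (\<phi> x)" by simp
    moreover have "S (\<phi> x) \<in> V" using span[OF t(1)] t(2) by (auto simp: V_def)
    ultimately show "x \<in> P" unfolding P_def by (rule image_eqI)
  qed
  ultimately show ?thesis unfolding planar_def by blast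
qed

end

theorem theorem1p3:
  fixes K :: "((real^'n::finite) \<times> (real^'n)) set"
  assumes "CARD('n) \<ge> 2"
    and "convex_body K"
    and "smooth_boundary K"
    and "strongly_convex K"
  shows "(\<forall>C. characteristic K C \<longrightarrow> planar C) \<longleftrightarrow>
         (\<exists>\<phi> r. affine_symplectomorphism \<phi> \<and> r > 0 \<and> \<phi> ` K = cball 0 r)"
proof
  assume planar: "\<forall>C. characteristic K C \<longrightarrow> planar C"
  interpret planar_characteristics K
    using assms(2-4) planar by unfold_locales auto
  show "\<exists>\<phi> r. affine_symplectomorphism \<phi> \<and> r > 0 \<and> \<phi> ` K = cball 0 r"
    by (rule ball_of_planar[OF assms(1)])
next
  assume "\<exists>\<phi> r. affine_symplectomorphism \<phi> \<and> r > 0 \<and> \<phi> ` K = cball 0 r"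
  then obtain \<phi> r where \<phi>: "affine_symplectomorphism \<phi>" "r > 0" "\<phi> ` K = cball 0 r" by blast
  interpret symplectic_body K
    using assms(2-4) by unfold_locales auto
  show "\<forall>C. characteristic K C \<longrightarrow> planar C"
    using planar_of_ball[OF \<phi>] by blast
qed

end
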